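(* Let $g\ge1$, $G=\mathrm{USp}_{2g}$, and let $F$ be a continuous complex-valued central function on $G$ (i.e. constant on conjugacy classes). Then $$\int_G F(m)\,dm=\int_{\Sigma_g}\widetilde F(s)\,\nu_g(s)\,ds,\qquad ds=ds_1\cdots ds_g,$$ where $$\nu_g(s)=\frac{1}{(2\pi)^g}\sqrt{d_0(s)\,d_1(s)}.$$
   Context: $\mathrm{USp}_{2g}=\{m\in \mathrm{GL}_{2g}(\mathbb{C}) : {}^t m J m=J,\ {}^t m\,\bar m=I_{2g}\}$ with $J=\begin{pmatrix}0&I_g\\-I_g&0\end{pmatrix}$; $dm$ is the Haar measure of total mass $1$. For $\theta=(\theta_1,\dots,\theta_g)$, $h(\theta)=\mathrm{diag}(e^{i\theta_1},\dots,e^{i\theta_g},e^{-i\theta_1},\dots,e^{-i\theta_g})\in G$. The Viète map is $\mathsf{s}(t)=(s_1(t),\dots,s_g(t))$ for $t=(t_1,\dots,t_g)$, where $s_n(t)$ is the elementary symmetric polynomial of degree $n$. Put $I_g=[-2,2]^g$ and $\Sigma_g=\mathsf{s}(I_g)\subset\mathbb{R}^g$ (the symmetric alcove). For $F$ continuous and central on $G$, $\widetilde F$ is the unique continuous function on $\Sigma_g$ such that $\widetilde F(\mathsf{s}(2\cos\theta_1,\dots,2\cos\theta_g))=F(h(\theta_1,\dots,\theta_g))$ for all $\theta\in[0,\pi]^g$. $d_0,d_1\in\mathbb{Z}[s_1,\dots,s_g]$ are the unique polynomials such that $d_0(\mathsf{s}(t))=\prod_{j<k}(t_k-t_j)^2$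 and $d_1(\mathsf{s}(t))=\prod_{j=1}^g(4-t_j^2)$. *)

theory Defs
  imports "HOL-Analysis.Analysis" "HOL-Probability.Probability_Measure" "HOL-Library.Poly_Mapping"
begin

text \<open>
  The rank \<open>g\<close> is \<open>CARD('n)\<close> for a finite linearly ordered index type \<open>'n\<close>; types are
  nonempty, so \<open>g \<ge> 1\<close>. Matrices of size \<open>2g\<close> are indexed by \<open>'n + 'n\<close>, where \<open>Inl\<close> gives
  the first and \<open>Inr\<close> the second block of \<open>g\<close> indices.
\<close>

section \<open>The compact symplectic group\<close>

definition symp_J :: "complex ^ ('n + 'n) ^ ('n + 'n::finite)" where
  "symp_J = (\<chi> a b. case (a, b) of
       (Inl i, Inr j) \<Rightarrow> if i = j then 1 else 0
     | (Inr i, Inl j) \<Rightarrow> if i = j then -1 else 0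
     | _ \<Rightarrow> 0)"

definition cnj_matrix :: "complex ^ 'm ^ 'k \<Rightarrow> complex ^ 'm ^ 'k" where
  "cnj_matrix A = (\<chi> a b. cnj (A $ a $ b))"

definition USp :: "(complex ^ ('n + 'n) ^ ('n + 'n::finite)) set" where
  "USp = {m. invertible m \<and> transpose m ** symp_J ** m = symp_J \<and>
             transpose m ** cnj_matrix m = mat 1}"

definition torus_elt :: "real ^ 'n \<Rightarrow> complex ^ ('n + 'n) ^ ('n + 'n::finite)" where
  "torus_elt \<theta> = (\<chi> a b. if a = b
     then (case a of Inl j \<Rightarrow> exp (\<i> * complex_of_real (\<theta> $ j))
                   | Inr j \<Rightarrow> exp (- \<i> * complex_of_real (\<theta> $ j)))
     else 0)"

text \<open>
  Regularity of the Haar measure is not required explicitly: it is automatic for Borel probability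
  measures on a compact metrizable group.
\<close>

definition normalized_haar_measure ::
    "(complex ^ 'k ^ 'k) set \<Rightarrow> (complex ^ 'k ^ 'k) measure \<Rightarrow> bool" where
  "normalized_haar_measure G M \<longleftrightarrow>
     prob_space M \<and> sets M = sets (restrict_space borel G) \<and>
     (\<forall>a\<in>G. distr M M (\<lambda>m. a ** m) = M)"

definition central_on :: "(complex ^ 'k ^ 'k) set \<Rightarrow> (complex ^ 'k ^ 'k \<Rightarrow> complex) \<Rightarrow> bool" where
  "central_on G F \<longleftrightarrow> (\<forall>m\<in>G. \<forall>x\<in>G. F (x ** m ** matrix_inv x) = F m)"


section \<open>The Viete map and the symmetric alcove\<close>

definition elem_sym :: "nat \<Rightarrow> real ^ 'n \<Rightarrow> real" where
  "elem_sym n t = (\<Sum>S | S \<subseteq> UNIV \<and> card S = n. \<Prod>i\<in>S. t $ i)"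

text \<open>
  The \<open>k\<close>-th smallest index \<open>i\<close> satisfies \<open>card {..i} = k\<close>, so the coordinates of the
  Viete map, in increasing order of the index, are \<open>s\<^sub>1, \<dots>, s\<^sub>g\<close>.
\<close>

definition viete :: "real ^ ('n::{finite,linorder}) \<Rightarrow> real ^ ('n::{finite,linorder})" where
  "viete t = (\<chi> i. elem_sym (card {..i}) t)"

definition sym_alcove :: "(real ^ ('n::{finite,linorder})) set" where
  "sym_alcove = viete ` {t. \<forall>i. t $ i \<in> {-2..2}}"

text \<open>Extensionality only pins down the irrelevant values outside \<open>sym_alcove\<close>.\<close>

definition alcove_fun ::
    "(complex ^ ('n + 'n) ^ ('n + 'n::{finite,linorder}) \<Rightarrow> complex)
     \<Rightarrow> real ^ ('n::{finite,linorder}) \<Rightarrow> complex" where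
  "alcove_fun F = (THE f. f \<in> extensional sym_alcove \<and> continuous_on sym_alcove f \<and>
     (\<forall>\<theta>. (\<forall>i. \<theta> $ i \<in> {0..pi}) \<longrightarrow>
        f (viete (\<chi> i. 2 * cos (\<theta> $ i))) = F (torus_elt \<theta>)))"


section \<open>The polynomials \<open>d\<^sub>0\<close>, \<open>d\<^sub>1\<close> and the density\<close>

text \<open>
  \<open>('n \<Rightarrow>\<^sub>0 nat) \<Rightarrow>\<^sub>0 int\<close> is the ring of integer polynomials in variables indexed by \<open>'n\<close>, a
  polynomial being the finitely supported map from exponent vectors to coefficients.
\<close>

type_synonym 'n int_mpoly = "('n \<Rightarrow>\<^sub>0 nat) \<Rightarrow>\<^sub>0 int"

definition mpoly_eval :: "('n::finite) int_mpoly \<Rightarrow> real ^ 'n \<Rightarrow> real" where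
  "mpoly_eval p x = (\<Sum>e\<in>Poly_Mapping.keys p.
     real_of_int (Poly_Mapping.lookup p e) * (\<Prod>i\<in>UNIV. (x $ i) ^ Poly_Mapping.lookup e i))"

definition d0 :: "('n::{finite,linorder}) int_mpoly" where
  "d0 = (THE p. \<forall>t. mpoly_eval p (viete t) = (\<Prod>(j, k) | j < k. (t $ k - t $ j)\<^sup>2))"

definition d1 :: "('n::{finite,linorder}) int_mpoly" where
  "d1 = (THE p. \<forall>t. mpoly_eval p (viete t) = (\<Prod>j\<in>UNIV. 4 - (t $ j)\<^sup>2))"

definition nu :: "real ^ ('n::{finite,linorder}) \<Rightarrow> real" where
  "nu s = 1 / (2 * pi) ^ CARD('n) * sqrt (mpoly_eval d0 s * mpoly_eval d1 s)"

end

theory Submission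
  imports Defs "HOL-Computational_Algebra.Polynomial"
begin

text \<open>
  Let \<open>p\<^sub>k = tr m\<^sup>k\<close>. Both the Haar integral and the integral over \<open>[-2,2]\<^sup>g\<close> against the Weyl density
  satisfy the same loop (Schwinger-Dyson) equations for monomials in the \<open>p\<^sub>k\<close>. On the Haar side they
  come from left invariance along the one-parameter subgroups generated by
  \<open>i (v v\<^sup>* - \<sigma>(v v\<^sup>*))\<close>, where \<open>\<sigma>\<close> is the adjoint with respect to \<open>J\<close>; polarization turns
  these into a sum over elementary matrices, i.e. over the Casimir element. On the Weyl side they
  come from integration by parts, since the density vanishes on the boundary. In a
  finite-dimensional space of polynomials of bounded weighted degree, a function orthogonal to
  all loop expressions has vanishing weighted Dirichlet form and is therefore constant, so the
  loop equations determine the functional up to a factor. The factor is the total mass, computed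
  from the orthogonality of Chebyshev polynomials. Diagonalization in \<open>USp\<close>, the Jacobian of the
  Viete map (the Vandermonde determinant) and the Stone-Weierstrass theorem give the rest.
\<close>

section \<open>Elementary symmetric polynomials and the Jacobian of the Viete map\<close>

text \<open>Both families of loop equations say that a monomial times the gradient of a power sum
  \<open>p_k\<close> has a divergence of integral zero; in the coordinates t = 2 cos \<theta> this
  gradient has the components (4 - t_i^2) times the partial derivatives of \<open>p_k\<close>.
  Pairing such a divergence with a function f moves the derivative to f and leaves the integral of
  the monomial times the inner product of the gradients of \<open>p_k\<close> and f. If f is itself
  a polynomial in the \<open>p_k\<close>, the chain rule assembles these into its Dirichlet energy.
  The weighted degree of a loop expression is bounded by that of its monomial times
  \<open>p_k\<close>, which keeps the argument inside one finite-dimensional space. Of the two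
  Vandermonde factors of the Weyl density one is the Jacobian of the Viete map, the other is the
  square root of \<open>d0\<close>. The constant arises from the total mass g! (2 pi)^g, where g!
  counts the chambers that the Viete map identifies. Eigenangles are chosen matrix by matrix, so
  their measurability is unknown; integrability is instead read off from traces and from
  \<open>F\<close> itself.\<close>

definition esym :: "'i set \<Rightarrow> nat \<Rightarrow> ('i \<Rightarrow> 'a::comm_ring_1) \<Rightarrow> 'a" where
  "esym A n t = (\<Sum>S | S \<subseteq> A \<and> card S = n. \<Prod>i\<in>S. t i)"

lemma elem_sym_eq_esym: "elem_sym n t = esym UNIV n (($) t)"
  by (simp add: elem_sym_def esym_def)

lemma esym_0 [simp]: "finite A \<Longrightarrow> esym A 0 t = 1"
proof -
  assume "finite A"
  then have "{S. S \<subseteq> A \<and> card S = 0} = {{}}"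
    using finite_subset by fastforce
  then show ?thesis by (simp add: esym_def)
qed

lemma esym_eq_0: "finite A \<Longrightarrow> card A < n \<Longrightarrow> esym A n t = 0"
proof -
  assume "finite A" "card A < n"
  then have "{S. S \<subseteq> A \<and> card S = n} = {}"
    by (auto dest: card_mono)
  then show ?thesis by (simp only: esym_def sum.empty)
qed

lemma esym_empty_Suc [simp]: "esym {} (Suc n) t = 0"
  by (rule esym_eq_0) auto

lemma esym_insert:
  assumes "finite A" "a \<notin> A"
  shows "esym (insert a A) (Suc n) t = esym A (Suc n) t + t a * esym A n t"
proof -
  have eq: "{S. S \<subseteq> insert a A \<and> card S = Suc n} =
      {S. S \<subseteq> A \<and> card S = Suc n} \<union> insert a ` {S. S \<subseteq> A \<and> card S = n}" (is "?L = ?R1 \<union> ?R2")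
  proof (intro equalityI subsetI)
    fix S assume S: "S \<in> ?L"
    show "S \<in> ?R1 \<union> ?R2"
    proof (cases "a \<in> S")
      case True
      have "S = insert a (S - {a})" "S - {a} \<subseteq> A" "card (S - {a}) = n"
        using S True by auto
      then show ?thesis by blast
    qed (use S in auto)
  next
    fix S assume "S \<in> ?R1 \<union> ?R2"
    then show "S \<in> ?L"
      using assms finite_subset[OF _ assms(1)] by (auto simp: card_insert_if)
  qed
  have fin: "finite ?R1" "finite {S. S \<subseteq> A \<and> card S = n}" using assms(1) by auto
  have inj: "inj_on (insert a) {S. S \<subseteq> A \<and> card S = n}"
    using assms(2) by (auto simp: inj_on_def)
  have "esym (insert a A) (Suc n) t = (\<Sum>S\<in>?R1. \<Prod>i\<in>S. t i) + (\<Sum>S\<in>?R2. \<Prod>i\<in>S. t i)"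
    unfolding esym_def eq using fin assms(2) by (intro sum.union_disjoint) auto
  also have "(\<Sum>S\<in>?R2. \<Prod>i\<in>S. t i) = (\<Sum>S | S \<subseteq> A \<and> card S = n. t a * (\<Prod>i\<in>S. t i))"
    unfolding sum.reindex[OF inj] o_def
    using assms finite_subset[OF _ assms(1)] by (intro sum.cong refl prod.insert) auto
  finally show ?thesis by (simp add: esym_def sum_distrib_left)
qed

lemma esym_remove:
  assumes "finite A" "a \<in> A"
  shows "esym A (Suc n) t = esym (A - {a}) (Suc n) t + t a * esym (A - {a}) n t"
  using esym_insert[of "A - {a}" a n t] assms by (simp add: insert_absorb)

lemma prod_add_eq_esym:
  assumes "finite A"
  shows "(\<Prod>i\<in>A. x + t i) = (\<Sum>n\<le>card A. esym A n t * x ^ (card A - n))"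
proof -
  have "(\<Prod>i\<in>A. x + t i) = (\<Prod>i\<in>A. t i + x)"
    by (simp add: add.commute)
  also have "\<dots> = (\<Sum>X\<in>Pow A. (\<Prod>i\<in>X. t i) * x ^ card (A - X))"
    by (simp add: prod_add[OF assms])
  also have "\<dots> = (\<Sum>n\<le>card A. \<Sum>X | X \<in> Pow A \<and> card X = n. (\<Prod>i\<in>X. t i) * x ^ card (A - X))"
    using assms by (intro sum.group[symmetric]) (auto intro: card_mono)
  also have "\<dots> = (\<Sum>n\<le>card A. esym A n t * x ^ (card A - n))"
    unfolding esym_def sum_distrib_right
    using assms finite_subset[OF _ assms] by (intro sum.cong) (auto simp: card_Diff_subset)
  finally show ?thesis .
qed

text \<open>Double counting: an \<open>n\<close>-element subset of \<open>A\<close> avoids exactly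
  \<open>card A - n\<close> elements \<open>j\<close>. The difference is taken in the ring because
  \<open>n\<close> may exceed \<open>card A\<close>.\<close>

lemma sum_esym_remove:
  assumes "finite A"
  shows "(\<Sum>j\<in>A. esym (A - {j}) n t) = (of_nat (card A) - of_nat n) * esym A n t"
  using assms
proof (induction A arbitrary: n rule: finite_induct)
  case empty
  then show ?case by (cases n) auto
next
  case (insert a A)
  show ?case
  proof (cases n)
    case 0
    then show ?thesis using insert by simp
  next
    case (Suc m)
    have 1: "esym (insert a A - {j}) n t = esym (A - {j}) (Suc m) t + t a * esym (A - {j}) m t"
      if "j \<in> A" for j
    proof -
      have "insert a A - {j} = insert a (A - {j})" using that insert by auto
      then show ?thesis using insert Suc by (simp add: esym_insert)
    qed
    have "(\<Sum>j\<in>insert a A. esym (insert a A - {j}) n t) =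
        esym A n t + (\<Sum>j\<in>A. esym (insert a A - {j}) n t)"
      using insert by simp
    also have "(\<Sum>j\<in>A. esym (insert a A - {j}) n t) =
        (\<Sum>j\<in>A. esym (A - {j}) (Suc m) t) + t a * (\<Sum>j\<in>A. esym (A - {j}) m t)"
      by (simp add: 1 sum.distrib sum_distrib_left)
    finally show ?thesis
      using insert Suc by (simp add: esym_insert algebra_simps)
  qed
qed

text \<open>Iterates \<open>esym_remove\<close>; in generating functions this is the division of the
  product over \<open>A\<close> by its factor at \<open>j\<close>. The left side becomes a
  polynomial in \<open>t j\<close> whose coefficients do not depend on \<open>j\<close>, which is
  what \<open>abs_det_viete_jac\<close> uses.\<close>

lemma esym_remove_expand:
  assumes "finite A" "j \<in> A"
  shows "esym (A - {j}) n t = (\<Sum>m\<le>n. (- t j) ^ m * esym A (n - m) t)"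
proof (induction n)
  case 0
  then show ?case using assms by simp
next
  case (Suc n)
  have "esym (A - {j}) (Suc n) t = esym A (Suc n) t + (- t j) * esym (A - {j}) n t"
    using esym_remove[OF assms, of n t] by (simp add: algebra_simps)
  also have "\<dots> = esym A (Suc n) t + (\<Sum>m\<le>n. (- t j) ^ Suc m * esym A (Suc n - Suc m) t)"
    by (simp add: Suc.IH sum_distrib_left mult.assoc)
  also have "\<dots> = (\<Sum>m\<le>Suc n. (- t j) ^ m * esym A (Suc n - m) t)"
    by (simp add: sum.atMost_Suc_shift del: sum.atMost_Suc)
  finally show ?case .
qed

text \<open>Summing \<open>esym_remove_expand\<close> over \<open>j\<close> must agree with
  \<open>sum_esym_remove\<close>; the term \<open>m = 0\<close> cancels the part with
  \<open>card A\<close>. The alternating signs of Newton's identities sit inside the powers of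
  \<open>- t j\<close>.\<close>

lemma newton_identity:
  assumes "finite A"
  shows "(\<Sum>m\<in>{1..n}. (\<Sum>j\<in>A. (- t j) ^ m) * esym A (n - m) t) = - of_nat n * esym A n t"
proof -
  have "(of_nat (card A) - of_nat n) * esym A n t = (\<Sum>j\<in>A. \<Sum>m\<le>n. (- t j) ^ m * esym A (n - m) t)"
    unfolding sum_esym_remove[OF assms, symmetric]
    using assms by (intro sum.cong refl) (simp add: esym_remove_expand)
  also have "\<dots> = (\<Sum>m\<le>n. (\<Sum>j\<in>A. (- t j) ^ m) * esym A (n - m) t)"
    by (subst sum.swap) (simp add: sum_distrib_right)
  also have "\<dots> = of_nat (card A) * esym A n t + (\<Sum>m\<in>{1..n}. (\<Sum>j\<in>A. (- t j) ^ m) * esym A (n - m) t)"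
    by (simp add: sum.atMost_shift sum.atLeast1_atMost_eq)
  finally show ?thesis by (simp add: algebra_simps eq_neg_iff_add_eq_0)
qed

text \<open>The zero-based rank \<open>card {..<i}\<close> is \<open>n - 1\<close> for the index \<open>i\<close> of the coordinate \<open>s\<^sub>n\<close>.\<close>

abbreviation rk :: "'n::{finite,linorder} \<Rightarrow> nat" where
  "rk i \<equiv> card {..<i}"

lemma card_atMost_eq: "card {..i::'n::{finite,linorder}} = Suc (rk i)"
proof -
  have "{..i} = insert i {..<i}" by auto
  then show ?thesis by simp
qed

lemma rk_less_iff [simp]: "rk i < rk j \<longleftrightarrow> i < (j::'n::{finite,linorder})"
proof -
  have *: "rk i < rk j" if "i < j" for i j :: 'n
    using that by (intro psubset_card_mono) auto
  show ?thesis using *[of i j] *[of j i] by (cases i j rule: linorder_cases) auto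
qed

lemma rk_le_iff [simp]: "rk i \<le> rk j \<longleftrightarrow> i \<le> (j::'n::{finite,linorder})"
  by (meson not_less rk_less_iff)

lemma rk_eq_iff [simp]: "rk i = rk j \<longleftrightarrow> i = (j::'n::{finite,linorder})"
  by (metis rk_le_iff order_antisym order_refl)

lemma bij_rk: "bij_betw (rk :: 'n::{finite,linorder} \<Rightarrow> nat) UNIV {..<CARD('n)}"
proof -
  have inj: "inj (rk :: 'n \<Rightarrow> nat)" by (auto simp: inj_def)
  have sub: "range (rk :: 'n \<Rightarrow> nat) \<subseteq> {..<CARD('n)}"
    by (auto intro!: psubset_card_mono)
  have "card (range (rk :: 'n \<Rightarrow> nat)) = CARD('n)"
    using card_image[OF inj] by simp
  then have "range (rk :: 'n \<Rightarrow> nat) = {..<CARD('n)}"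
    using sub by (intro card_subset_eq) auto
  then show ?thesis using inj by (simp add: bij_betw_def)
qed

lemma sum_rk: "(\<Sum>i\<in>(UNIV::'n::{finite,linorder} set). f (rk i)) = (\<Sum>k<CARD('n). f k)"
  using sum.reindex_bij_betw[OF bij_rk] by simp

section \<open>Triangular and Vandermonde-type determinants\<close>

lemma permutes_le_imp_id:
  fixes p :: "'n::{finite,linorder} \<Rightarrow> 'n"
  assumes "p permutes UNIV" "\<And>i. p i \<le> i"
  shows "p = id"
proof (rule ccontr)
  assume "p \<noteq> id"
  then have ne: "{i. p i \<noteq> i} \<noteq> {}" by auto
  define i where "i = Min {i. p i \<noteq> i}"
  have i: "p i \<noteq> i" using Min_in[OF _ ne] by (simp add: i_def)
  then have "p i < i" using assms(2)[of i] by simp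
  moreover have "i \<le> j" if "p j \<noteq> j" for j
    unfolding i_def using that by (intro Min_le) auto
  \<comment> \<open>Minimality of \<open>i\<close> makes the smaller point \<open>p i\<close> a
    fixed point, so \<open>p\<close> takes the same value at \<open>p i\<close> and at
    \<open>i\<close>.\<close>
  ultimately have "p (p i) = p i" using leD by blast
  then show False using i permutes_inj[OF assms(1)] by (auto simp: inj_def)
qed

lemma det_triangular:
  fixes A :: "'a::comm_ring_1 ^ 'n::{finite,linorder} ^ 'n::_"
  assumes "\<And>i j. i < j \<Longrightarrow> A $ i $ j = 0"
  shows "det A = (\<Prod>i\<in>UNIV. A $ i $ i)"
proof -
  have "det A = (\<Sum>p | p permutes (UNIV :: 'n set). if p = id then (\<Prod>i\<in>UNIV. A $ i $ i) else 0)"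
    unfolding det_def
  proof (rule sum.cong[OF refl])
    fix p :: "'n \<Rightarrow> 'n" assume p: "p \<in> {p. p permutes UNIV}"
    show "of_int (sign p) * (\<Prod>i\<in>UNIV. A $ i $ p i) =
        (if p = id then (\<Prod>i\<in>UNIV. A $ i $ i) else 0)"
    proof (cases "p = id")
      case False
      then obtain i where "\<not> p i \<le> i" using permutes_le_imp_id p by blast
      then have "A $ i $ p i = 0" by (simp add: assms)
      then have "(\<Prod>i\<in>UNIV. A $ i $ p i) = 0" by (meson UNIV_I finite prod_zero)
      then show ?thesis using False by simp
    qed (simp add: sign_id)
  qed
  then show ?thesis by (simp add: permutes_id)
qed

definition vdm :: "real ^ 'n::{finite,linorder} \<Rightarrow> real" where
  "vdm t = (\<Prod>(j, k) | j < k. t $ k - t $ j)"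

text \<open>The matrix factors through the triangular matrix of coefficients; for the Newton basis
  the values at the nodes are triangular as well.\<close>

lemma det_poly_family:
  fixes t :: "real ^ 'n::{finite,linorder}" and f :: "'n \<Rightarrow> real poly"
  assumes deg: "\<And>i. degree (f i) \<le> rk i"
  shows "det (\<chi> k i. poly (f i) (t $ k)) = (\<Prod>i\<in>UNIV. coeff (f i) (rk i)) * vdm t"
proof -
  define V :: "real ^ 'n::_ ^ 'n::_" where "V = (\<chi> k m. (t $ k) ^ rk m)"
  have factor: "det (\<chi> k i. poly (g i) (t $ k)) = det V * (\<Prod>i\<in>UNIV. coeff (g i) (rk i))"
    if deg: "\<And>i. degree (g i) \<le> rk i" for g :: "'n \<Rightarrow> real poly"
  proof -
    define C :: "real ^ 'n::_ ^ 'n::_" where "C = (\<chi> i m. coeff (g i) (rk m))"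
    have "(\<chi> k i. poly (g i) (t $ k)) = V ** transpose C"
    proof -
      have "poly (g i) (t $ k) = (\<Sum>m\<in>(UNIV::'n set). (t $ k) ^ rk m * coeff (g i) (rk m))" for i k
      proof -
        have "rk i < CARD('n)" using bij_rk[where 'n='n] by (auto simp: bij_betw_def)
        then have lt: "degree (g i) < CARD('n)" using deg[of i] by simp
        have "poly (g i) (t $ k) = (\<Sum>m\<le>degree (g i). coeff (g i) m * (t $ k) ^ m)"
          by (rule poly_altdef)
        also have "\<dots> = (\<Sum>m<CARD('n). coeff (g i) m * (t $ k) ^ m)"
          using lt by (intro sum.mono_neutral_left) (auto intro!: coeff_eq_0)
        also have "\<dots> = (\<Sum>m\<in>(UNIV::'n set). (t $ k) ^ rk m * coeff (g i) (rk m))"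
          unfolding sum_rk[symmetric] by (simp add: mult.commute)
        finally show ?thesis .
      qed
      then show ?thesis
        by (simp add: vec_eq_iff matrix_matrix_mult_def transpose_def V_def C_def)
    qed
    moreover have "det C = (\<Prod>i\<in>UNIV. C $ i $ i)"
    proof (rule det_triangular)
      fix i j :: 'n assume "i < j"
      then have "degree (g i) < rk j" using deg[of i] le_less_trans rk_less_iff by blast
      then show "C $ i $ j = 0" by (simp add: C_def coeff_eq_0)
    qed
    ultimately show ?thesis by (simp add: det_mul det_transpose C_def)
  qed
  define N :: "'n \<Rightarrow> real poly" where "N i = (\<Prod>l\<in>{..<i}. [:- (t $ l), 1:])" for i
  have degN: "degree (N i) = rk i" for i
    unfolding N_def by (subst degree_prod_eq_sum_degree) auto
  have lc: "coeff (N i) (rk i) = 1" for i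
    using lead_coeff_prod[of "\<lambda>l. [:- (t $ l), 1:]" "{..<i}"] degN[of i]
    by (simp add: N_def)
  have "det V = det (\<chi> k i. poly (N i) (t $ k))"
    using factor[of N] by (simp add: degN lc)
  also have "\<dots> = (\<Prod>i\<in>UNIV. poly (N i) (t $ i))"
  proof (subst det_triangular)
    fix k i :: 'n assume "k < i"
    then show "(\<chi> k i. poly (N i) (t $ k)) $ k $ i = 0"
      by (auto simp: N_def poly_prod)
  qed simp
  also have "\<dots> = (\<Prod>i\<in>UNIV. \<Prod>l\<in>{..<i}. t $ i - t $ l)"
    by (simp add: N_def poly_prod)
  also have "\<dots> = (\<Prod>(i, l)\<in>(SIGMA i:UNIV. {..<i}). t $ i - t $ l)"
    by (subst prod.Sigma) auto
  also have "\<dots> = vdm t"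
    unfolding vdm_def
    by (rule prod.reindex_bij_witness[of _ "\<lambda>(a,b). (b,a)" "\<lambda>(a,b). (b,a)"]) auto
  finally show ?thesis using factor[OF deg] by simp
qed

text \<open>The Jacobian matrix of \<open>viete\<close>: the derivative of an elementary symmetric
  polynomial in one variable is the one of the next lower degree in the remaining variables, and
  coordinate \<open>i\<close> of \<open>viete\<close> has degree \<open>rk i + 1\<close>.\<close>

definition viete_jac :: "real ^ 'n::{finite,linorder} \<Rightarrow> real ^ 'n::_ ^ 'n::_" where
  "viete_jac t = (\<chi> i j. esym (UNIV - {j}) (rk i) (($) t))"

text \<open>By \<open>esym_remove_expand\<close>, row \<open>i\<close> consists of the values at the
  points \<open>t $ j\<close> of one polynomial of degree \<open>rk i\<close> with leading
  coefficient \<open>(-1) ^ rk i\<close>, so \<open>det_poly_family\<close> applies to the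
  transpose. The absolute value removes the signs.\<close>

lemma abs_det_viete_jac:
  fixes t :: "real ^ 'n::{finite,linorder}"
  shows "\<bar>det (viete_jac t)\<bar> = \<bar>vdm t\<bar>"
proof -
  define f :: "'n \<Rightarrow> real poly" where
    "f i = (\<Sum>m\<le>rk i. monom ((-1) ^ m * esym UNIV (rk i - m) (($) t)) m)" for i
  have deg: "degree (f i) \<le> rk i" for i
    unfolding f_def by (intro degree_sum_le order.trans[OF degree_monom_le]) auto
  have co: "coeff (f i) (rk i) = (-1) ^ rk i" for i
    by (simp add: f_def coeff_sum)
  have "poly (f i) (t $ k) = esym (UNIV - {k}) (rk i) (($) t)" for i k
    by (subst esym_remove_expand) (simp_all add: f_def poly_sum poly_monom power_minus[of "t $ k"] mult_ac)
  then have "viete_jac t = transpose (\<chi> k i. poly (f i) (t $ k))"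
    by (simp add: viete_jac_def transpose_def vec_eq_iff)
  then have "det (viete_jac t) = (\<Prod>i\<in>UNIV. coeff (f i) (rk i)) * vdm t"
    using det_poly_family[OF deg] by (simp add: det_transpose)
  then show ?thesis by (simp add: co abs_mult abs_prod power_abs)
qed

section \<open>Derivative and fibres of the Viete map\<close>

lemma has_derivative_esym:
  fixes t :: "real ^ 'n::finite"
  assumes "finite A"
  shows "((\<lambda>t. esym A (Suc n) (($) t)) has_derivative
          (\<lambda>h. \<Sum>j\<in>A. esym (A - {j}) n (($) t) * h $ j)) (at t)"
  using assms
proof (induction A arbitrary: n rule: finite_induct)
  case empty
  then show ?case by simp
next
  case (insert a A)
  have ins: "insert a A - {j} = insert a (A - {j})" if "j \<in> A" for j
    using that insert by auto
  have nth: "((\<lambda>t. t $ a) has_derivative (\<lambda>h. h $ a)) (at t)"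
    by (rule bounded_linear_imp_has_derivative[OF bounded_linear_vec_nth])
  show ?case
  proof (cases n)
    case 0
    have "((\<lambda>t. esym A (Suc 0) (($) t) + t $ a) has_derivative
        (\<lambda>h. (\<Sum>j\<in>A. esym (A - {j}) 0 (($) t) * h $ j) + h $ a)) (at t)"
      by (rule has_derivative_add[OF insert.IH nth])
    then show ?thesis using insert 0 by (simp add: esym_insert add.commute)
  next
    case (Suc m)
    have "((\<lambda>t. esym A (Suc n) (($) t) + t $ a * esym A (Suc m) (($) t)) has_derivative
        (\<lambda>h. (\<Sum>j\<in>A. esym (A - {j}) n (($) t) * h $ j) +
             (t $ a * (\<Sum>j\<in>A. esym (A - {j}) m (($) t) * h $ j) + h $ a * esym A (Suc m) (($) t)))) (at t)"
      by (rule has_derivative_add[OF insert.IH has_derivative_mult[OF nth insert.IH]])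
    also have "(\<lambda>h. (\<Sum>j\<in>A. esym (A - {j}) n (($) t) * h $ j) +
             (t $ a * (\<Sum>j\<in>A. esym (A - {j}) m (($) t) * h $ j) + h $ a * esym A (Suc m) (($) t)))
        = (\<lambda>h. \<Sum>j\<in>insert a A. esym (insert a A - {j}) n (($) t) * h $ j)"
      using insert Suc
      by (simp add: ins esym_insert sum_distrib_left sum.distrib algebra_simps)
    finally show ?thesis using insert Suc by (simp add: esym_insert)
  qed
qed

lemma viete_nth: "viete t $ i = esym UNIV (Suc (rk i)) (($) t)"
  by (simp add: viete_def elem_sym_eq_esym card_atMost_eq)

lemma has_derivative_viete:
  fixes t :: "real ^ 'n::{finite,linorder}"
  shows "(viete has_derivative (\<lambda>h. viete_jac t *v h)) (at t)"
proof -
  have "((\<lambda>t. viete t \<bullet> axis i 1) has_derivative (\<lambda>h. (viete_jac t *v h) \<bullet> axis i 1)) (at t)" for i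
    using has_derivative_esym[of UNIV "rk i" t]
    by (simp add: inner_axis viete_nth matrix_vector_mult_def viete_jac_def)
  then show ?thesis
    by (subst has_derivative_componentwise_within) (auto simp: Basis_vec_def)
qed

lemma continuous_viete: "continuous_on S viete"
  by (meson continuous_at_imp_continuous_on has_derivative_continuous has_derivative_viete)

lemma esym_eq_viete:
  fixes s t :: "real ^ 'n::{finite,linorder}"
  assumes "viete s = viete t"
  shows "esym UNIV n (($) s) = esym UNIV n (($) t)"
proof (cases n)
  case (Suc m)
  show ?thesis
  proof (cases "m < CARD('n)")
    case True
    then obtain i :: 'n where "rk i = m" using bij_rk[where 'n='n] unfolding bij_betw_def by (metis imageE lessThan_iff)
    then show ?thesis using assms viete_nth[of s i] viete_nth[of t i] Suc by simp
  qed (use Suc in \<open>simp add: esym_eq_0\<close>)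
qed simp

text \<open>The monic polynomial with roots \<open>- s $ i\<close> has the elementary symmetric
  polynomials as coefficients, so \<open>s\<close> and \<open>t\<close> take every value equally
  often. Bijections between the fibres over each value glue to \<open>p\<close>.\<close>

lemma viete_eq_imp_permutes:
  fixes s t :: "real ^ 'n::{finite,linorder}"
  assumes "viete s = viete t"
  obtains p where "p permutes UNIV" "\<And>i. s $ i = t $ p i"
proof -
  have "(\<Prod>i\<in>UNIV. [:s $ i, 1:]) = (\<Prod>i\<in>UNIV. [:t $ i, 1:])"
  proof -
    have "poly (\<Prod>i\<in>UNIV. [:s $ i, 1:]) x = poly (\<Prod>i\<in>UNIV. [:t $ i, 1:]) x" for x
      using prod_add_eq_esym[of UNIV x "($) s"] prod_add_eq_esym[of UNIV x "($) t"]
      by (simp add: poly_prod add.commute esym_eq_viete[OF assms])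
    then show ?thesis by (simp add: poly_eq_poly_eq_iff[symmetric] fun_eq_iff)
  qed
  then have ord: "order x (\<Prod>i\<in>UNIV. [:s $ i, 1:]) = order x (\<Prod>i\<in>UNIV. [:t $ i, 1:])" for x
    by simp
  have "order x (\<Prod>i\<in>A. [:u $ i, 1:]) = card {i\<in>A. u $ i = - x}"
    for x and u :: "real ^ 'n::_" and A
  proof (induction A rule: infinite_finite_induct)
    case (insert a A)
    have "order x [:u $ a, 1:] = (if u $ a = - x then 1 else 0)"
      using order_power_n_n[of x 1] order_0I[of "[:u $ a, 1:]" x]
      by (auto simp: add_eq_0_iff)
    moreover have "{i \<in> insert a A. u $ i = - x} =
        (if u $ a = - x then insert a {i\<in>A. u $ i = - x} else {i\<in>A. u $ i = - x})"
      by auto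
    moreover have "(\<Prod>i\<in>A. [:u $ i, 1:]) \<noteq> 0" by (simp add: insert)
    ultimately show ?case using insert by (simp add: order_mult del: mult_pCons_left)
  qed auto
  from this[where A=UNIV] have o: "order x (\<Prod>i\<in>UNIV. [:u $ i, 1:]) = card {i. u $ i = - x}"
    for x and u :: "real ^ 'n::_"
    by simp
  have "card {i. s $ i = x} = card {i. t $ i = x}" for x
    using ord[of "-x"] by (simp add: o)
  then have "\<exists>f. bij_betw f {i. s $ i = x} {i. t $ i = x}" for x
    by (intro finite_same_card_bij) auto
  then obtain f where f: "\<And>x. bij_betw (f x) {i. s $ i = x} {i. t $ i = x}" by metis
  define p where "p i = f (s $ i) i" for i
  have tp: "t $ p i = s $ i" for i
    using f[of "s $ i"] by (auto simp: p_def bij_betw_def)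
  have "inj p"
  proof (rule injI)
    fix i j assume eq: "p i = p j"
    then have s: "s $ i = s $ j" using tp[of i] tp[of j] by simp
    then have "f (s $ i) i = f (s $ i) j" using eq by (simp add: p_def)
    then show "i = j"
      using f[of "s $ i"] s by (auto simp: bij_betw_def dest: inj_onD)
  qed
  then have "bij p" by (simp add: finite_UNIV_inj_surj bij_def)
  then have "p permutes UNIV" by (intro bij_imp_permutes) auto
  then show thesis using that tp by metis
qed

lemma esym_permute:
  assumes "p permutes UNIV"
  shows "esym UNIV n (\<lambda>i. t (p i)) = esym (UNIV :: 'i::finite set) n t"
proof -
  have b: "bij_betw ((`) p) {S. S \<subseteq> UNIV \<and> card S = n} {S. S \<subseteq> UNIV \<and> card S = n}"
  proof (rule bij_betwI[where g = "(`) (inv p)"])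
  qed (use assms in \<open>auto simp: card_image permutes_inj_on permutes_inj_on[OF permutes_inv] image_comp permutes_inv_o\<close>)
  have "(\<Prod>i\<in>p ` S. t i) = (\<Prod>i\<in>S. t (p i))" for S
    by (subst prod.reindex) (auto simp: permutes_inj_on[OF assms])
  then show ?thesis
    unfolding esym_def by (subst (2) sum.reindex_bij_betw[OF b, symmetric]) simp
qed

lemma viete_permute:
  fixes t :: "real ^ 'n::{finite,linorder}"
  assumes "p permutes UNIV"
  shows "viete (\<chi> i. t $ p i) = viete t"
proof -
  have "($) (\<chi> i. t $ p i) = (\<lambda>i. t $ p i)" by auto
  then show ?thesis
    using esym_permute[OF assms, of _ "($) t"] by (simp add: vec_eq_iff viete_nth)
qed

section \<open>Symmetric polynomials as polynomials in the Viete coordinates\<close>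

definition mpoly_mono :: "real ^ 'n::finite \<Rightarrow> ('n \<Rightarrow>\<^sub>0 nat) \<Rightarrow> real" where
  "mpoly_mono x e = (\<Prod>i\<in>UNIV. (x $ i) ^ Poly_Mapping.lookup e i)"

lemma mpoly_mono_0 [simp]: "mpoly_mono x 0 = 1"
  by (simp add: mpoly_mono_def)

lemma mpoly_mono_add: "mpoly_mono x (e + f) = mpoly_mono x e * mpoly_mono x f"
  by (simp add: mpoly_mono_def lookup_add power_add prod.distrib)

lemma mpoly_eval_superset:
  assumes "finite K" "Poly_Mapping.keys p \<subseteq> K"
  shows "mpoly_eval p x = (\<Sum>e\<in>K. real_of_int (Poly_Mapping.lookup p e) * mpoly_mono x e)"
  unfolding mpoly_eval_def mpoly_mono_def[symmetric] using assms
  by (intro sum.mono_neutral_left) (auto simp: in_keys_iff)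

lemma mpoly_eval_0 [simp]: "mpoly_eval 0 x = 0"
  by (simp add: mpoly_eval_def)

lemma mpoly_eval_add: "mpoly_eval (p + q) x = mpoly_eval p x + mpoly_eval q x"
proof -
  let ?K = "Poly_Mapping.keys p \<union> Poly_Mapping.keys q"
  have "mpoly_eval (p + q) x = (\<Sum>e\<in>?K. real_of_int (Poly_Mapping.lookup (p + q) e) * mpoly_mono x e)"
    by (intro mpoly_eval_superset) (auto dest!: subsetD[OF Poly_Mapping.keys_add])
  then show ?thesis
    using mpoly_eval_superset[of ?K p x] mpoly_eval_superset[of ?K q x]
    by (simp add: lookup_add algebra_simps sum.distrib)
qed

lemma mpoly_eval_sum: "mpoly_eval (\<Sum>i\<in>I. p i) x = (\<Sum>i\<in>I. mpoly_eval (p i) x)"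
  by (induction I rule: infinite_finite_induct) (auto simp: mpoly_eval_add)

lemma mpoly_eval_single: "mpoly_eval (Poly_Mapping.single e c) x = real_of_int c * mpoly_mono x e"
  by (simp add: mpoly_eval_def mpoly_mono_def)

lemma mpoly_eq_sum_single:
  "p = (\<Sum>e\<in>Poly_Mapping.keys p. Poly_Mapping.single e (Poly_Mapping.lookup p e))"
proof (rule poly_mapping_eqI)
  fix k
  show "Poly_Mapping.lookup p k =
    Poly_Mapping.lookup (\<Sum>e\<in>Poly_Mapping.keys p. Poly_Mapping.single e (Poly_Mapping.lookup p e)) k"
    by (cases "k \<in> Poly_Mapping.keys p")
      (auto simp: lookup_sum lookup_single when_def in_keys_iff)
qed

lemma mpoly_eval_mult: "mpoly_eval (p * q) x = mpoly_eval p x * mpoly_eval q x"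
proof -
  have "p * q = (\<Sum>e\<in>Poly_Mapping.keys p. \<Sum>f\<in>Poly_Mapping.keys q.
      Poly_Mapping.single (e + f) (Poly_Mapping.lookup p e * Poly_Mapping.lookup q f))"
    by (subst mpoly_eq_sum_single[of p], subst mpoly_eq_sum_single[of q])
      (simp only: sum_product mult_single)
  then have "mpoly_eval (p * q) x = (\<Sum>e\<in>Poly_Mapping.keys p. \<Sum>f\<in>Poly_Mapping.keys q.
      (real_of_int (Poly_Mapping.lookup p e) * mpoly_mono x e) *
      (real_of_int (Poly_Mapping.lookup q f) * mpoly_mono x f))"
    by (simp add: mpoly_eval_sum mpoly_eval_single mpoly_mono_add mult_ac)
  then show ?thesis
    by (simp add: mpoly_eval_def mpoly_mono_def sum_product)
qed

lemma mpoly_eval_of_int [simp]: "mpoly_eval (of_int c) x = of_int c"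
  by (simp add: mpoly_eval_single flip: single_of_int)

lemma mpoly_eval_uminus: "mpoly_eval (- p) x = - mpoly_eval p x"
  using mpoly_eval_mult[of "of_int (-1)" p x] mpoly_eval_of_int[of "-1" x] by simp

lemma real_polynomial_function_mpoly_eval: "real_polynomial_function (mpoly_eval p)"
  unfolding mpoly_eval_def
  by (intro real_polynomial_function_sum real_polynomial_function.intros real_polynomial_function_prod
      real_polynomial_function_power bounded_linear_vec_nth) auto

text \<open>Scaling one coordinate by 2 separates two distinct exponent vectors, which
  allows to eliminate one monomial at a time.\<close>

lemma mpoly_mono_independent:
  fixes K :: "('n::finite \<Rightarrow>\<^sub>0 nat) set" and c :: "('n \<Rightarrow>\<^sub>0 nat) \<Rightarrow> real"
  assumes "finite K" "\<And>x. (\<Sum>e\<in>K. c e * mpoly_mono x e) = 0" "e \<in> K"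
  shows "c e = 0"
  using assms
proof (induction "card K" arbitrary: K c e)
  case 0
  then show ?case by simp
next
  case (Suc m)
  show ?case
  proof (cases "K = {e}")
    case True
    have "mpoly_mono (\<chi> i. 1) e = 1" by (simp add: mpoly_mono_def)
    then show ?thesis using Suc.prems(2)[of "\<chi> i. 1"] True by simp
  next
    case False
    then obtain f where f: "f \<in> K" "f \<noteq> e" using Suc.prems(3) by auto
    then obtain i where i: "Poly_Mapping.lookup e i \<noteq> Poly_Mapping.lookup f i"
      by (metis poly_mapping_eqI)
    define d where "d g = c g * (2 ^ Poly_Mapping.lookup g i - 2 ^ Poly_Mapping.lookup f i)" for g
    have scale: "mpoly_mono (\<chi> j. if j = i then 2 * x $ j else x $ j) g =
        2 ^ Poly_Mapping.lookup g i * mpoly_mono x g" for x and g :: "'n \<Rightarrow>\<^sub>0 nat"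
    proof -
      have "mpoly_mono (\<chi> j. if j = i then 2 * x $ j else x $ j) g =
          (\<Prod>j\<in>UNIV. (if j = i then 2 ^ Poly_Mapping.lookup g i else 1) * x $ j ^ Poly_Mapping.lookup g j)"
        unfolding mpoly_mono_def by (intro prod.cong) (auto simp: power_mult_distrib)
      then show ?thesis by (simp add: prod.distrib mpoly_mono_def)
    qed
    have "(\<Sum>g\<in>K - {f}. d g * mpoly_mono x g) = 0" for x
    proof -
      have "(\<Sum>g\<in>K - {f}. d g * mpoly_mono x g) = (\<Sum>g\<in>K. d g * mpoly_mono x g)"
        using Suc.prems(1) by (intro sum.mono_neutral_left) (auto simp: d_def)
      also have "\<dots> = (\<Sum>g\<in>K. c g * mpoly_mono (\<chi> j. if j = i then 2 * x $ j else x $ j) g)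
          - 2 ^ Poly_Mapping.lookup f i * (\<Sum>g\<in>K. c g * mpoly_mono x g)"
        by (simp add: d_def scale sum_distrib_left sum_subtractf[symmetric] algebra_simps)
      also have "\<dots> = 0" using Suc.prems(2) by simp
      finally show ?thesis .
    qed
    moreover have "m = card (K - {f})" using Suc f by simp
    ultimately have "d e = 0" using Suc.hyps(1)[of "K - {f}" d e] Suc.prems f by auto
    then show ?thesis using i by (simp add: d_def)
  qed
qed

text \<open>On the line through \<open>u\<close> and \<open>x\<close> the function is a univariate
  polynomial that vanishes on a neighbourhood of \<open>0\<close>, hence at infinitely many points,
  hence also at \<open>1\<close>, where the line reaches \<open>x\<close>.\<close>

lemma real_polynomial_function_eq_0:
  fixes p :: "'a::euclidean_space \<Rightarrow> real"
  assumes p: "real_polynomial_function p" and U: "open U" "u \<in> U" "\<And>x. x \<in> U \<Longrightarrow> p x = 0"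
  shows "p x = 0"
proof -
  define h where "h y = p (u + y *\<^sub>R (x - u))" for y :: real
  have "real_polynomial_function (p \<circ> (\<lambda>y. u + y *\<^sub>R (x - u)))"
    using p by (intro real_polynomial_function_compose polynomial_function_add)
      (auto intro!: polynomial_function_bounded_linear bounded_linear_scaleR_left)
  moreover have "h = p \<circ> (\<lambda>y. u + y *\<^sub>R (x - u))" by (auto simp: h_def)
  ultimately have "real_polynomial_function h" by simp
  then obtain a n where an: "h = (\<lambda>y. \<Sum>i\<le>n. a i * y ^ i)"
    using real_polynomial_function_imp_sum by blast
  have "open ((\<lambda>y::real. u + y *\<^sub>R (x - u)) -` U)"
    using U(1) by (intro open_vimage continuous_intros)
  moreover have "0 \<in> (\<lambda>y::real. u + y *\<^sub>R (x - u)) -` U" using U by simp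
  ultimately have "infinite ((\<lambda>y::real. u + y *\<^sub>R (x - u)) -` U)"
    using finite_imp_not_open by blast
  moreover have "(\<lambda>y::real. u + y *\<^sub>R (x - u)) -` U \<subseteq> {y. (\<Sum>i\<le>n. a i * y ^ i) = 0}"
    using U(3) fun_cong[OF an, symmetric] by (auto simp: h_def)
  ultimately have "infinite {y. (\<Sum>i\<le>n. a i * y ^ i) = 0}"
    using finite_subset by blast
  then have "\<forall>i\<le>n. a i = 0" using polyfun_finite_roots[of a n] by auto
  then have "h 1 = 0" by (simp add: an)
  then show ?thesis by (simp add: h_def)
qed

lemma mpoly_eq_0:
  assumes "open U" "u \<in> U" "\<And>x. x \<in> U \<Longrightarrow> mpoly_eval p x = 0"
  shows "p = 0"
proof (rule ccontr)
  assume "p \<noteq> 0"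
  then obtain e where e: "e \<in> Poly_Mapping.keys p" by (metis ex_in_conv keys_eq_empty)
  have "mpoly_eval p x = 0" for x
    by (rule real_polynomial_function_eq_0[OF real_polynomial_function_mpoly_eval assms])
  then have "real_of_int (Poly_Mapping.lookup p e) = 0"
    using mpoly_mono_independent[of "Poly_Mapping.keys p" "\<lambda>e. real_of_int (Poly_Mapping.lookup p e)" e] e
    by (simp add: mpoly_eval_def mpoly_mono_def)
  then show False using e by (simp add: in_keys_iff)
qed

section \<open>The Weyl chamber and uniqueness of polynomials in the Viete coordinates\<close>

definition chamber :: "(real ^ 'n::{finite,linorder}) set" where
  "chamber = {t. \<forall>i j. i < j \<longrightarrow> t $ i < t $ j}"

lemma open_chamber: "open (chamber :: (real ^ 'n::{finite,linorder}) set)"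
proof -
  have "chamber = (\<Inter>p\<in>{(i, j). i < j}. {t :: real ^ 'n::_. t $ fst p < t $ snd p})"
    by (auto simp: chamber_def)
  also have "open \<dots>" by (intro open_INT ballI open_Collect_less continuous_intros) auto
  finally show ?thesis .
qed

text \<open>Two increasing arrangements of the same values coincide: the permutation that links them
  is strictly increasing, so it preserves ranks.\<close>

lemma inj_on_viete_chamber: "inj_on viete (chamber :: (real ^ 'n::{finite,linorder}) set)"
proof (rule inj_onI)
  fix s t :: "real ^ 'n::_" assume st: "s \<in> chamber" "t \<in> chamber" "viete s = viete t"
  from viete_eq_imp_permutes[OF st(3)] obtain p
    where p: "p permutes UNIV" "\<And>i. s $ i = t $ p i" by blast
  have mono: "p i < p j" if "i < j" for i j
  proof -
    have "t $ p i < t $ p j" using st that p(2) by (auto simp: chamber_def)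
    then show ?thesis using st(2) unfolding chamber_def
      by (metis (mono_tags, lifting) less_asym linorder_neqE mem_Collect_eq)
  qed
  have "p i = i" for i
  proof -
    have "{..<p i} = p ` {..<i}"
    proof (intro equalityI subsetI)
      fix k assume "k \<in> {..<p i}"
      moreover obtain l where "k = p l" using permutes_surj[OF p(1)] by auto
      ultimately show "k \<in> p ` {..<i}" using mono[of i l] by (cases "l = i") force+
    qed (use mono in auto)
    then have "rk (p i) = rk i" by (simp add: card_image permutes_inj_on[OF p(1)])
    then show ?thesis by simp
  qed
  then show "s = t" using p(2) by (simp add: vec_eq_iff)
qed

text \<open>The image of \<open>viete\<close> is in general not everything, as the polynomial with
  these coefficients must have only real roots. By invariance of domain it contains the nonempty
  open image of the chamber, and \<open>mpoly_eq_0\<close> applies there. This is the uniqueness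
  behind \<open>d0\<close> and \<open>d1\<close>.\<close>

lemma mpoly_eq_if_eq_on_viete:
  fixes p q :: "'n::{finite,linorder} int_mpoly"
  assumes "\<And>t. mpoly_eval p (viete t) = mpoly_eval q (viete t)"
  shows "p = q"
proof -
  have "open (viete ` (chamber :: (real ^ 'n::_) set))"
    by (intro invariance_of_domain continuous_viete open_chamber inj_on_viete_chamber)
  moreover have "viete (\<chi> i::'n. real (rk i)) \<in> viete ` chamber"
    by (auto simp: chamber_def)
  ultimately have "p - q = 0"
    using assms by (rule_tac mpoly_eq_0)
      (auto simp: diff_conv_add_uminus mpoly_eval_add mpoly_eval_uminus simp del: add_uminus_conv_diff)
  then show ?thesis by simp
qed

text \<open>The functions of \<open>t\<close> that are integer polynomials in the Viete coordinates.
  Existence of \<open>d0\<close> and \<open>d1\<close> follows from closure under the ring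
  operations, starting from the elementary symmetric polynomials.\<close>

definition sym_int_poly :: "(real ^ 'n::{finite,linorder} \<Rightarrow> real) \<Rightarrow> bool" where
  "sym_int_poly h \<longleftrightarrow> (\<exists>p :: 'n int_mpoly. \<forall>t. mpoly_eval p (viete t) = h t)"

lemma sym_int_poly_of_int: "sym_int_poly (\<lambda>t. of_int c)"
  unfolding sym_int_poly_def by (rule exI[of _ "of_int c"]) simp

lemma sym_int_poly_add: "sym_int_poly f \<Longrightarrow> sym_int_poly g \<Longrightarrow> sym_int_poly (\<lambda>t. f t + g t)"
  unfolding sym_int_poly_def by (metis mpoly_eval_add)

lemma sym_int_poly_mult: "sym_int_poly f \<Longrightarrow> sym_int_poly g \<Longrightarrow> sym_int_poly (\<lambda>t. f t * g t)"
  unfolding sym_int_poly_def by (metis mpoly_eval_mult)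

lemma sym_int_poly_uminus: "sym_int_poly f \<Longrightarrow> sym_int_poly (\<lambda>t. - f t)"
  unfolding sym_int_poly_def by (metis mpoly_eval_uminus)

lemma sym_int_poly_sum:
  assumes "\<And>i. i \<in> I \<Longrightarrow> sym_int_poly (f i)"
  shows "sym_int_poly (\<lambda>t. \<Sum>i\<in>I. f i t)"
  using assms sym_int_poly_of_int[of 0]
  by (induction I rule: infinite_finite_induct) (auto intro: sym_int_poly_add)

lemma sym_int_poly_prod:
  assumes "\<And>i. i \<in> I \<Longrightarrow> sym_int_poly (f i)"
  shows "sym_int_poly (\<lambda>t. \<Prod>i\<in>I. f i t)"
  using assms sym_int_poly_of_int[of 1]
  by (induction I rule: infinite_finite_induct) (auto intro: sym_int_poly_mult)

lemma mpoly_eval_var: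
  "mpoly_eval (Poly_Mapping.single (Poly_Mapping.single i 1) 1) x = x $ i"
proof -
  have "mpoly_mono x (Poly_Mapping.single i 1) = (\<Prod>j\<in>UNIV. if j = i then x $ i else 1)"
    unfolding mpoly_mono_def by (intro prod.cong) (auto simp: lookup_single when_def)
  then show ?thesis by (simp add: mpoly_eval_single)
qed

lemma sym_int_poly_esym: "sym_int_poly (\<lambda>t :: real ^ 'n::{finite,linorder}. esym UNIV n (($) t))"
proof (cases n)
  case 0
  then show ?thesis using sym_int_poly_of_int[of 1] by simp
next
  case (Suc m)
  show ?thesis
  proof (cases "m < CARD('n)")
    case True
    then obtain i :: 'n where "rk i = m"
      using bij_rk[where 'n='n] unfolding bij_betw_def by (metis imageE lessThan_iff)
    then show ?thesis unfolding sym_int_poly_def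
      using Suc viete_nth[of _ i] mpoly_eval_var[of i] by metis
  next
    case False
    then show ?thesis using sym_int_poly_of_int[of 0] Suc by (simp add: esym_eq_0)
  qed
qed

text \<open>Newton's identity is solved for the highest power sum, whose coefficient is
  \<open>esym UNIV 0 t = 1\<close>; no division occurs, so the coefficients stay integers.\<close>

lemma sym_int_poly_power_sum:
  "sym_int_poly (\<lambda>t :: real ^ 'n::{finite,linorder}. \<Sum>j\<in>UNIV. (- t $ j) ^ n)"
proof (induction n rule: less_induct)
  case (less n)
  show ?case
  proof (cases n)
    case 0
    then show ?thesis using sym_int_poly_of_int[of "int CARD('n)"] by simp
  next
    case (Suc m)
    have "(\<Sum>j\<in>UNIV. (- t $ j) ^ n) = - (\<Sum>k\<in>{1..m}. (\<Sum>j\<in>UNIV. (- t $ j) ^ k) * esym UNIV (n - k) (($) t))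
        + (- of_int (int n) * esym UNIV n (($) t))" for t :: "real ^ 'n::_"
    proof -
      have "{1..n} = insert n {1..m}" using Suc by auto
      then have "(\<Sum>k\<in>{1..n}. (\<Sum>j\<in>UNIV. (- t $ j) ^ k) * esym UNIV (n - k) (($) t)) =
          (\<Sum>j\<in>UNIV. (- t $ j) ^ n) + (\<Sum>k\<in>{1..m}. (\<Sum>j\<in>UNIV. (- t $ j) ^ k) * esym UNIV (n - k) (($) t))"
        using Suc by simp
      then show ?thesis
        using newton_identity[of UNIV "($) t" n] by simp
    qed
    moreover have "sym_int_poly (\<lambda>t :: real ^ 'n::_. \<Sum>k\<in>{1..m}. (\<Sum>j\<in>UNIV. (- t $ j) ^ k) * esym UNIV (n - k) (($) t))"
      by (rule sym_int_poly_sum, rule sym_int_poly_mult[OF less sym_int_poly_esym]) (use Suc in auto)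
    moreover have "sym_int_poly (\<lambda>t :: real ^ 'n::_. - of_int (int n) * esym UNIV n (($) t))"
      by (intro sym_int_poly_mult sym_int_poly_uminus sym_int_poly_of_int sym_int_poly_esym)
    ultimately show ?thesis
      by (simp only:) (intro sym_int_poly_add sym_int_poly_uminus)
  qed
qed

lemma vdm_power2_eq: "vdm t ^ 2 = (\<Prod>(j, k) | j < k. (t $ k - t $ j)\<^sup>2)"
  unfolding vdm_def prod_power_distrib by (intro prod.cong) auto

text \<open>The discriminant is the determinant of the transposed Vandermonde matrix times the
  matrix itself, and the entries of this product are the power sums of degree
  \<open>rk i + rk j\<close>.\<close>

lemma sym_int_poly_vdm: "sym_int_poly (\<lambda>t :: real ^ 'n::{finite,linorder}. vdm t ^ 2)"
proof -
  have V: "det (\<chi> k i. (t $ k) ^ rk i) = vdm t" for t :: "real ^ 'n::_"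
    using det_poly_family[of "\<lambda>i. monom 1 (rk i)" t] by (simp add: degree_monom_eq poly_monom)
  have "vdm t ^ 2 = det (\<chi> (i::'n) (j::'n). \<Sum>k\<in>UNIV. (t $ k) ^ (rk i + rk j))" for t :: "real ^ 'n::_"
  proof -
    have "vdm t ^ 2 = det (transpose (\<chi> k (i::'n). (t $ k) ^ rk i) ** (\<chi> k (i::'n). (t $ k) ^ rk i))"
      by (simp add: det_mul det_transpose V power2_eq_square)
    then show ?thesis by (simp add: matrix_matrix_mult_def transpose_def power_add)
  qed
  also have "\<dots> t = (\<Sum>p | p permutes (UNIV :: 'n set). of_int (sign p) *
      (\<Prod>i\<in>UNIV. (\<Sum>k\<in>UNIV. (t $ k) ^ (rk i + rk (p i)))))" for t :: "real ^ 'n::_"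
    by (simp add: det_def)
  \<comment> \<open>The sign factors convert power sums of \<open>t\<close> to those of
    \<open>- t\<close>, the form of \<open>sym_int_poly_power_sum\<close>.\<close>
  finally have eq: "vdm t ^ 2 = (\<Sum>p | p permutes (UNIV :: 'n set). of_int (sign p) *
      (\<Prod>i\<in>UNIV. of_int ((-1) ^ (rk i + rk (p i))) * (\<Sum>k\<in>UNIV. (- t $ k) ^ (rk i + rk (p i)))))"
    for t :: "real ^ 'n::_"
    by (simp add: sum_distrib_left power_mult_distrib[symmetric] cong: sum.cong prod.cong)
  show ?thesis
    unfolding eq
    by (intro sym_int_poly_sum sym_int_poly_mult sym_int_poly_prod sym_int_poly_of_int
        sym_int_poly_power_sum)
qed

lemma sym_int_poly_prod_4_minus:
  "sym_int_poly (\<lambda>t :: real ^ 'n::{finite,linorder}. \<Prod>j\<in>UNIV. 4 - (t $ j)\<^sup>2)"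
proof -
  have eq: "(\<Prod>j\<in>UNIV. 4 - (t $ j)\<^sup>2) = (\<Prod>j\<in>(UNIV::'n set). of_int (-1)) *
     (\<Sum>n\<le>CARD('n). esym UNIV n (($) t) * of_int ((- 2) ^ (CARD('n) - n))) *
     (\<Sum>n\<le>CARD('n). esym UNIV n (($) t) * of_int (2 ^ (CARD('n) - n)))" for t :: "real ^ 'n::_"
  proof -
    \<comment> \<open>Each linear factor yields the generating polynomial of \<open>esym\<close>,
      evaluated at \<open>- 2\<close> and at \<open>2\<close>.\<close>
    have "(\<Prod>j\<in>UNIV. 4 - (t $ j)\<^sup>2) = (\<Prod>j\<in>UNIV. of_int (-1) * (- 2 + t $ j) * (2 + t $ j))"
      by (intro prod.cong) (auto simp: algebra_simps power2_eq_square)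
    then show ?thesis
      unfolding prod.distrib prod_add_eq_esym[OF finite] by simp
  qed
  show ?thesis unfolding eq
    by (intro sym_int_poly_sum sym_int_poly_mult sym_int_poly_prod sym_int_poly_of_int
        sym_int_poly_esym)
qed

lemma the_mpoly_eval_viete:
  fixes h :: "real ^ 'n::{finite,linorder} \<Rightarrow> real"
  assumes "sym_int_poly h"
  shows "mpoly_eval (THE p. \<forall>t. mpoly_eval p (viete t) = h t) (viete t) = h t"
proof -
  obtain p :: "'n int_mpoly" where p: "\<forall>t. mpoly_eval p (viete t) = h t"
    using assms unfolding sym_int_poly_def by blast
  have "(THE p. \<forall>t. mpoly_eval p (viete t) = h t) = p"
    by (rule the_equality) (use p in \<open>auto intro: mpoly_eq_if_eq_on_viete\<close>)
  then show ?thesis using p by simp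
qed

lemma mpoly_eval_d0: "mpoly_eval d0 (viete t) = vdm t ^ 2"
  using the_mpoly_eval_viete[OF sym_int_poly_vdm] by (simp add: d0_def vdm_power2_eq)

lemma mpoly_eval_d1: "mpoly_eval d1 (viete t) = (\<Prod>j\<in>UNIV. 4 - (t $ j)\<^sup>2)"
  using the_mpoly_eval_viete[OF sym_int_poly_prod_4_minus] by (simp add: d1_def)

text \<open>The real \<open>sqrt\<close> is extended as an odd function and is multiplicative on all
  reals, so \<open>nu_viete\<close> holds for every \<open>t\<close>, also outside the cube.\<close>

lemma sqrt_prod: "sqrt (\<Prod>i\<in>I. f i) = (\<Prod>i\<in>I. sqrt (f i))"
  by (induction I rule: infinite_finite_induct) (auto simp: real_sqrt_mult)

lemma nu_viete: "nu (viete t) = 1 / (2 * pi) ^ CARD('n) * \<bar>vdm t\<bar> * (\<Prod>j\<in>UNIV. sqrt (4 - (t $ j)\<^sup>2))"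
  for t :: "real ^ 'n::{finite,linorder}"
  by (simp add: nu_def mpoly_eval_d0 mpoly_eval_d1 real_sqrt_mult sqrt_prod)

section \<open>Change of variables to the symmetric alcove\<close>

lemma Basis_vec_eq: "(Basis :: (real ^ 'n::finite) set) = range (\<lambda>i. axis i 1)"
  by (auto simp: Basis_vec_def)

lemma prod_Basis_vec: "(\<Prod>b\<in>(Basis :: (real ^ 'n::finite) set). f b) = (\<Prod>i\<in>UNIV. f (axis i 1))"
  unfolding Basis_vec_eq by (subst prod.reindex) (auto simp: inj_def axis_eq_axis)

lemma sum_Basis_vec: "(\<Sum>b\<in>(Basis :: (real ^ 'n::finite) set). f b) = (\<Sum>i\<in>UNIV. f (axis i 1))"
  unfolding Basis_vec_eq by (subst sum.reindex) (auto simp: inj_def axis_eq_axis)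

lemma measurable_reindex:
  "(\<lambda>x :: real ^ 'n::finite. \<chi> i::'m::finite. x $ \<pi> i) \<in> borel_measurable borel"
  by (intro borel_measurable_continuous_onI continuous_intros)

text \<open>A bijection of indices maps boxes to boxes of the same volume, and boxes determine
  \<open>lborel\<close>. Two index types occur because the map also serves to pass to a well-ordered
  copy of \<open>'n\<close>.\<close>

lemma lborel_distr_reindex:
  fixes \<pi> :: "'m::finite \<Rightarrow> 'n::finite"
  assumes "bij \<pi>"
  shows "distr lborel borel (\<lambda>x :: real ^ 'n. \<chi> i. x $ \<pi> i) = lborel"
proof (rule lborel_eqI[symmetric])
  fix l u :: "real ^ 'm" assume le: "\<And>b. b \<in> Basis \<Longrightarrow> l \<bullet> b \<le> u \<bullet> b"
  let ?P = "\<lambda>x :: real ^ 'n. \<chi> i. x $ \<pi> i"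
  let ?l = "\<chi> j. l $ inv \<pi> j" and ?u = "\<chi> j. u $ inv \<pi> j"
  have i: "\<pi> (inv \<pi> j) = j" "inv \<pi> (\<pi> k) = k" for j k
    using assms by (auto simp: bij_def surj_f_inv_f)
  have "?P -` box l u = box ?l ?u"
    by (auto simp: mem_box_cart) (metis i(1), metis i(1), metis i(2), metis i(2))
  then have "emeasure (distr lborel borel ?P) (box l u) = emeasure lborel (box ?l ?u)"
    by (subst emeasure_distr) (auto simp: measurable_reindex)
  also have "\<dots> = (\<Prod>b\<in>Basis. (?u - ?l) \<bullet> b)"
  proof (rule emeasure_lborel_box)
    fix b :: "real ^ 'n" assume "b \<in> Basis"
    then obtain j where "b = axis j 1" by (auto simp: Basis_vec_eq)
    then show "?l \<bullet> b \<le> ?u \<bullet> b" using le[of "axis (inv \<pi> j) 1"] by (simp add: inner_axis Basis_vec_eq)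
  qed
  also have "(\<Prod>b\<in>Basis. (?u - ?l) \<bullet> b) = (\<Prod>j\<in>UNIV. (u - l) $ inv \<pi> j)"
    by (simp add: prod_Basis_vec inner_axis)
  also have "\<dots> = (\<Prod>i\<in>UNIV. (u - l) $ i)"
    using assms by (intro prod.reindex_bij_betw) (simp add: bij_imp_bij_inv)
  finally show "emeasure (distr lborel borel ?P) (box l u) = (\<Prod>b\<in>Basis. (u - l) \<bullet> b)"
    by (simp add: prod_Basis_vec inner_axis)
qed simp

lemma integral_lborel_reindex:
  fixes \<pi> :: "'m::finite \<Rightarrow> 'n::finite" and f :: "real ^ 'm \<Rightarrow> 'b::{banach,second_countable_topology}"
  assumes "bij \<pi>" and [measurable]: "f \<in> borel_measurable borel"
  shows "(\<integral>x. f (\<chi> i. x $ \<pi> i) \<partial>lborel) = (\<integral>y. f y \<partial>lborel)"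
proof -
  have "(\<integral>y. f y \<partial>lborel) = (\<integral>y. f y \<partial>distr lborel borel (\<lambda>x :: real ^ 'n. \<chi> i. x $ \<pi> i))"
    by (simp add: lborel_distr_reindex[OF assms(1)])
  also have "\<dots> = (\<integral>x. f (\<chi> i. x $ \<pi> i) \<partial>lborel)"
    by (rule integral_distr) (simp_all add: measurable_reindex)
  finally show ?thesis by simp
qed

lemma integrable_lborel_reindex:
  fixes \<pi> :: "'m::finite \<Rightarrow> 'n::finite" and f :: "real ^ 'm \<Rightarrow> 'b::{banach,second_countable_topology}"
  assumes "bij \<pi>" and "integrable lborel f"
  shows "integrable lborel (\<lambda>x. f (\<chi> i. x $ \<pi> i))"
proof -
  have "integrable (distr lborel borel (\<lambda>x :: real ^ 'n. \<chi> i. x $ \<pi> i)) f"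
    by (simp add: lborel_distr_reindex[OF assms(1)] assms(2))
  then show ?thesis
    using assms(2) by (subst (asm) integrable_distr_eq) (auto simp: measurable_reindex)
qed

lemma integral_lborel_prod:
  fixes f :: "'n::finite \<Rightarrow> real \<Rightarrow> real"
  assumes int: "\<And>i. integrable lborel (f i)"
  shows "(\<integral>x. (\<Prod>i\<in>UNIV. f i (x $ i)) \<partial>(lborel :: (real ^ 'n) measure)) = (\<Prod>i\<in>UNIV. \<integral>y. f i y \<partial>lborel)"
proof -
  interpret product_sigma_finite "\<lambda>_::real ^ 'n. lborel :: real measure" by standard
  \<comment> \<open>The product measure behind \<open>lborel\<close> is indexed by
    \<open>Basis\<close>; \<open>g\<close> transports the family \<open>f\<close> from indices to
    basis vectors.\<close>
  define g where "g b = f (SOME i. b = axis i (1::real))" for b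
  have g: "g (axis i 1) = f i" for i
    by (simp add: g_def axis_eq_axis)
  have [measurable]: "f i \<in> borel_measurable borel" for i using int[of i] by auto
  have nth: "(\<Sum>b\<in>Basis. y b *\<^sub>R b) $ i = y (axis i 1)" for y and i :: 'n
    by (simp add: sum_Basis_vec axis_def if_distrib[where f="\<lambda>x. _ * x"] cong: if_cong)
  have "(\<integral>x. (\<Prod>i\<in>UNIV. f i (x $ i)) \<partial>(lborel :: (real ^ 'n) measure)) =
      (\<integral>y. (\<Prod>i\<in>UNIV. f i ((\<Sum>b\<in>Basis. y b *\<^sub>R b) $ i)) \<partial>(\<Pi>\<^sub>M b\<in>(Basis :: (real ^ 'n) set). lborel))"
    by (subst lborel_eq, subst integral_distr) (auto intro!: borel_measurable_prod)
  also have "\<dots> = (\<integral>y. (\<Prod>b\<in>Basis. g b (y b)) \<partial>(\<Pi>\<^sub>M b\<in>(Basis :: (real ^ 'n) set). lborel))"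
    unfolding nth by (simp add: prod_Basis_vec g)
  also have "\<dots> = (\<Prod>b\<in>(Basis :: (real ^ 'n) set). \<integral>y. g b y \<partial>lborel)"
    by (rule product_integral_prod) (auto simp: Basis_vec_eq g int)
  finally show ?thesis by (simp add: prod_Basis_vec g)
qed

lemma vdm_eq_0_iff: "vdm t = 0 \<longleftrightarrow> (\<exists>i j. i \<noteq> j \<and> t $ i = t $ j)"
  for t :: "real ^ 'n::{finite,linorder}"
proof -
  have "vdm t = 0 \<longleftrightarrow> (\<exists>i j. i < j \<and> t $ j = t $ i)"
    by (auto simp: vdm_def)
  then show ?thesis by (metis linorder_neqE order_less_irrefl)
qed

lemma continuous_vdm: "continuous_on S vdm"
  unfolding vdm_def case_prod_unfold by (intro continuous_intros)

lemma negligible_vdm: "negligible {t :: real ^ 'n::{finite,linorder}. vdm t = 0}"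
proof -
  have "negligible (\<Union>p\<in>{(i, j). i \<noteq> j}. {t :: real ^ 'n::_. (axis (fst p) 1 - axis (snd p) 1) \<bullet> t = 0})"
    by (intro negligible_Union) (auto simp: axis_eq_axis intro!: negligible_hyperplane)
  then show ?thesis
    by (rule negligible_subset) (auto simp: vdm_eq_0_iff inner_diff_left inner_axis')
qed

lemma AE_vdm_neq_0: "AE t in lborel. vdm (t :: real ^ 'n::{finite,linorder}) \<noteq> 0"
proof -
  have "closed {t :: real ^ 'n::_. vdm t = 0}"
    by (intro closed_Collect_eq continuous_vdm continuous_intros)
  then have "{t :: real ^ 'n::_. vdm t = 0} \<in> sets lborel" by (simp add: borel_closed)
  then have "{t :: real ^ 'n::_. vdm t = 0} \<in> null_sets lborel"
    using negligible_vdm[where 'n='n] null_sets_completion_iff[of "{t :: real ^ 'n::_. vdm t = 0}" lborel]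
    by (simp add: negligible_iff_null_sets)
  then show ?thesis by (auto dest: AE_not_in)
qed

section \<open>The cube, sorting of coordinates and the alcove\<close>

definition cube :: "(real ^ 'n::finite) set" where
  "cube = {t. \<forall>i. t $ i \<in> {-2..2}}"

lemma cube_eq_cbox: "cube = cbox (\<chi> i. -2) (\<chi> i. 2)"
  by (auto simp: cube_def mem_box_cart)

lemma compact_cube: "compact (cube :: (real ^ 'n::finite) set)"
  by (simp add: cube_eq_cbox)

lemma cube_permute: "p permutes UNIV \<Longrightarrow> (\<chi> i. t $ p i) \<in> cube \<longleftrightarrow> t \<in> cube"
  unfolding cube_def by simp (metis permutes_surj surjD)

lemma sym_alcove_eq: "sym_alcove = viete ` cube"
  by (simp add: sym_alcove_def cube_def)

lemma compact_sym_alcove: "compact sym_alcove"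
  unfolding sym_alcove_eq by (intro compact_continuous_image continuous_viete compact_cube)

lemma ex_permute_in_chamber:
  fixes t :: "real ^ 'n::{finite,linorder}"
  assumes "vdm t \<noteq> 0"
  obtains p where "p permutes UNIV" "(\<chi> i. t $ p i) \<in> chamber"
proof -
  have inj: "t $ i = t $ j \<Longrightarrow> i = j" for i j
    using assms by (auto simp: vdm_eq_0_iff)
  \<comment> \<open>\<open>r i\<close> is the position of \<open>t $ i\<close> in increasing order.
    As the coordinates are distinct, \<open>r\<close> is a bijection onto the ranks, and
    \<open>p\<close> below is \<open>rk\<close> followed by its inverse.\<close>
  define r where "r i = card {j. t $ j < t $ i}" for i
  have r_less: "r i < r j" if "t $ i < t $ j" for i j
    unfolding r_def using that by (intro psubset_card_mono) auto
  have r_inj: "inj r"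
  proof (rule injI)
    fix i j assume "r i = r j"
    then show "i = j" using r_less[of i j] r_less[of j i] inj[of i j] by (cases "t $ i" "t $ j" rule: linorder_cases) auto
  qed
  have "range r \<subseteq> {..<CARD('n)}"
    by (auto simp: r_def intro!: psubset_card_mono)
  then have "range r = {..<CARD('n)}"
    using card_image[OF r_inj] by (intro card_subset_eq) auto
  then have "rk i \<in> range r" for i :: 'n using bij_rk[where 'n='n] by (auto simp: bij_betw_def)
  then have "\<exists>k. r k = rk i" for i :: 'n by (metis imageE)
  then obtain p where p: "\<And>i :: 'n. r (p i) = rk i" by metis
  have "inj p" using p by (intro injI) (metis rk_eq_iff)
  then have "bij p" by (simp add: finite_UNIV_inj_surj bij_def)
  then have perm: "p permutes UNIV" by (intro bij_imp_permutes) auto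
  have "t $ p i < t $ p j" if "i < j" for i j
  proof (rule ccontr)
    assume "\<not> t $ p i < t $ p j"
    then have "t $ p j < t $ p i \<or> p i = p j"
      using inj[of "p i" "p j"] by (cases "t $ p i" "t $ p j" rule: linorder_cases) auto
    then have "r (p j) \<le> r (p i)" using r_less[of "p j" "p i"] by auto
    then show False using that by (simp add: p)
  qed
  then show thesis using that[OF perm] by (simp add: chamber_def)
qed

text \<open>If the coordinates of \<open>t\<close> are distinct, sorting them gives a preimage in
  the chamber. What remains is the image of the null set \<open>vdm t = 0\<close> under a
  differentiable map.\<close>

lemma negligible_alcove_boundary: "negligible (sym_alcove - viete ` (cube \<inter> chamber :: (real ^ 'n::{finite,linorder}) set))"
proof (rule negligible_subset)
  show "negligible (viete ` {t :: real ^ 'n::_. vdm t = 0})"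
    by (intro negligible_differentiable_image_negligible negligible_vdm)
      (auto simp: differentiable_on_def differentiable_def intro: has_derivative_at_withinI has_derivative_viete)
  show "sym_alcove - viete ` (cube \<inter> chamber) \<subseteq> viete ` {t :: real ^ 'n::_. vdm t = 0}"
  proof
    fix s assume s: "s \<in> sym_alcove - viete ` (cube \<inter> chamber :: (real ^ 'n::_) set)"
    then obtain t where t: "t \<in> cube" "s = viete t" by (auto simp: sym_alcove_eq)
    have "vdm t = 0"
    proof (rule ccontr)
      assume "vdm t \<noteq> 0"
      then obtain p where p: "p permutes UNIV" "(\<chi> i. t $ p i) \<in> chamber"
        using ex_permute_in_chamber by blast
      then have "s \<in> viete ` (cube \<inter> chamber)"
        using t viete_permute[OF p(1), of t] cube_permute[OF p(1), of t] by (metis IntI image_eqI)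
      then show False using s by simp
    qed
    then show "s \<in> viete ` {t. vdm t = 0}" using t by simp
  qed
qed

lemma sets_cube_chamber: "cube \<inter> chamber \<in> sets (borel :: (real ^ 'n::{finite,linorder}) measure)"
  by (intro sets.Int borel_closed borel_open open_chamber compact_imp_closed compact_cube)

lemma integral_sym_alcove_wellorder:
  fixes \<phi> :: "real ^ 'n::{finite,wellorder} \<Rightarrow> real"
  assumes "continuous_on sym_alcove \<phi>"
  shows "(LINT s:sym_alcove|lborel. \<phi> s) = (LINT t:cube \<inter> chamber|lborel. \<bar>vdm t\<bar> * \<phi> (viete t))"
proof -
  define \<psi> where "\<psi> t = \<bar>vdm t\<bar> * \<phi> (viete t)" for t
  let ?S = "cube \<inter> chamber :: (real ^ 'n::_) set"
  have "continuous_on cube \<psi>"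
    unfolding \<psi>_def using assms
    by (intro continuous_intros continuous_vdm continuous_on_compose2[OF assms continuous_viete])
      (auto simp: sym_alcove_eq)
  then have "set_integrable lborel cube \<psi>"
    unfolding set_integrable_def by (rule borel_integrable_compact[OF compact_cube])
  then have \<psi>: "set_integrable lborel ?S \<psi>"
    by (rule set_integrable_subset) (use sets_cube_chamber in auto)
  then have \<psi>': "\<psi> absolutely_integrable_on ?S"
    by (simp add: set_integrable_def integrable_completion)
  have m: "\<bar>det (matrix ((*v) (viete_jac x)))\<bar> *\<^sub>R \<phi> (viete x) = \<psi> x" for x
    by (simp add: \<psi>_def abs_det_viete_jac)
  have \<phi>: "set_integrable lborel sym_alcove \<phi>"
    using borel_integrable_compact[OF compact_sym_alcove assms] by (simp add: set_integrable_def)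
  have "(LINT s:sym_alcove|lborel. \<phi> s) = integral sym_alcove \<phi>"
    using \<phi> by (rule set_borel_integral_eq_integral)
  also have "\<dots> = integral (viete ` ?S) \<phi>"
    by (rule integral_spike_set) (auto intro: negligible_subset[OF negligible_alcove_boundary]
       simp: sym_alcove_eq)
  \<comment> \<open>The change of variables is for vector-valued functions, so \<open>\<phi>\<close>
    is viewed with values in \<open>real ^ 1\<close>.\<close>
  also have "\<dots> = integral (viete ` ?S) (\<lambda>s. vec (\<phi> s) :: real ^ 1) $ 1"
    by (simp add: integral_on_1_eq)
  also have "integral (viete ` ?S) (\<lambda>s. vec (\<phi> s) :: real ^ 1) =
      integral ?S (\<lambda>x. \<bar>det (matrix ((*v) (viete_jac x)))\<bar> *\<^sub>R vec (\<phi> (viete x)))"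
  proof (rule integral_change_of_variables)
    show "?S \<in> sets lebesgue" using sets_cube_chamber by auto
    show "(viete has_derivative (*v) (viete_jac x)) (at x within ?S)" for x
      by (rule has_derivative_at_withinI[OF has_derivative_viete])
    show "inj_on viete ?S" using inj_on_viete_chamber by (rule inj_on_subset) auto
  qed (use \<psi>' m in \<open>simp add: absolutely_integrable_on_1_iff\<close>)
  also have "\<dots> $ 1 = integral ?S \<psi>" using m by (simp add: integral_on_1_eq)
  also have "\<dots> = (LINT t:?S|lborel. \<psi> t)"
    using \<psi> by (rule set_borel_integral_eq_integral(2)[symmetric])
  finally show ?thesis by (simp add: \<psi>_def)
qed

text \<open>The change of variables theorem is stated for well-ordered index types; a copy of the
  index type turns a finite linear order into an instance.\<close>

typedef 'a wo_copy = "UNIV :: 'a set" by simp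

setup_lifting type_definition_wo_copy

lemma bij_Rep_wo_copy: "bij Rep_wo_copy"
  by (metis Abs_wo_copy_inverse Rep_wo_copy_inverse UNIV_I bijI')

instance wo_copy :: (finite) finite
  by standard (metis bij_Rep_wo_copy bij_betw_finite finite)

instantiation wo_copy :: ("{finite,linorder}") wellorder
begin

lift_definition less_wo_copy :: "'a wo_copy \<Rightarrow> 'a wo_copy \<Rightarrow> bool" is "(<)" .
lift_definition less_eq_wo_copy :: "'a wo_copy \<Rightarrow> 'a wo_copy \<Rightarrow> bool" is "(\<le>)" .

instance
proof
  show "P a" if "\<And>x. (\<And>y. y < x \<Longrightarrow> P y) \<Longrightarrow> P x" for P and a :: "'a wo_copy"
  proof (induction "card {y. y < a}" arbitrary: a rule: less_induct)
    case less
    show ?case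
    proof (rule that)
      fix y assume y: "y < a"
      have "{z. z < y} \<subset> {z. z < a}"
        using y by (transfer, auto)
      then have "card {z. z < y} < card {z. z < a}" by (intro psubset_card_mono) auto
      then show "P y" by (rule less)
    qed
  qed
qed (transfer, auto)+

end

lemma card_atMost_wo_copy: "card {..i} = card {..Rep_wo_copy i}"
proof -
  have "bij_betw Rep_wo_copy {..i} {..Rep_wo_copy i}"
    by (rule bij_betwI[where g = Abs_wo_copy])
      (auto simp: less_eq_wo_copy.rep_eq Abs_wo_copy_inverse Rep_wo_copy_inverse)
  then show ?thesis by (rule bij_betw_same_card)
qed

lemma integral_sym_alcove_chamber:
  fixes \<phi> :: "real ^ 'n::{finite,linorder} \<Rightarrow> real"
  assumes cont: "continuous_on sym_alcove \<phi>"
  shows "(LINT s:sym_alcove|lborel. \<phi> s) = (LINT t:cube \<inter> chamber|lborel. \<bar>vdm t\<bar> * \<phi> (viete t))"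
proof -
  \<comment> \<open>\<open>P\<close> and \<open>Q\<close> relabel coordinates along the order
    isomorphism between \<open>'n\<close> and its copy; cube, chamber, alcove, \<open>viete\<close>
    and \<open>vdm\<close> are all compatible with them.\<close>
  define P :: "real ^ 'n::_ \<Rightarrow> real ^ 'n wo_copy" where "P x = (\<chi> i. x $ Rep_wo_copy i)" for x
  define Q :: "real ^ 'n wo_copy \<Rightarrow> real ^ 'n::_" where "Q y = (\<chi> j. y $ Abs_wo_copy j)" for y
  have PQ: "Q (P x) = x" "P (Q y) = y" for x y
    by (simp_all add: P_def Q_def vec_eq_iff Abs_wo_copy_inverse Rep_wo_copy_inverse)
  have cQ: "continuous_on A Q" for A unfolding Q_def by (intro continuous_intros)
  have bijA: "bij Abs_wo_copy"
    by (metis Abs_wo_copy_inverse Rep_wo_copy_inverse UNIV_I bijI')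
  have injR: "inj_on (Rep_wo_copy :: 'n wo_copy \<Rightarrow> 'n) S" and injA: "inj_on (Abs_wo_copy :: 'n \<Rightarrow> _) T"
    for S T
    by (auto intro: inj_on_subset bij_is_inj bij_Rep_wo_copy bijA)
  have inP: "P x \<in> cube \<longleftrightarrow> x \<in> cube" for x
    unfolding P_def cube_def by simp (metis Abs_wo_copy_inverse UNIV_I)
  have inC: "P x \<in> chamber \<longleftrightarrow> x \<in> chamber" for x
    unfolding P_def chamber_def less_wo_copy.rep_eq by simp (metis Abs_wo_copy_inverse UNIV_I)
  have viP: "viete (P x) = P (viete x)" for x
  proof -
    have "elem_sym n (P x) = elem_sym n x" for n
    proof -
      have "elem_sym n x = (\<Sum>S | S \<subseteq> UNIV \<and> card S = n. \<Prod>i\<in>Rep_wo_copy ` S. x $ i)"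
        unfolding elem_sym_def
      proof (rule sum.reindex_bij_betw[symmetric, where g="\<lambda>S. \<Prod>i\<in>S. x $ i"])
        show "bij_betw ((`) (Rep_wo_copy :: 'n wo_copy \<Rightarrow> 'n)) {S. S \<subseteq> UNIV \<and> card S = n} {S. S \<subseteq> UNIV \<and> card S = n}"
          by (intro bij_betwI[where g="(`) Abs_wo_copy"])
            (auto simp: card_image injR injA image_comp o_def Abs_wo_copy_inverse Rep_wo_copy_inverse)
      qed
      also have "\<dots> = elem_sym n (P x)"
        unfolding elem_sym_def
        by (intro sum.cong refl, subst prod.reindex)
          (auto simp: P_def inj_on_subset[OF bij_is_inj[OF bij_Rep_wo_copy]])
      finally show ?thesis by simp
    qed
    then show ?thesis by (simp add: viete_def P_def[of "\<chi> i. _ i"] card_atMost_wo_copy)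
  qed
  have vdP: "vdm (P x) = vdm x" for x
    unfolding vdm_def
    by (rule prod.reindex_bij_witness[of _ "map_prod Abs_wo_copy Abs_wo_copy" "map_prod Rep_wo_copy Rep_wo_copy"])
      (auto simp: P_def less_wo_copy.rep_eq Abs_wo_copy_inverse Rep_wo_copy_inverse)
  have alP: "P s \<in> sym_alcove \<longleftrightarrow> s \<in> sym_alcove" for s
  proof
    assume "P s \<in> sym_alcove"
    then obtain t where "t \<in> cube" "P s = viete t" by (auto simp: sym_alcove_eq)
    then have "s = viete (Q t)" "Q t \<in> cube"
      using PQ viP[of "Q t"] inP[of "Q t"] by (metis, metis)
    then show "s \<in> sym_alcove" by (auto simp: sym_alcove_eq)
  next
    assume "s \<in> sym_alcove"
    then show "P s \<in> sym_alcove" using viP inP by (auto simp: sym_alcove_eq) (metis image_eqI)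
  qed
  have cont': "continuous_on sym_alcove (\<lambda>y. \<phi> (Q y))"
    by (rule continuous_on_compose2[OF cont cQ]) (auto simp: alP[symmetric] PQ)
  have m1: "(\<lambda>y. indicator sym_alcove y *\<^sub>R \<phi> (Q y)) \<in> borel_measurable borel"
    using borel_integrable_compact[OF compact_sym_alcove cont'] by (auto dest: borel_measurable_integrable)
  have contc: "continuous_on cube (\<lambda>y. \<bar>vdm y\<bar> * \<phi> (Q (viete y)))"
    by (intro continuous_intros continuous_vdm continuous_on_compose2[OF cont' continuous_viete])
      (auto simp: sym_alcove_eq)
  have "set_integrable lborel (cube \<inter> chamber) (\<lambda>y. \<bar>vdm y\<bar> * \<phi> (Q (viete y)))"
    by (rule set_integrable_subset[of _ cube])
      (use borel_integrable_compact[OF compact_cube contc] sets_cube_chamber in \<open>auto simp: set_integrable_def\<close>)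
  then have m2: "(\<lambda>y. indicator (cube \<inter> chamber) y *\<^sub>R (\<bar>vdm y\<bar> * \<phi> (Q (viete y)))) \<in> borel_measurable borel"
    by (auto simp: set_integrable_def dest: borel_measurable_integrable)
  have "(LINT s:sym_alcove|lborel. \<phi> s) = (\<integral>x. indicator sym_alcove (P x) *\<^sub>R \<phi> (Q (P x)) \<partial>lborel)"
    unfolding set_lebesgue_integral_def by (simp add: indicator_def alP PQ)
  also have "\<dots> = (LINT y:sym_alcove|lborel. \<phi> (Q y))"
    unfolding set_lebesgue_integral_def P_def by (rule integral_lborel_reindex[OF bij_Rep_wo_copy m1])
  also have "\<dots> = (LINT y:cube \<inter> chamber|lborel. \<bar>vdm y\<bar> * \<phi> (Q (viete y)))"
    by (rule integral_sym_alcove_wellorder[OF cont'])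
  also have "\<dots> = (\<integral>x. indicator (cube \<inter> chamber) (P x) *\<^sub>R (\<bar>vdm (P x)\<bar> * \<phi> (Q (viete (P x)))) \<partial>lborel)"
    unfolding set_lebesgue_integral_def P_def by (rule integral_lborel_reindex[OF bij_Rep_wo_copy m2, symmetric])
  also have "\<dots> = (LINT t:cube \<inter> chamber|lborel. \<bar>vdm t\<bar> * \<phi> (viete t))"
    unfolding set_lebesgue_integral_def by (simp add: indicator_def inP inC viP vdP PQ)
  finally show ?thesis .
qed

text \<open>Up to the null set \<open>vdm t = 0\<close>, the cube is the disjoint union of the g!
  images of its intersection with the chamber under permutations of the coordinates: exactly one
  permutation sorts a point with distinct coordinates.\<close>

lemma integral_chamber_eq_cube:
  fixes \<psi> :: "real ^ 'n::{finite,linorder} \<Rightarrow> real"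
  assumes cont: "continuous_on cube \<psi>"
    and sym: "\<And>p t. p permutes UNIV \<Longrightarrow> \<psi> (\<chi> i. t $ p i) = \<psi> t"
  shows "fact CARD('n) * (LINT t:cube \<inter> chamber|lborel. \<psi> t) = (LINT t:cube|lborel. \<psi> t)"
proof -
  let ?S = "cube \<inter> chamber :: (real ^ 'n::_) set" and ?P = "\<lambda>(p :: 'n \<Rightarrow> 'n) (t :: real ^ 'n::_). \<chi> i. t $ p i"
  have "set_integrable lborel cube \<psi>"
    using borel_integrable_compact[OF compact_cube cont] by (simp add: set_integrable_def)
  then have "set_integrable lborel ?S \<psi>"
    by (rule set_integrable_subset) (use sets_cube_chamber in auto)
  then have int: "integrable lborel (\<lambda>t. indicator ?S t *\<^sub>R \<psi> t)"
    by (simp add: set_integrable_def)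
  have split: "indicator cube t *\<^sub>R \<psi> t = (\<Sum>p | p permutes UNIV. indicator ?S (?P p t) *\<^sub>R \<psi> (?P p t))"
    if "vdm t \<noteq> 0" for t
  proof (cases "t \<in> cube")
    case True
    obtain p where p: "p permutes UNIV" "?P p t \<in> chamber"
      using ex_permute_in_chamber[OF \<open>vdm t \<noteq> 0\<close>] by blast
    have uniq: "q = p" if "q permutes UNIV" "?P q t \<in> chamber" for q
    proof -
      have "viete (?P q t) = viete (?P p t)" by (simp add: viete_permute p that)
      then have "?P q t = ?P p t" by (rule inj_onD[OF inj_on_viete_chamber _ that(2) p(2)])
      then have "t $ q i = t $ p i" for i by (simp add: vec_eq_iff)
      then show ?thesis using \<open>vdm t \<noteq> 0\<close> by (auto simp: vdm_eq_0_iff fun_eq_iff)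
    qed
    have "(\<Sum>q | q permutes UNIV. indicator ?S (?P q t) *\<^sub>R \<psi> (?P q t)) =
        (\<Sum>q | q permutes UNIV. if q = p then \<psi> t else 0)"
    proof (rule sum.cong[OF refl])
      fix q :: "'n \<Rightarrow> 'n" assume "q \<in> {q. q permutes UNIV}"
      then have q: "q permutes UNIV" by simp
      show "indicator ?S (?P q t) *\<^sub>R \<psi> (?P q t) = (if q = p then \<psi> t else 0)"
      proof (cases "q = p")
        case False
        then have "?P q t \<notin> chamber" using uniq[OF q] by blast
        then show ?thesis using False by simp
      qed (use True p sym[OF p(1), of t] cube_permute[OF p(1), of t] in simp)
    qed
    then show ?thesis using True p by simp
  next
    case False
    then have "?P p t \<notin> ?S" if "p permutes UNIV" for p
      using cube_permute[OF that, of t] by auto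
    then show ?thesis using False by simp
  qed
  have "(LINT t:cube|lborel. \<psi> t) =
      (\<integral>t. (\<Sum>p | p permutes UNIV. indicator ?S (?P p t) *\<^sub>R \<psi> (?P p t)) \<partial>lborel)"
    unfolding set_lebesgue_integral_def
  proof (rule integral_cong_AE)
    show "(\<lambda>t. indicator cube t *\<^sub>R \<psi> t) \<in> borel_measurable lborel"
      using \<open>set_integrable lborel cube \<psi>\<close> by (auto simp: set_integrable_def)
    show "(\<lambda>t. \<Sum>p | p permutes UNIV. indicator ?S (?P p t) *\<^sub>R \<psi> (?P p t)) \<in> borel_measurable lborel"
      using integrable_lborel_reindex[OF permutes_bij int]
      by (intro borel_measurable_sum borel_measurable_integrable) auto
    show "AE t in lborel. indicator cube t *\<^sub>R \<psi> t =
        (\<Sum>p | p permutes UNIV. indicator ?S (?P p t) *\<^sub>R \<psi> (?P p t))"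
      using AE_vdm_neq_0 by eventually_elim (rule split)
  qed
  also have "\<dots> = (\<Sum>p | p permutes (UNIV :: 'n set). \<integral>t. indicator ?S (?P p t) *\<^sub>R \<psi> (?P p t) \<partial>lborel)"
    using integrable_lborel_reindex[OF permutes_bij int]
    by (intro Bochner_Integration.integral_sum) auto
  also have "\<dots> = (\<Sum>p | p permutes (UNIV :: 'n set). LINT t:?S|lborel. \<psi> t)"
    unfolding set_lebesgue_integral_def using int
    by (intro sum.cong refl integral_lborel_reindex) (auto simp: permutes_bij)
  also have "\<dots> = fact CARD('n) * (LINT t:?S|lborel. \<psi> t)"
    by (simp add: card_permutations[OF refl])
  finally show ?thesis by simp
qed

lemma abs_vdm_permute:
  fixes t :: "real ^ 'n::{finite,linorder}"
  assumes "p permutes UNIV"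
  shows "\<bar>vdm (\<chi> i. t $ p i)\<bar> = \<bar>vdm t\<bar>"
proof -
  have "vdm (\<chi> i. t $ p i) ^ 2 = vdm t ^ 2"
    by (metis mpoly_eval_d0 viete_permute[OF assms])
  then show ?thesis by (simp add: power2_eq_iff abs_eq_iff)
qed

text \<open>The Viete map covers the alcove g! times. The factor \<open>\<bar>vdm t\<bar>\<close> is
  its Jacobian; \<open>nu\<close> contributes a second one, which makes the square in the Weyl
  density.\<close>

lemma integral_sym_alcove:
  fixes \<phi> :: "real ^ 'n::{finite,linorder} \<Rightarrow> real"
  assumes cont: "continuous_on sym_alcove \<phi>"
  shows "fact CARD('n) * (LINT s:sym_alcove|lborel. \<phi> s) = (LINT t:cube|lborel. \<bar>vdm t\<bar> * \<phi> (viete t))"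
  unfolding integral_sym_alcove_chamber[OF cont]
proof (rule integral_chamber_eq_cube)
  show "continuous_on cube (\<lambda>t. \<bar>vdm t\<bar> * \<phi> (viete t))"
    by (intro continuous_intros continuous_vdm continuous_on_compose2[OF cont continuous_viete])
      (auto simp: sym_alcove_eq)
qed (simp add: abs_vdm_permute viete_permute)

section \<open>Chebyshev polynomials and the semicircle weight\<close>

text \<open>With x = 2 cos \<theta> the values are 2 cos (k \<theta>) here and sin (k \<theta>) /
  sin \<theta> for \<open>ups\<close>, so \<open>ups k\<close> is the Chebyshev polynomial of the
  second kind of degree \<open>k - 1\<close>. The start value 2 makes \<open>tau k\<close> the sum
  of the k-th powers of a pair of conjugate eigenvalues for every \<open>k\<close>.\<close>

fun tau :: "nat \<Rightarrow> real \<Rightarrow> real" where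
  "tau 0 x = 2"
| "tau (Suc 0) x = x"
| "tau (Suc (Suc k)) x = x * tau (Suc k) x - tau k x"

fun ups :: "nat \<Rightarrow> real \<Rightarrow> real" where
  "ups 0 x = 0"
| "ups (Suc 0) x = 1"
| "ups (Suc (Suc k)) x = x * ups (Suc k) x - ups k x"

text \<open>\<open>nd k l\<close> is the distance \<open>\<bar>k - l\<bar>\<close>; one of the two truncated differences vanishes.\<close>

definition nd :: "nat \<Rightarrow> nat \<Rightarrow> nat" where
  "nd k l = (k - l) + (l - k)"

lemma tau_2_cos: "tau k (2 * cos \<theta>) = 2 * cos (real k * \<theta>)"
\<comment> \<open>The induction rule of \<open>tau\<close> carries the argument \<open>x\<close>
  along; the predicate ignores it, and \<open>undefined\<close> fills the slot.\<close>
proof (induction k rule: tau.induct[of "\<lambda>k _. tau k (2 * cos \<theta>) = 2 * cos (real k * \<theta>)" _ undefined])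
  case (3 k)
  have "cos (real (Suc (Suc k)) * \<theta>) + cos (real k * \<theta>) = 2 * cos \<theta> * cos (real (Suc k) * \<theta>)"
    using cos_plus_cos[of "real (Suc (Suc k)) * \<theta>" "real k * \<theta>"] by (simp add: algebra_simps add_divide_distrib)
  then show ?case using 3 by (simp add: algebra_simps)
qed auto

lemma ups_2_cos: "ups k (2 * cos \<theta>) * sin \<theta> = sin (real k * \<theta>)"
proof (induction k rule: tau.induct[of "\<lambda>k _. ups k (2 * cos \<theta>) * sin \<theta> = sin (real k * \<theta>)" _ undefined])
  case (3 k)
  have "sin (real (Suc (Suc k)) * \<theta>) + sin (real k * \<theta>) = 2 * cos \<theta> * sin (real (Suc k) * \<theta>)"
    using sin_plus_sin[of "real (Suc (Suc k)) * \<theta>" "real k * \<theta>"] by (simp add: algebra_simps add_divide_distrib)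
  then show ?case using 3 by (simp add: algebra_simps)
qed auto

lemma in_Icc_2_cos:
  assumes "x \<in> {-2..2}"
  obtains \<theta> where "\<theta> \<in> {0..pi}" "x = 2 * cos \<theta>"
proof
  show "arccos (x / 2) \<in> {0..pi}" "x = 2 * cos (arccos (x / 2))"
    using assms arccos_lbound[of "x / 2"] arccos_ubound[of "x / 2"] cos_arccos[of "x / 2"] by auto
qed

lemma cos_nd: "cos (real (nd k l) * \<theta>) = cos (real k * \<theta> - real l * \<theta>)"
proof (cases "k \<le> l")
  case True
  then have "real (nd k l) * \<theta> = - (real k * \<theta> - real l * \<theta>)"
    by (simp add: nd_def of_nat_diff algebra_simps)
  then show ?thesis by (simp only: cos_minus)
qed (simp add: nd_def of_nat_diff algebra_simps)

lemma tau_mult_tau: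
  assumes "x \<in> {-2..2}"
  shows "tau k x * tau l x = tau (k + l) x + tau (nd k l) x"
  using assms
  by (rule in_Icc_2_cos) (simp add: tau_2_cos cos_nd cos_add cos_diff distrib_right)

lemma ups_mult_ups:
  assumes "x \<in> {-2..2}"
  shows "(4 - x\<^sup>2) * ups k x * ups l x = tau (nd k l) x - tau (k + l) x"
proof -
  obtain \<theta> where \<theta>: "x = 2 * cos \<theta>" using assms by (rule in_Icc_2_cos)
  have "4 - x\<^sup>2 = 4 * (sin \<theta>)\<^sup>2"
    by (simp add: \<theta> power_mult_distrib sin_squared_eq)
  then have "(4 - x\<^sup>2) * ups k x * ups l x = 4 * (ups k x * sin \<theta>) * (ups l x * sin \<theta>)"
    by (simp add: power2_eq_square)
  then show ?thesis
    unfolding \<theta> ups_2_cos tau_2_cos cos_nd by (simp add: cos_add cos_diff distrib_right)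
qed

text \<open>The rule 2 cos a sin b = sin (a + b) - sin (a - b). This lemma and
  \<open>ups_eq_tau\<close> are proved through the recursion, not through x = 2 cos \<theta>, since
  they are used for derivatives at every real \<open>x\<close>.\<close>

lemma tau_eq_ups: "tau (Suc k) x = ups (Suc (Suc k)) x - ups k x"
proof (induction k x rule: tau.induct)
  case (3 k x)
  have "tau (Suc (Suc (Suc k))) x = x * tau (Suc (Suc k)) x - tau (Suc k) x" by simp
  also have "\<dots> = x * (ups (Suc (Suc (Suc k))) x - ups (Suc k) x) - (ups (Suc (Suc k)) x - ups k x)"
    by (simp only: 3)
  also have "\<dots> = (x * ups (Suc (Suc (Suc k))) x - ups (Suc (Suc k)) x) - (x * ups (Suc k) x - ups k x)"
    by (simp add: right_diff_distrib del: ups.simps)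
  also have "\<dots> = ups (Suc (Suc (Suc (Suc k)))) x - ups (Suc (Suc k)) x"
    by (simp only: ups.simps(3))
  finally show ?case .
qed auto

lemma ups_eq_tau: "(4 - x\<^sup>2) * ups (Suc k) x = tau k x - tau (Suc (Suc k)) x"
proof (induction k x rule: tau.induct)
  case (1 x)
  then show ?case by (simp add: power2_eq_square)
next
  case (2 x)
  then show ?case by (simp add: power2_eq_square algebra_simps)
next
  case (3 k x)
  have "(4 - x\<^sup>2) * ups (Suc (Suc (Suc k))) x =
      x * ((4 - x\<^sup>2) * ups (Suc (Suc k)) x) - (4 - x\<^sup>2) * ups (Suc k) x"
    by (simp add: algebra_simps)
  also have "\<dots> = x * (tau (Suc k) x - tau (Suc (Suc (Suc k))) x) - (tau k x - tau (Suc (Suc k)) x)"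
    by (simp only: 3)
  finally show ?case by (simp add: algebra_simps)
qed

lemma DERIV_tau: "(tau k has_field_derivative real k * ups k x) (at x)"
proof (induction k x rule: tau.induct)
  case (1 x)
  have "tau 0 = (\<lambda>_. 2)" by auto
  then show ?case by simp
next
  case (2 x)
  have "tau (Suc 0) = (\<lambda>x. x)" by auto
  then show ?case by simp
next
  case (3 k x)
  have e: "tau (Suc (Suc k)) = (\<lambda>x. x * tau (Suc k) x - tau k x)" by auto
  have "((\<lambda>x. x * tau (Suc k) x - tau k x) has_field_derivative
      (1 * tau (Suc k) x + (real (Suc k) * ups (Suc k) x) * x - real k * ups k x)) (at x)"
    by (intro DERIV_diff DERIV_mult' DERIV_mult DERIV_ident 3)
  moreover have "1 * tau (Suc k) x + (real (Suc k) * ups (Suc k) x) * x - real k * ups k x =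
      real (Suc (Suc k)) * ups (Suc (Suc k)) x"
    by (simp add: tau_eq_ups algebra_simps)
  ultimately show ?case by (simp only: e)
qed

lemma continuous_tau: "continuous_on S (tau k)"
  by (rule DERIV_continuous_on) (auto intro: DERIV_tau has_field_derivative_at_within)

lemma ex_DERIV_ups: "\<exists>D. (ups k has_field_derivative D) (at x)"
proof (induction k x rule: tau.induct)
  case (1 x)
  have "ups 0 = (\<lambda>_. 0)" by auto
  then show ?case by (auto intro: DERIV_const)
next
  case (2 x)
  have "ups (Suc 0) = (\<lambda>_. 1)" by auto
  then show ?case by (auto intro: DERIV_const)
next
  case (3 k x)
  have e: "ups (Suc (Suc k)) = (\<lambda>x. x * ups (Suc k) x - ups k x)" by auto
  from 3 obtain D E where "(ups (Suc k) has_field_derivative D) (at x)" "(ups k has_field_derivative E) (at x)"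
    by blast
  from DERIV_diff[OF DERIV_mult[OF DERIV_ident this(1)] this(2)] show ?case unfolding e by blast
qed

lemma continuous_ups: "continuous_on S (ups k)"
  by (meson DERIV_isCont continuous_at_imp_continuous_on ex_DERIV_ups)

text \<open>A geometric sum in exp (i \<theta>). It turns the term \<open>x * ups k x\<close>, which
  arises when the weighted field is differentiated, into values of \<open>tau\<close>, that is, into
  traces of powers.\<close>

lemma sum_tau_nd: "(\<Sum>j<k. tau (nd k (2 * j)) x) = x * ups k x"
proof (induction k x rule: tau.induct)
  case (3 k x)
  have "(\<Sum>j<Suc (Suc k). tau (nd (Suc (Suc k)) (2 * j)) x) =
      tau (Suc (Suc k)) x + (\<Sum>j<Suc k. tau (nd k (2 * j)) x)"
  proof -
    have "nd (Suc (Suc k)) (2 * Suc j) = nd k (2 * j)" "nd (Suc (Suc k)) (2 * 0) = Suc (Suc k)" for j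
      by (simp_all add: nd_def)
    then show ?thesis by (simp only: sum.lessThan_Suc_shift)
  qed
  also have "(\<Sum>j<Suc k. tau (nd k (2 * j)) x) = x * ups k x + tau k x"
    using 3(2) by (simp add: nd_def)
  also have "tau (Suc (Suc k)) x + (x * ups k x + tau k x) = x * ups (Suc (Suc k)) x"
    using tau_eq_ups[of k x] by (simp add: distrib_left[symmetric] del: ups.simps)
  finally show ?case .
qed (auto simp: nd_def)

text \<open>The semicircle weight, extended by 0 outside [-2,2] so that it is continuous on the
  whole line and integrals can run over the whole space.\<close>

definition arc :: "real \<Rightarrow> real" where
  "arc x = sqrt (max 0 (4 - x\<^sup>2))"

lemma continuous_arc: "continuous_on S arc"
  unfolding arc_def by (intro continuous_intros)

lemma arc_nonneg: "0 \<le> arc x" by (simp add: arc_def)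

lemma arc_eq_0_iff: "arc x = 0 \<longleftrightarrow> x \<le> -2 \<or> 2 \<le> x"
proof -
  have "arc x = 0 \<longleftrightarrow> 2\<^sup>2 \<le> x\<^sup>2" by (auto simp: arc_def max_def)
  also have "\<dots> \<longleftrightarrow> 2 \<le> \<bar>x\<bar>" by (metis abs_le_square_iff abs_numeral)
  finally show ?thesis by auto
qed

lemma arc_eq: "x \<in> {-2..2} \<Longrightarrow> arc x = sqrt (4 - x\<^sup>2)"
  using abs_le_square_iff[of x 2] by (auto simp: arc_def max_def)

text \<open>The power 3/2 of the positive part of \<open>4 - x\<^sup>2\<close>, which is
  differentiable also at -2 and 2, where \<open>arc\<close> itself is not.\<close>

lemma DERIV_arc_cubed: "((\<lambda>x. (4 - x\<^sup>2) * arc x) has_field_derivative - 3 * x * arc x) (at x)"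
proof -
  consider "\<bar>x\<bar> < 2" | "\<bar>x\<bar> > 2" | "x = 2" | "x = -2" by linarith
  then show ?thesis
  proof cases
    case 1
    have pos: "4 - y\<^sup>2 > 0" if "y \<in> {-2<..<2}" for y :: real
      using that abs_square_less_1[of "y / 2"] by (simp add: power_divide abs_less_iff)
    have x: "x \<in> {-2<..<2}" using 1 by auto
    have "((\<lambda>y. (4 - y\<^sup>2) * sqrt (4 - y\<^sup>2)) has_field_derivative - 3 * x * sqrt (4 - x\<^sup>2)) (at x)"
      using pos[OF x]
      by (auto intro!: derivative_eq_intros simp: field_simps power2_eq_square)
    then have "((\<lambda>x. (4 - x\<^sup>2) * arc x) has_field_derivative - 3 * x * sqrt (4 - x\<^sup>2)) (at x)"
      by (rule DERIV_cong_ev[OF refl _ refl, THEN iffD1, rotated])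
        (rule eventually_mono[OF eventually_nhds_in_open[OF open_greaterThanLessThan x]], simp add: arc_eq)
    then show ?thesis using x by (simp add: arc_eq)
  next
    case 2
    have x: "x \<in> - {-2..2}" using 2 by auto
    have "arc x = 0" using 2 by (auto simp: arc_eq_0_iff)
    moreover have "((\<lambda>x. (4 - x\<^sup>2) * arc x) has_field_derivative 0) (at x)"
    proof (rule DERIV_cong_ev[OF refl _ refl, THEN iffD1])
      show "((\<lambda>x::real. 0::real) has_field_derivative 0) (at x)" by simp
      show "\<forall>\<^sub>F y in nhds x. 0 = (4 - y\<^sup>2) * arc y"
        by (rule eventually_mono[OF eventually_nhds_in_open[OF _ x]]) (auto simp: arc_eq_0_iff)
    qed
    ultimately show ?thesis by simp
  next
    case 3
    \<comment> \<open>At an end point one linear factor of \<open>4 - z\<^sup>2\<close> is split off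
      as the increment; the remaining quotient is continuous and vanishes there
      (Caratheodory).\<close>
    have "(\<forall>z. (4 - z\<^sup>2) * arc z - (4 - x\<^sup>2) * arc x = (- (z + 2) * arc z) * (z - x)) \<and>
        isCont (\<lambda>z. - (z + 2) * arc z) x \<and> - (x + 2) * arc x = - 3 * x * arc x"
      using 3 continuous_arc[of UNIV]
      by (auto simp: arc_eq_0_iff algebra_simps power2_eq_square continuous_on_eq_continuous_at intro!: continuous_intros)
    then show ?thesis
      unfolding CARAT_DERIV by (rule exI[of _ "\<lambda>z. - (z + 2) * arc z"])
  next
    case 4
    have "(\<forall>z. (4 - z\<^sup>2) * arc z - (4 - x\<^sup>2) * arc x = ((2 - z) * arc z) * (z - x)) \<and>
        isCont (\<lambda>z. (2 - z) * arc z) x \<and> (2 - x) * arc x = - 3 * x * arc x"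
      using 4 continuous_arc[of UNIV]
      by (auto simp: arc_eq_0_iff algebra_simps power2_eq_square continuous_on_eq_continuous_at intro!: continuous_intros)
    then show ?thesis
      unfolding CARAT_DERIV by (rule exI[of _ "\<lambda>z. (2 - z) * arc z"])
  qed
qed

text \<open>A component of the gradient of the k-th power sum for the weight
  \<open>4 - x\<^sup>2\<close>, as \<open>real k * ups k x\<close> is the derivative of
  \<open>tau k\<close>. The companion \<open>aux_r\<close> is its divergence with respect to
  \<open>arc\<close>, by \<open>DERIV_arc_aux_a\<close>.\<close>

definition aux_a :: "nat \<Rightarrow> real \<Rightarrow> real" where
  "aux_a k x = (4 - x\<^sup>2) * (real k * ups k x)"

definition aux_r :: "nat \<Rightarrow> real \<Rightarrow> real" where
  "aux_r k x = - real k * (real k * tau k x + 2 * (\<Sum>j<k. tau (nd k (2 * j)) x))"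

text \<open>The derivative is described only after multiplication by \<open>4 - x\<^sup>2\<close>,
  which stays meaningful at the end points. The equation comes from differentiating both sides of
  \<open>ups_eq_tau\<close>.\<close>

lemma DERIV_ups:
  obtains D where "(ups k has_field_derivative D) (at x)" "D * (4 - x\<^sup>2) = x * ups k x - real k * tau k x"
proof (cases k)
  case 0
  have "ups 0 = (\<lambda>_. 0)" by auto
  then show ?thesis using that[of 0] 0 by simp
next
  case (Suc m)
  obtain D where D: "(ups k has_field_derivative D) (at x)" using ex_DERIV_ups by blast
  have e: "(\<lambda>x. (4 - x\<^sup>2) * ups k x) = (\<lambda>x. tau m x - tau (Suc (Suc m)) x)"
    using ups_eq_tau[of _ m] Suc by auto
  have "((\<lambda>x. (4 - x\<^sup>2) * ups k x) has_field_derivative (- 2 * x * ups k x + D * (4 - x\<^sup>2))) (at x)"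
    by (rule derivative_eq_intros D | simp)+
  moreover have "((\<lambda>x. (4 - x\<^sup>2) * ups k x) has_field_derivative
      real m * ups m x - real (Suc (Suc m)) * ups (Suc (Suc m)) x) (at x)"
    unfolding e by (intro DERIV_diff DERIV_tau)
  ultimately have "- 2 * x * ups k x + D * (4 - x\<^sup>2) =
      real m * ups m x - real (Suc (Suc m)) * ups (Suc (Suc m)) x"
    by (rule DERIV_unique)
  then have "D * (4 - x\<^sup>2) = x * ups k x - real k * tau k x"
    unfolding Suc tau_eq_ups by (simp add: algebra_simps)
  then show ?thesis using that D by blast
qed

lemma DERIV_arc_aux_a: "((\<lambda>x. arc x * aux_a k x) has_field_derivative arc x * aux_r k x) (at x)"
proof -
  obtain D where D: "(ups k has_field_derivative D) (at x)"
    "D * (4 - x\<^sup>2) = x * ups k x - real k * tau k x" using DERIV_ups by blast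
  have "((\<lambda>x. (4 - x\<^sup>2) * arc x * (real k * ups k x)) has_field_derivative
      (- 3 * x * arc x * (real k * ups k x) + (real k * D) * ((4 - x\<^sup>2) * arc x))) (at x)"
    by (intro DERIV_mult DERIV_arc_cubed DERIV_cmult D)
  moreover have "- 3 * x * arc x * (real k * ups k x) + (real k * D) * ((4 - x\<^sup>2) * arc x) = arc x * aux_r k x"
  proof -
    have "- 3 * x * arc x * (real k * ups k x) + (real k * D) * ((4 - x\<^sup>2) * arc x) =
        arc x * real k * (- 3 * x * ups k x + D * (4 - x\<^sup>2))"
      by (simp add: algebra_simps)
    also have "- 3 * x * ups k x + D * (4 - x\<^sup>2) = - (real k * tau k x + 2 * (x * ups k x))"
      unfolding D(2) by simp
    finally show ?thesis
      unfolding aux_r_def sum_tau_nd by (simp only: mult_minus_left mult_minus_right mult.assoc)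
  qed
  ultimately show ?thesis by (simp add: aux_a_def mult_ac)
qed

text \<open>The recursion rewrites \<open>x * tau l x\<close> and \<open>y * tau (k - l) y\<close>
  by neighbouring indices, and the sum telescopes as in the Christoffel-Darboux formula. The term
  \<open>l = 0\<close> has no left neighbour and leaves the two middle terms.\<close>

lemma tau_telescope_step:
  "j < k \<Longrightarrow> (x - y) * (\<Sum>l<Suc j. tau l x * tau (k - l) y) =
    tau (Suc j) x * tau (k - j) y - 2 * tau (Suc k) y + x * tau k y - tau j x * tau (k - Suc j) y"
proof (induction j)
  case 0
  then obtain m where "k = Suc m" by (cases k) auto
  then show ?case by (simp add: algebra_simps)
next
  case (Suc j)
  define m where "m = k - Suc (Suc j)"
  have m: "k - j = Suc (Suc m)" "k - Suc j = Suc m" "k - Suc (Suc j) = m"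
    using Suc.prems by (auto simp: m_def)
  have "(x - y) * (\<Sum>l<Suc (Suc j). tau l x * tau (k - l) y) =
      (x - y) * (\<Sum>l<Suc j. tau l x * tau (k - l) y) + (x - y) * (tau (Suc j) x * tau (Suc m) y)"
    by (simp add: m algebra_simps)
  also have "\<dots> = tau (Suc j) x * tau (Suc (Suc m)) y - 2 * tau (Suc k) y + x * tau k y - tau j x * tau (Suc m) y
      + (x - y) * (tau (Suc j) x * tau (Suc m) y)"
    using Suc by (simp add: m)
  finally show ?case by (simp add: m algebra_simps)
qed

text \<open>The factor \<open>x - y\<close> cancels the pole of the logarithmic derivative of the
  squared Vandermonde product. Adding the telescoped sum to its mirror image in \<open>x\<close> and
  \<open>y\<close> makes the cofactor symmetric.\<close>

lemma aux_a_diff: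
  "2 * (aux_a k x - aux_a k y) =
    - real k * ((x - y) * (\<Sum>l<k. tau l x * tau (k - l) y + tau l y * tau (k - l) x))"
proof (cases k)
  case 0
  then show ?thesis by (simp add: aux_a_def)
next
  case (Suc m)
  have T: "(x - y) * (\<Sum>l<k. tau l x * tau (k - l) y) =
    tau k x * y - 2 * tau (Suc k) y + x * tau k y - tau m x * 2" for x y
    using tau_telescope_step[of m k x y] Suc by simp
  have "(x - y) * (\<Sum>l<k. tau l x * tau (k - l) y + tau l y * tau (k - l) x) =
      (x - y) * (\<Sum>l<k. tau l x * tau (k - l) y) - (y - x) * (\<Sum>l<k. tau l y * tau (k - l) x)"
    by (simp add: sum.distrib algebra_simps)
  also have "\<dots> = 2 * ((tau (Suc k) x - tau m x) - (tau (Suc k) y - tau m y))"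
    unfolding T by (simp add: algebra_simps)
  finally have e: "(x - y) * (\<Sum>l<k. tau l x * tau (k - l) y + tau l y * tau (k - l) x) =
      2 * ((tau (Suc k) x - tau m x) - (tau (Suc k) y - tau m y))" .
  have a: "aux_a k x = - real k * (tau (Suc k) x - tau m x)" for x
  proof -
    have "(4 - x\<^sup>2) * ups k x = tau m x - tau (Suc k) x"
      using ups_eq_tau[of x m] by (simp only: Suc)
    moreover have "aux_a k x = real k * ((4 - x\<^sup>2) * ups k x)" by (simp add: aux_a_def)
    ultimately show ?thesis by (simp only: mult_minus_left minus_diff_eq flip: mult_minus_right)
  qed
  show ?thesis unfolding e a by (simp add: right_diff_distrib del: tau.simps)
qed

text \<open>The integral of \<open>f (\<phi> h x)\<close> is constant in \<open>h\<close>;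
  differentiation at 0 under the integral sign gives the claim. It serves twice: for translations of
  \<open>real ^ 'n\<close> and for left multiplication on \<open>USp\<close>.\<close>

lemma integral_eq_0_flow:
  fixes f :: "'a \<Rightarrow> 'b::{euclidean_space}"
  assumes int: "integrable M f" and meas: "f' \<in> borel_measurable M"
    and pres: "\<And>h. integrable M (\<lambda>x. f (\<phi> h x))" "\<And>h. (\<integral>x. f (\<phi> h x) \<partial>M) = (\<integral>x. f x \<partial>M)"
    and zero: "\<And>x. x \<in> space M \<Longrightarrow> \<phi> 0 x = x"
    and deriv: "\<And>h x. x \<in> space M \<Longrightarrow> ((\<lambda>h. f (\<phi> h x)) has_vector_derivative f' (\<phi> h x)) (at (h::real))"
    and bound: "integrable M g" "\<And>h x. x \<in> space M \<Longrightarrow> \<bar>h\<bar> \<le> 1 \<Longrightarrow> norm (f' (\<phi> h x)) \<le> g x"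
  shows "(\<integral>x. f' x \<partial>M) = 0"
proof -
  define e where "e n = 1 / real (Suc n)" for n
  have e: "0 < e n" "e n \<le> 1" "e n \<noteq> 0" for n by (auto simp: e_def)
  have e0: "e \<longlonglongrightarrow> 0" unfolding e_def by (rule LIMSEQ_Suc[OF lim_1_over_n])
  define s where "s n x = (f (\<phi> (e n) x) - f x) /\<^sub>R e n" for n x
  have "(\<integral>x. s n x \<partial>M) = 0" for n
    unfolding s_def using int pres by simp
  moreover have "(\<lambda>n. \<integral>x. s n x \<partial>M) \<longlonglongrightarrow> (\<integral>x. f' x \<partial>M)"
  proof (rule integral_dominated_convergence[where w = g])
    show "s n \<in> borel_measurable M" for n
      unfolding s_def using int pres(1)[of "e n"] by (auto dest!: borel_measurable_integrable)
    show "AE x in M. (\<lambda>n. s n x) \<longlonglongrightarrow> f' x"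
    proof (rule AE_I2)
      fix x assume x: "x \<in> space M"
      have "((\<lambda>h. norm (f (\<phi> (0 + h) x) - f (\<phi> 0 x) - h *\<^sub>R f' (\<phi> 0 x)) / norm h) \<longlongrightarrow> 0) (at 0)"
        using deriv[OF x, of 0] unfolding has_vector_derivative_def has_derivative_at by simp
      then have "(\<lambda>n. norm (f (\<phi> (e n) x) - f x - e n *\<^sub>R f' x) / norm (e n)) \<longlonglongrightarrow> 0"
        using e0 e(3) zero[OF x] unfolding tendsto_at_iff_sequentially
        by (auto simp: o_def dest!: spec[of _ e])
      also have "(\<lambda>n. norm (f (\<phi> (e n) x) - f x - e n *\<^sub>R f' x) / norm (e n)) = (\<lambda>n. norm (s n x - f' x))"
      proof
        fix n
        have "s n x - f' x = (f (\<phi> (e n) x) - f x - e n *\<^sub>R f' x) /\<^sub>R e n"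
          using e(1)[of n] by (simp add: s_def scaleR_diff_right)
        then show "norm (f (\<phi> (e n) x) - f x - e n *\<^sub>R f' x) / norm (e n) = norm (s n x - f' x)"
          using e(1)[of n] by (simp add: divide_inverse mult.commute)
      qed
      finally show "(\<lambda>n. s n x) \<longlonglongrightarrow> f' x"
        by (intro LIM_zero_cancel[of _ "f' x"]) (rule tendsto_norm_zero_cancel)
    qed
    show "AE x in M. norm (s n x) \<le> g x" for n
    proof (rule AE_I2)
      fix x assume x: "x \<in> space M"
      \<comment> \<open>Mean value inequality: the difference quotient is bounded by
        \<open>f'\<close> at an intermediate time below 1, where \<open>g\<close> dominates.\<close>
      have "\<exists>h\<in>{0<..<e n}. norm (f (\<phi> (e n) x) - f (\<phi> 0 x)) \<le> norm ((e n - 0) *\<^sub>R f' (\<phi> h x))"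
      proof (rule mvt_general[OF e(1)])
        show "continuous_on {0..e n} (\<lambda>h. f (\<phi> h x))"
          using deriv[OF x] by (meson continuous_at_imp_continuous_on has_vector_derivative_continuous)
        show "((\<lambda>h. f (\<phi> h x)) has_derivative (\<lambda>y. y *\<^sub>R f' (\<phi> h x))) (at h)" for h
          using deriv[OF x, of h] by (simp add: has_vector_derivative_def)
      qed
      then obtain h where h: "0 < h" "h < e n" "norm (f (\<phi> (e n) x) - f x) \<le> e n * norm (f' (\<phi> h x))"
        using e(1)[of n] zero[OF x] by auto
      have "norm (f' (\<phi> h x)) \<le> g x" using bound(2)[OF x, of h] h e(2)[of n] by simp
      then have "norm (f (\<phi> (e n) x) - f x) \<le> e n * g x"
        using h(3) mult_left_mono[of _ "g x" "e n"] e(1)[of n] by (meson less_imp_le order_trans)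
      then show "norm (s n x) \<le> g x"
        using e(1)[of n] by (simp add: s_def divide_simps mult.commute)
    qed
  qed (use meas bound in auto)
  ultimately show ?thesis by (simp add: LIMSEQ_const_iff)
qed

section \<open>Integration by parts against the Weyl density\<close>

definition psum :: "nat \<Rightarrow> real ^ 'n::finite \<Rightarrow> real" where
  "psum k t = (\<Sum>i\<in>UNIV. tau k (t $ i))"

text \<open>The Weyl density up to a constant, in the coordinates t = 2 cos \<theta>: of the squared
  sine of each angle one factor is consumed by dt, which leaves \<open>arc\<close>.\<close>

definition weyl_w :: "real ^ 'n::{finite,linorder} \<Rightarrow> real" where
  "weyl_w t = (\<Prod>i\<in>UNIV. arc (t $ i)) * vdm t ^ 2"

definition weyl_int :: "(real ^ 'n::{finite,linorder} \<Rightarrow> real) \<Rightarrow> real" where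
  "weyl_int f = (\<integral>t. weyl_w t * f t \<partial>lborel)"

lemma prod_arc_eq_0: "t \<notin> cube \<Longrightarrow> (\<Prod>i\<in>UNIV. arc (t $ i)) = 0"
  by (auto simp: cube_def arc_eq_0_iff not_le) (meson less_imp_le)+

lemma weyl_w_eq_0: "t \<notin> cube \<Longrightarrow> weyl_w t = 0"
  by (simp add: weyl_w_def prod_arc_eq_0)

lemma weyl_w_nonneg: "0 \<le> weyl_w t"
  by (simp add: weyl_w_def prod_nonneg arc_nonneg)

lemma continuous_weyl_w: "continuous_on S weyl_w"
  unfolding weyl_w_def
  by (intro continuous_intros continuous_vdm continuous_on_compose2[OF continuous_arc[of UNIV]]) auto

lemma integrable_cube_support:
  fixes g :: "real ^ 'n::finite \<Rightarrow> real"
  assumes "continuous_on UNIV g" "\<And>t. t \<notin> cube \<Longrightarrow> g t = 0"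
  shows "integrable lborel g"
proof -
  have "integrable lborel (\<lambda>t. indicator cube t *\<^sub>R g t)"
    by (rule borel_integrable_compact[OF compact_cube continuous_on_subset[OF assms(1)]]) simp
  also have "(\<lambda>t. indicator cube t *\<^sub>R g t) = g"
    using assms(2) by (auto simp: indicator_def fun_eq_iff)
  finally show ?thesis .
qed

lemma integrable_weyl:
  "continuous_on UNIV f \<Longrightarrow> integrable lborel (\<lambda>t. weyl_w t * f t)"
  by (rule integrable_cube_support) (auto intro!: continuous_intros continuous_weyl_w simp: weyl_w_eq_0)

lemma weyl_int_add:
  "continuous_on UNIV f \<Longrightarrow> continuous_on UNIV g \<Longrightarrow> weyl_int (\<lambda>t. f t + g t) = weyl_int f + weyl_int g"
  unfolding weyl_int_def by (simp add: distrib_left integrable_weyl)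

lemma weyl_int_cmult: "weyl_int (\<lambda>t. c * f t) = c * weyl_int f"
  unfolding weyl_int_def by (simp add: mult.left_commute)

lemma weyl_int_sum:
  assumes "\<And>i. i \<in> I \<Longrightarrow> continuous_on UNIV (f i)"
  shows "weyl_int (\<lambda>t. \<Sum>i\<in>I. f i t) = (\<Sum>i\<in>I. weyl_int (f i))"
  unfolding weyl_int_def sum_distrib_left
  using assms by (intro Bochner_Integration.integral_sum integrable_weyl)

lemma weyl_int_cong: "(\<And>t. t \<in> cube \<Longrightarrow> f t = g t) \<Longrightarrow> weyl_int f = weyl_int g"
  unfolding weyl_int_def
  by (intro Bochner_Integration.integral_cong refl) (metis mult_eq_0_iff weyl_w_eq_0)

section \<open>Integration by parts in one coordinate\<close>

definition has_partial :: "(real ^ 'n::finite \<Rightarrow> real) \<Rightarrow> 'n \<Rightarrow> real \<Rightarrow> real ^ 'n \<Rightarrow> bool" where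
  "has_partial f i D t \<longleftrightarrow> ((\<lambda>h. f (t + h *\<^sub>R axis i 1)) has_field_derivative D) (at 0)"

lemma has_partial_shift:
  assumes "has_partial f i D (t + h *\<^sub>R axis i 1)"
  shows "((\<lambda>h. f (t + h *\<^sub>R axis i 1)) has_field_derivative D) (at h)"
  using assms DERIV_shift[of "\<lambda>h. f (t + h *\<^sub>R axis i 1)" D 0 h]
  by (simp add: has_partial_def algebra_simps)

lemma has_partial_mult:
  "has_partial f i D t \<Longrightarrow> has_partial g i E t \<Longrightarrow> has_partial (\<lambda>t. f t * g t) i (D * g t + E * f t) t"
  unfolding has_partial_def by (drule (1) DERIV_mult) simp

lemma has_partial_const: "has_partial (\<lambda>_. c) i 0 t"
  unfolding has_partial_def by simp

lemma has_partial_sum: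
  assumes "\<And>x. x \<in> A \<Longrightarrow> has_partial (f x) i (D x) t"
  shows "has_partial (\<lambda>t. \<Sum>x\<in>A. f x t) i (\<Sum>x\<in>A. D x) t"
  using assms unfolding has_partial_def by (rule DERIV_sum)

lemma has_partial_comp_nth:
  assumes "(f has_field_derivative D) (at (t $ j))"
  shows "has_partial (\<lambda>t. f (t $ j)) i (if j = i then D else 0) t"
proof (cases "j = i")
  case True
  have "((\<lambda>h. f (t $ i + h)) has_field_derivative D) (at 0)"
    using assms DERIV_shift[of f D 0 "t $ i"] True by (simp add: add.commute)
  then show ?thesis using True by (simp add: has_partial_def axis_def)
qed (simp add: has_partial_def axis_def)

lemma integral_partial_eq_0:
  fixes G G' :: "real ^ 'n::finite \<Rightarrow> real"
  assumes cont: "continuous_on UNIV G" "continuous_on UNIV G'"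
    and supp: "\<And>t. t \<notin> cube \<Longrightarrow> G t = 0" "\<And>t. t \<notin> cube \<Longrightarrow> G' t = 0"
    and part: "\<And>t. has_partial G i (G' t) t"
  shows "(\<integral>t. G' t \<partial>lborel) = 0"
proof -
  let ?\<phi> = "\<lambda>h t. t + h *\<^sub>R axis i 1 :: real ^ 'n"
  have int: "integrable lborel G" "integrable lborel G'"
    using cont supp by (auto intro: integrable_cube_support)
  have shift: "integrable lborel (\<lambda>t. G (c + t)) \<and> (\<integral>t. G (c + t) \<partial>lborel) = (\<integral>t. G t \<partial>lborel)" for c
  proof -
    have d: "distr lborel borel ((+) c) = (lborel :: (real ^ 'n) measure)" by (rule lborel_distr_plus)
    have m: "G \<in> borel_measurable borel" using int by auto
    show ?thesis
      using int(1) m integrable_distr_eq[of "(+) c" lborel borel G] integral_distr[of "(+) c" lborel borel G]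
      by (simp add: d)
  qed
  have "bounded (G' ` cube)"
    by (intro compact_imp_bounded compact_continuous_image compact_cube continuous_on_subset[OF cont(2)]) simp
  then obtain B where "\<forall>y\<in>G' ` cube. norm y \<le> B" by (auto simp: bounded_iff)
  then have B: "norm (G' t) \<le> \<bar>B\<bar>" for t
    using supp(2)[of t] by (cases "t \<in> cube") force+
  \<comment> \<open>For \<open>\<bar>h\<bar> \<le> 1\<close> the shifted support stays in the cube
    enlarged by one in each direction.\<close>
  let ?K = "cbox (\<chi> i. -3) (\<chi> i. 3) :: (real ^ 'n) set"
  show ?thesis
  proof (rule integral_eq_0_flow[where f = G and \<phi> = ?\<phi> and g = "\<lambda>t. \<bar>B\<bar> * indicator ?K t"])
    show "integrable lborel (\<lambda>t. G (t + h *\<^sub>R axis i 1))" "(\<integral>t. G (t + h *\<^sub>R axis i 1) \<partial>lborel) = (\<integral>t. G t \<partial>lborel)" for h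
      using shift[of "h *\<^sub>R axis i 1"] by (simp_all add: add.commute)
    show "((\<lambda>h. G (t + h *\<^sub>R axis i 1)) has_vector_derivative G' (t + h *\<^sub>R axis i 1)) (at h)" for t h
      using has_partial_shift[OF part] by (simp add: has_real_derivative_iff_has_vector_derivative)
    show "integrable lborel (\<lambda>t. \<bar>B\<bar> * indicator ?K t)"
      by (intro integrable_mult_right integrable_real_indicator) (auto simp: emeasure_lborel_cbox_finite[unfolded infinity_ennreal_def])
    show "norm (G' (t + h *\<^sub>R axis i 1)) \<le> \<bar>B\<bar> * indicator ?K t" if "\<bar>h\<bar> \<le> 1" for h t
    proof (cases "t \<in> ?K")
      case False
      have "t + h *\<^sub>R axis i 1 \<notin> cube"
      proof
        assume c: "t + h *\<^sub>R axis i 1 \<in> cube"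
        have "-3 \<le> t $ j \<and> t $ j \<le> 3" for j
        proof -
          have "-2 \<le> t $ j + h * axis i 1 $ j \<and> t $ j + h * axis i 1 $ j \<le> 2"
            using c by (simp add: cube_def)
          moreover have "\<bar>h * axis i 1 $ j\<bar> \<le> 1" using that by (simp add: axis_def)
          ultimately show ?thesis by linarith
        qed
        then show False using False by (auto simp: mem_box_cart)
      qed
      then show ?thesis using supp(2) by simp
    qed (use B[of "t + h *\<^sub>R axis i 1"] in simp)
  qed (use int in auto)
qed

text \<open>Products of traces from splitting the word m^k in two, plus traces of m^(k - 2j) from
  inverting one piece by the symplectic adjoint; \<open>cLam\<close> is the same expression on the
  group. On the cube it is the weighted divergence of the field \<open>aux_a k\<close>, divided by
  \<open>- k\<close>.\<close>

definition Lam :: "nat \<Rightarrow> real ^ 'n::finite \<Rightarrow> real" where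
  "Lam k t = (\<Sum>j<k. psum j t * psum (k - j) t + psum (nd k (2 * j)) t)"

lemma continuous_psum: "continuous_on S (psum k)"
  unfolding psum_def by (intro continuous_intros continuous_on_compose2[OF continuous_tau[of UNIV]]) auto

lemma continuous_Lam: "continuous_on S (Lam k)"
  unfolding Lam_def by (intro continuous_intros continuous_psum)

lemma sum_pairs_symmetrize:
  fixes f :: "'n::{finite,linorder} \<Rightarrow> 'n \<Rightarrow> real"
  shows "(\<Sum>(j, m) | j < m. f m j + f j m) + (\<Sum>i\<in>UNIV. f i i) = (\<Sum>i\<in>UNIV. \<Sum>j\<in>UNIV. f i j)"
proof -
  let ?A = "{(j, m). j < (m :: 'n)}" and ?B = "{(j, m). m < (j :: 'n)}" and ?C = "{(j, m). j = (m :: 'n)}"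
  have "(\<Sum>i\<in>UNIV. \<Sum>j\<in>UNIV. f i j) = (\<Sum>(i, j)\<in>?A \<union> ?B \<union> ?C. f i j)"
  proof -
    have "?A \<union> ?B \<union> ?C = UNIV \<times> UNIV" by auto
    then show ?thesis by (simp add: sum.cartesian_product)
  qed
  also have "\<dots> = (\<Sum>(i, j)\<in>?A. f i j) + (\<Sum>(i, j)\<in>?B. f i j) + (\<Sum>(i, j)\<in>?C. f i j)"
    by (subst sum.union_disjoint; (subst sum.union_disjoint)?) auto
  also have "(\<Sum>(i, j)\<in>?B. f i j) = (\<Sum>(i, j)\<in>?A. f j i)"
    by (rule sum.reindex_bij_witness[of _ prod.swap prod.swap]) auto
  also have "(\<Sum>(i, j)\<in>?C. f i j) = (\<Sum>i\<in>UNIV. f i i)"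
    by (rule sum.reindex_bij_witness[of _ "\<lambda>i. (i, i)" fst]) auto
  also have "(\<Sum>(i, j)\<in>?A. f i j) + (\<Sum>(i, j)\<in>?A. f j i) = (\<Sum>(j, m)\<in>?A. f m j + f j m)"
    by (simp add: sum.distrib[symmetric] case_prod_unfold add.commute)
  finally show ?thesis by simp
qed

text \<open>The sum of the \<open>tau (nd k (2 * j))\<close> occurs twice in \<open>aux_r\<close>:
  one copy combines with \<open>real k * tau k\<close> to the diagonal part of the products
  \<open>psum j t * psum (k - j) t\<close>, the other is the second summand of \<open>Lam\<close>.
  The pair sum supplies the off-diagonal part.\<close>

lemma sum_aux_r_eq:
  fixes t :: "real ^ 'n::{finite,linorder}"
  assumes "t \<in> cube"
  shows "(\<Sum>i\<in>UNIV. aux_r k (t $ i)) - real k * (\<Sum>(j, m) | j < m.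
      \<Sum>l<k. tau l (t $ m) * tau (k - l) (t $ j) + tau l (t $ j) * tau (k - l) (t $ m)) = - real k * Lam k t"
proof -
  have sq: "(\<Sum>l<k. tau l (t $ i) * tau (k - l) (t $ i)) =
      real k * tau k (t $ i) + (\<Sum>l<k. tau (nd k (2 * l)) (t $ i))" for i
  proof -
    have "tau l (t $ i) * tau (k - l) (t $ i) = tau k (t $ i) + tau (nd k (2 * l)) (t $ i)" if "l < k" for l
    proof -
      have "nd l (k - l) = nd k (2 * l)" using that by (auto simp: nd_def)
      then show ?thesis using tau_mult_tau[of "t $ i" l "k - l"] assms that by (simp add: cube_def)
    qed
    then show ?thesis by (simp add: sum.distrib)
  qed
  define f where "f i j = (\<Sum>l<k. tau l (t $ i) * tau (k - l) (t $ j))" for i j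
  have "(\<Sum>l<k. psum l t * psum (k - l) t) = (\<Sum>i\<in>UNIV. \<Sum>j\<in>UNIV. f i j)"
    unfolding psum_def sum_product f_def
    by (subst sum.swap, intro sum.cong refl, rule sum.swap)
  also have "\<dots> = (\<Sum>(j, m) | j < m. f m j + f j m) + (\<Sum>i\<in>UNIV. f i i)"
    by (rule sum_pairs_symmetrize[symmetric])
  finally have 1: "(\<Sum>l<k. psum l t * psum (k - l) t) =
      (\<Sum>(j, m) | j < m. f m j + f j m) + (\<Sum>i\<in>UNIV. f i i)" .
  have 2: "(\<Sum>l<k. psum (nd k (2 * l)) t) = (\<Sum>i\<in>UNIV. \<Sum>l<k. tau (nd k (2 * l)) (t $ i))"
    unfolding psum_def by (rule sum.swap)
  have 3: "(\<Sum>i\<in>UNIV. aux_r k (t $ i)) =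
      - real k * ((\<Sum>i\<in>UNIV. f i i) + (\<Sum>i\<in>UNIV. \<Sum>l<k. tau (nd k (2 * l)) (t $ i)))"
    by (simp add: f_def sq aux_r_def sum_distrib_left[symmetric] sum.distrib sum_negf)
  show ?thesis
    unfolding Lam_def sum.distrib 1 2 3 f_def[symmetric] by (simp add: algebra_simps f_def sum.distrib)
qed

text \<open>The product rule written out, which stays valid where \<open>vdm\<close> vanishes,
  unlike a logarithmic derivative.\<close>

definition vdm2_partial :: "'n \<Rightarrow> real ^ 'n::{finite,linorder} \<Rightarrow> real" where
  "vdm2_partial i t = (\<Sum>q | fst q < snd q. 2 * (t $ snd q - t $ fst q) *
      ((if snd q = i then 1 else 0) - (if fst q = i then 1 else 0)) *
      (\<Prod>q'\<in>{q. fst q < snd q} - {q}. (t $ snd q' - t $ fst q')\<^sup>2))"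

lemma vdm_power2: "vdm t ^ 2 = (\<Prod>q | fst q < snd q. (t $ snd q - t $ fst q)\<^sup>2)"
  by (simp add: vdm_def prod_power_distrib case_prod_unfold)

lemma has_partial_vdm2: "has_partial (\<lambda>t. vdm t ^ 2) i (vdm2_partial i t) t"
  unfolding has_partial_def vdm_power2 vdm2_partial_def
proof -
  have "((\<lambda>h. ((t + h *\<^sub>R axis i 1) $ b - (t + h *\<^sub>R axis i 1) $ a)\<^sup>2) has_real_derivative
      2 * (t $ b - t $ a) * ((if b = i then 1 else 0) - (if a = i then 1 else 0))) (at 0)" for a b
    by (auto intro!: derivative_eq_intros simp: axis_def)
  from has_field_derivative_prod[where A="{q. fst q < snd q}" and z=0 and
      f="\<lambda>q h. ((t + h *\<^sub>R axis i 1) $ snd q - (t + h *\<^sub>R axis i 1) $ fst q)\<^sup>2", OF this]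
  show "((\<lambda>h. \<Prod>q | fst q < snd q. ((t + h *\<^sub>R axis i 1) $ snd q - (t + h *\<^sub>R axis i 1) $ fst q)\<^sup>2)
     has_real_derivative
     (\<Sum>q | fst q < snd q. 2 * (t $ snd q - t $ fst q) *
      ((if snd q = i then 1 else 0) - (if fst q = i then 1 else 0)) *
      (\<Prod>q'\<in>{q. fst q < snd q} - {q}. (t $ snd q' - t $ fst q')\<^sup>2))) (at 0)"
    by simp
qed

text \<open>Differentiating the square of a pair \<open>q\<close> leaves one factor
  \<open>t $ snd q - t $ fst q\<close>; \<open>aux_a_diff\<close> provides another, so the full
  square, and with it \<open>vdm t ^ 2\<close>, is restored.\<close>

lemma sum_aux_a_vdm2_partial:
  fixes t :: "real ^ 'n::{finite,linorder}"
  shows "(\<Sum>i\<in>UNIV. aux_a k (t $ i) * vdm2_partial i t) =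
    - real k * vdm t ^ 2 * (\<Sum>(j, m) | j < m.
      \<Sum>l<k. tau l (t $ m) * tau (k - l) (t $ j) + tau l (t $ j) * tau (k - l) (t $ m))"
proof -
  let ?Q = "{q :: 'n \<times> 'n. fst q < snd q}"
  let ?R = "\<lambda>q. \<Prod>q'\<in>?Q - {q}. (t $ snd q' - t $ fst q')\<^sup>2"
  let ?S = "\<lambda>x y. \<Sum>l<k. tau l x * tau (k - l) y + tau l y * tau (k - l) x"
  have "(\<Sum>i\<in>UNIV. aux_a k (t $ i) * vdm2_partial i t) =
      (\<Sum>q\<in>?Q. \<Sum>i\<in>UNIV. aux_a k (t $ i) * (2 * (t $ snd q - t $ fst q) *
      ((if snd q = i then 1 else 0) - (if fst q = i then 1 else 0)) * ?R q))"
    unfolding vdm2_partial_def sum_distrib_left by (rule sum.swap)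
  also have "\<dots> = (\<Sum>q\<in>?Q. (t $ snd q - t $ fst q) * ?R q * (2 * (aux_a k (t $ snd q) - aux_a k (t $ fst q))))"
  proof (rule sum.cong[OF refl])
    fix q
    have "(\<Sum>i\<in>UNIV. aux_a k (t $ i) * ((if snd q = i then 1 else 0) - (if fst q = i then 1 else 0))) =
        aux_a k (t $ snd q) - aux_a k (t $ fst q)"
      by (simp add: right_diff_distrib sum_subtractf if_distrib[where f="\<lambda>x. _ * x"] cong: if_cong)
    then have "2 * (t $ snd q - t $ fst q) * ?R q * (aux_a k (t $ snd q) - aux_a k (t $ fst q)) =
       (\<Sum>i\<in>UNIV. 2 * (t $ snd q - t $ fst q) * ?R q *
         (aux_a k (t $ i) * ((if snd q = i then 1 else 0) - (if fst q = i then 1 else 0))))"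
      by (simp only: sum_distrib_left[symmetric])
    then show "(\<Sum>i\<in>UNIV. aux_a k (t $ i) * (2 * (t $ snd q - t $ fst q) *
      ((if snd q = i then 1 else 0) - (if fst q = i then 1 else 0)) * ?R q)) =
      (t $ snd q - t $ fst q) * ?R q * (2 * (aux_a k (t $ snd q) - aux_a k (t $ fst q)))"
      by (simp only: mult_ac)
  qed
  also have "\<dots> = (\<Sum>q\<in>?Q. - real k * vdm t ^ 2 * ?S (t $ snd q) (t $ fst q))"
  proof (rule sum.cong[OF refl])
    fix q assume q: "q \<in> ?Q"
    have "vdm t ^ 2 = (t $ snd q - t $ fst q)\<^sup>2 * ?R q"
      unfolding vdm_power2 using q by (intro prod.remove) auto
    then show "(t $ snd q - t $ fst q) * ?R q * (2 * (aux_a k (t $ snd q) - aux_a k (t $ fst q))) =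
        - real k * vdm t ^ 2 * ?S (t $ snd q) (t $ fst q)"
      unfolding aux_a_diff by (simp add: power2_eq_square mult_ac)
  qed
  finally show ?thesis by (simp only: sum_distrib_left case_prod_unfold)
qed

lemma continuous_aux_a: "continuous_on S (aux_a k)"
  unfolding aux_a_def by (intro continuous_intros continuous_ups)

lemma continuous_aux_r: "continuous_on S (aux_r k)"
  unfolding aux_r_def by (intro continuous_intros continuous_tau)

text \<open>The divergence of the compactly supported field with components
  \<open>weyl_w t * aux_a k (t $ i) * f t\<close> integrates to zero.\<close>

lemma weyl_loop:
  fixes f :: "real ^ 'n::{finite,linorder} \<Rightarrow> real"
  assumes cont: "continuous_on UNIV f" "\<And>i. continuous_on UNIV (f' i)"
    and part: "\<And>i t. has_partial f i (f' i t) t"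
  shows "weyl_int (\<lambda>t. real k * (Lam k t * f t) - (\<Sum>i\<in>UNIV. aux_a k (t $ i) * f' i t)) = 0"
proof -
  \<comment> \<open>\<open>arc\<close> alone is not differentiable at the end points, but its
    product with \<open>aux_a k\<close> is; hence the grouping.\<close>
  define G where "G i t = (arc (t $ i) * aux_a k (t $ i)) * ((\<Prod>j\<in>UNIV - {i}. arc (t $ j)) * (vdm t ^ 2 * f t))"
    for i and t :: "real ^ 'n::_"
  define G' where "G' i t = (\<Prod>j\<in>UNIV. arc (t $ j)) * (aux_r k (t $ i) * (vdm t ^ 2 * f t) +
      aux_a k (t $ i) * (vdm2_partial i t * f t + f' i t * vdm t ^ 2))"
    for i and t :: "real ^ 'n::_"
  note ci = continuous_intros continuous_vdm continuous_on_compose2[OF continuous_arc[of UNIV]]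
      continuous_on_compose2[OF continuous_aux_a[of UNIV]] continuous_on_compose2[OF continuous_aux_r[of UNIV]] cont
  have contV: "continuous_on UNIV (vdm2_partial i)" for i :: 'n
    unfolding vdm2_partial_def by (intro continuous_intros)
  have rem: "(\<Prod>j\<in>UNIV. arc (t $ j)) = arc (t $ i) * (\<Prod>j\<in>UNIV - {i}. arc (t $ j))" for i and t :: "real ^ 'n::_"
    by (rule prod.remove) auto
  have zero: "(\<integral>t. G' i t \<partial>lborel) = 0" for i
  proof (rule integral_partial_eq_0)
    show "continuous_on UNIV (G i)" unfolding G_def by (intro ci) auto
    show cG': "continuous_on UNIV (G' i)" unfolding G'_def by (intro ci contV) auto
    show "G i t = 0" if "t \<notin> cube" for t
      using prod_arc_eq_0[OF that] unfolding rem[of t i] by (auto simp: G_def)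
    show "G' i t = 0" if "t \<notin> cube" for t
      using prod_arc_eq_0[OF that] by (simp add: G'_def)
    show "has_partial (G i) i (G' i t) t" for t
    proof -
      have 1: "has_partial (\<lambda>t. arc (t $ i) * aux_a k (t $ i)) i (arc (t $ i) * aux_r k (t $ i)) t"
        using has_partial_comp_nth[OF DERIV_arc_aux_a, where t=t and i=i and j=i] by simp
      have 2: "has_partial (\<lambda>t. \<Prod>j\<in>UNIV - {i}. arc (t $ j)) i 0 t"
      proof -
        have "(\<Prod>j\<in>UNIV - {i}. arc ((t + h *\<^sub>R axis i 1) $ j)) = (\<Prod>j\<in>UNIV - {i}. arc (t $ j))" for h
          by (intro prod.cong refl) (auto simp: axis_def)
        then show ?thesis by (simp add: has_partial_def)
      qed
      have "has_partial (G i) i (arc (t $ i) * aux_r k (t $ i) * ((\<Prod>j\<in>UNIV - {i}. arc (t $ j)) * (vdm t ^ 2 * f t)) +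
         (0 * (vdm t ^ 2 * f t) + (vdm2_partial i t * f t + f' i t * vdm t ^ 2) * (\<Prod>j\<in>UNIV - {i}. arc (t $ j))) *
         (arc (t $ i) * aux_a k (t $ i))) t"
        unfolding G_def by (intro has_partial_mult 1 2 has_partial_vdm2 part)
      then show ?thesis unfolding G'_def rem[of t i] by (simp add: algebra_simps)
    qed
  qed
  have int: "integrable lborel (G' i)" for i
    by (rule integrable_cube_support) (auto simp: G'_def prod_arc_eq_0 intro!: ci contV)
  have "(\<Sum>i\<in>UNIV. G' i t) = - (weyl_w t * (real k * (Lam k t * f t) - (\<Sum>i\<in>UNIV. aux_a k (t $ i) * f' i t)))" for t
  proof (cases "t \<in> cube")
    case True
    let ?P = "\<Prod>j\<in>UNIV. arc (t $ j)"
    let ?S = "\<Sum>(j, m) | j < m.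
      \<Sum>l<k. tau l (t $ m) * tau (k - l) (t $ j) + tau l (t $ j) * tau (k - l) (t $ m)"
    have "(\<Sum>i\<in>UNIV. G' i t) = ?P * ((\<Sum>i\<in>UNIV. aux_r k (t $ i)) * (vdm t ^ 2 * f t) +
        (\<Sum>i\<in>UNIV. aux_a k (t $ i) * vdm2_partial i t) * f t + (\<Sum>i\<in>UNIV. aux_a k (t $ i) * f' i t) * vdm t ^ 2)"
      unfolding G'_def sum_distrib_left[symmetric] sum_distrib_right sum.distrib[symmetric]
      by (intro arg_cong2[where f="(*)"] sum.cong refl) (simp add: algebra_simps)
    also have "\<dots> = ?P * (((\<Sum>i\<in>UNIV. aux_r k (t $ i)) - real k * ?S) * (vdm t ^ 2 * f t) +
        (\<Sum>i\<in>UNIV. aux_a k (t $ i) * f' i t) * vdm t ^ 2)"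
      unfolding sum_aux_a_vdm2_partial by (simp add: algebra_simps)
    also have "\<dots> = - (weyl_w t * (real k * (Lam k t * f t) - (\<Sum>i\<in>UNIV. aux_a k (t $ i) * f' i t)))"
      unfolding sum_aux_r_eq[OF True] weyl_w_def by (simp add: algebra_simps)
    finally show ?thesis .
  qed (simp add: G'_def prod_arc_eq_0 weyl_w_eq_0)
  then have "weyl_int (\<lambda>t. real k * (Lam k t * f t) - (\<Sum>i\<in>UNIV. aux_a k (t $ i) * f' i t)) =
      (\<integral>t. - (\<Sum>i\<in>UNIV. G' i t) \<partial>lborel)"
    by (simp add: weyl_int_def)
  also have "\<dots> = - (\<Sum>i\<in>UNIV. \<integral>t. G' i t \<partial>lborel)"
    using int by (simp add: Bochner_Integration.integral_sum)
  finally show ?thesis by (simp add: zero)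
qed

section \<open>Total mass of the Weyl density and its loop equations\<close>

fun upsp :: "nat \<Rightarrow> real poly" where
  "upsp 0 = 1"
| "upsp (Suc 0) = [:0, 1:]"
| "upsp (Suc (Suc k)) = [:0, 1:] * upsp (Suc k) - upsp k"

lemma poly_upsp: "poly (upsp k) x = ups (Suc k) x"
  by (induction k rule: upsp.induct) auto

lemma upsp_monic: "degree (upsp k) \<le> k \<and> coeff (upsp k) k = 1"
proof (induction k rule: upsp.induct)
  case (3 k)
  have "degree (upsp k) \<le> Suc (Suc k)" "coeff (upsp k) (Suc (Suc k)) = 0"
    using 3(2) by (auto intro: coeff_eq_0)
  moreover have "degree ([:0, 1:] * upsp (Suc k)) \<le> Suc (Suc k)"
    using 3(1) by (auto intro!: degree_pCons_le order.trans[OF degree_pCons_le])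
  ultimately show ?case using 3 by (auto intro: degree_diff_le)
qed auto

lemma det_ups:
  fixes t :: "real ^ 'n::{finite,linorder}"
  shows "det (\<chi> k i. ups (Suc (rk i)) (t $ k)) = vdm t"
  using det_poly_family[of "\<lambda>i. upsp (rk i)" t] upsp_monic by (simp add: poly_upsp)

text \<open>With x = 2 cos \<theta> the function is 2 sin (n \<theta>). For \<open>n > 0\<close>
  this provides primitives of \<open>tau n x / arc x\<close>.\<close>

lemma DERIV_arc_ups:
  assumes "x \<in> {-2<..<2}"
  shows "((\<lambda>x. arc x * ups n x) has_field_derivative - real n * tau n x / arc x) (at x)"
proof -
  obtain D where D: "(ups n has_field_derivative D) (at x)"
    "D * (4 - x\<^sup>2) = x * ups n x - real n * tau n x" using DERIV_ups by blast
  have pos: "4 - x\<^sup>2 > 0"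
    using assms abs_square_less_1[of "x / 2"] by (simp add: power_divide abs_less_iff)
  have arc: "arc x = sqrt (4 - x\<^sup>2)" using assms by (intro arc_eq) auto
  have sq: "sqrt (4 - x\<^sup>2) * sqrt (4 - x\<^sup>2) = 4 - x\<^sup>2" using pos by simp
  have "((\<lambda>y. sqrt (4 - y\<^sup>2)) has_field_derivative - x / sqrt (4 - x\<^sup>2)) (at x)"
    using pos by (auto intro!: derivative_eq_intros simp: field_simps)
  then have "(arc has_field_derivative - x / sqrt (4 - x\<^sup>2)) (at x)"
    by (rule DERIV_cong_ev[OF refl _ refl, THEN iffD1, rotated])
      (rule eventually_mono[OF eventually_nhds_in_open[OF open_greaterThanLessThan assms]], simp add: arc_eq)
  then have "((\<lambda>x. arc x * ups n x) has_field_derivative (- x / sqrt (4 - x\<^sup>2) * ups n x + D * arc x)) (at x)"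
    by (intro DERIV_mult D)
  moreover have "- x / sqrt (4 - x\<^sup>2) * ups n x + D * arc x = - real n * tau n x / arc x"
  proof -
    have "- x / sqrt (4 - x\<^sup>2) * ups n x + D * arc x = (- x * ups n x + D * (4 - x\<^sup>2)) / sqrt (4 - x\<^sup>2)"
      using pos sq by (simp add: arc field_simps)
    then show ?thesis by (simp add: D(2) arc)
  qed
  ultimately show ?thesis by simp
qed

lemma DERIV_arc_ups_divide:
  assumes "x \<in> {-2<..<2}" "n > 0"
  shows "((\<lambda>x. (arc x * ups n x) / real n) has_field_derivative - tau n x / arc x) (at x)"
  using DERIV_cdivide[OF DERIV_arc_ups[OF assms(1), of n], of "real n"] assms(2) by simp

lemma ups_orthogonal_has_integral:
  assumes "a > 0" "b > 0"
  shows "((\<lambda>x. arc x * ups a x * ups b x) has_integral (if a = b then 2 * pi else 0)) {-2..2}"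
proof -
  \<comment> \<open>By \<open>ups_mult_ups\<close> the integrand is
    \<open>(tau (nd a b) x - tau (a + b) x) / arc x\<close>. For \<open>a = b\<close> the first
    index is 0 and its primitive is \<open>2 * arcsin (x / 2)\<close>, whose increment is
    \<open>2 * pi\<close>.\<close>
  define \<Phi> where "\<Phi> x = (if a = b then 2 * arcsin (x / 2) else - (arc x * ups (nd a b) x) / real (nd a b)) +
      (arc x * ups (a + b) x) / real (a + b)" for x
  have arc2: "arc 2 = 0" "arc (-2) = 0" by (simp_all add: arc_eq_0_iff)
  have "((\<lambda>x. arc x * ups a x * ups b x) has_integral (\<Phi> 2 - \<Phi> (-2))) {-2..2}"
  proof (rule fundamental_theorem_of_calculus_interior)
    have "continuous_on {-2..2::real} (\<lambda>x. arcsin (x / 2))"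
      by (intro continuous_on_arcsin continuous_intros) auto
    then show "continuous_on {-2..2} \<Phi>"
      unfolding \<Phi>_def using assms
      by (cases "a = b") (auto simp: nd_def intro!: continuous_intros continuous_arc continuous_ups)
    fix x :: real assume x: "x \<in> {-2<..<2}"
    have pos: "4 - x\<^sup>2 > 0"
      using x abs_square_less_1[of "x / 2"] by (simp add: power_divide abs_less_iff)
    have arc: "arc x = sqrt (4 - x\<^sup>2)" using x by (intro arc_eq) auto
    have ar0: "arc x \<noteq> 0" using pos by (simp add: arc)
    have 1: "((\<lambda>x. (arc x * ups (a + b) x) / real (a + b)) has_field_derivative - tau (a + b) x / arc x) (at x)"
      using assms by (intro DERIV_arc_ups_divide x) simp
    have 2: "((\<lambda>x. if a = b then 2 * arcsin (x / 2) else - (arc x * ups (nd a b) x) / real (nd a b))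
        has_field_derivative tau (nd a b) x / arc x) (at x)"
    proof (cases "a = b")
      case True
      have e: "1 - (x / 2)\<^sup>2 = (4 - x\<^sup>2) / 4" by (simp add: power_divide)
      have s: "sqrt (1 - (x / 2)\<^sup>2) = sqrt (4 - x\<^sup>2) / 2"
        unfolding e real_sqrt_divide by simp
      have "((\<lambda>x. arcsin (x / 2)) has_field_derivative inverse (sqrt (1 - (x / 2)\<^sup>2)) * (1 / 2)) (at x)"
        using x by (intro DERIV_chain2[OF DERIV_arcsin]) (auto intro!: derivative_eq_intros)
      then have "((\<lambda>x. 2 * arcsin (x / 2)) has_field_derivative 2 * (inverse (sqrt (1 - (x / 2)\<^sup>2)) * (1 / 2))) (at x)"
        by (rule DERIV_cmult)
      moreover have "2 * (inverse (sqrt (1 - (x / 2)\<^sup>2)) * (1 / 2)) = tau (nd a b) x / arc x"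
        unfolding s arc using True by (simp add: nd_def)
      ultimately show ?thesis using True by (simp only: if_True refl)
    next
      case False
      then have n0: "nd a b > 0" by (auto simp: nd_def)
      show ?thesis
        using DERIV_cdivide[OF DERIV_minus[OF DERIV_arc_ups[OF x, of "nd a b"]], of "real (nd a b)"] n0 False
        by simp
    qed
    have "(\<Phi> has_field_derivative tau (nd a b) x / arc x + - tau (a + b) x / arc x) (at x)"
      unfolding \<Phi>_def by (rule DERIV_add[OF 2 1])
    moreover have "tau (nd a b) x / arc x + - tau (a + b) x / arc x = arc x * ups a x * ups b x"
    proof -
      have "(4 - x\<^sup>2) * ups a x * ups b x = tau (nd a b) x - tau (a + b) x"
        using x by (intro ups_mult_ups) auto
      moreover have "4 - x\<^sup>2 = arc x * arc x" using pos by (simp add: arc)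
      ultimately show ?thesis using ar0 by (simp add: field_simps)
    qed
    ultimately show "(\<Phi> has_vector_derivative arc x * ups a x * ups b x) (at x)"
      by (simp add: has_real_derivative_iff_has_vector_derivative[symmetric])
  qed simp
  moreover have "\<Phi> 2 - \<Phi> (-2) = (if a = b then 2 * pi else 0)"
    by (simp add: \<Phi>_def arc2 arcsin_minus)
  ultimately show ?thesis by simp
qed

lemma ups_orthogonal:
  assumes "a > 0" "b > 0"
  shows "integrable lborel (\<lambda>x. arc x * ups a x * ups b x)"
    and "(\<integral>x. arc x * ups a x * ups b x \<partial>lborel) = (if a = b then 2 * pi else 0)"
proof -
  have ind: "(\<lambda>x. indicator {-2..2} x *\<^sub>R (arc x * ups a x * ups b x)) = (\<lambda>x. arc x * ups a x * ups b x)"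
  proof
    fix x show "indicator {-2..2} x *\<^sub>R (arc x * ups a x * ups b x) = arc x * ups a x * ups b x"
      using arc_eq_0_iff[of x] by (auto simp: indicator_def)
  qed
  have "integrable lborel (\<lambda>x. indicator {-2..2} x *\<^sub>R (arc x * ups a x * ups b x))"
    by (intro borel_integrable_compact continuous_intros continuous_arc continuous_ups) simp
  then have s: "set_integrable lborel {-2..2} (\<lambda>x. arc x * ups a x * ups b x)"
    by (simp add: set_integrable_def)
  then show "integrable lborel (\<lambda>x. arc x * ups a x * ups b x)"
    unfolding set_integrable_def ind .
  have "(\<integral>x. arc x * ups a x * ups b x \<partial>lborel) = (LINT x:{-2..2}|lborel. arc x * ups a x * ups b x)"
    unfolding set_lebesgue_integral_def ind ..
  also have "\<dots> = integral {-2..2} (\<lambda>x. arc x * ups a x * ups b x)"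
    using s by (rule set_borel_integral_eq_integral)
  finally show "(\<integral>x. arc x * ups a x * ups b x \<partial>lborel) = (if a = b then 2 * pi else 0)"
    using integral_unique[OF ups_orthogonal_has_integral[OF assms]] by simp
qed

text \<open>Both Vandermonde factors are expanded as determinants in the orthogonal family
  \<open>ups\<close>. In the double sum over permutations only the g! diagonal terms survive, each
  contributing \<open>(2 * pi) ^ CARD('n)\<close>.\<close>

lemma weyl_int_1:
  "weyl_int (\<lambda>_ :: real ^ 'n::{finite,linorder}. 1) = fact CARD('n) * (2 * pi) ^ CARD('n)"
proof -
  let ?U = "\<lambda>(p :: 'n \<Rightarrow> 'n) k x. ups (Suc (rk (p k))) x"
  let ?F = "\<lambda>p q k x. arc x * ?U p k x * ?U q k x"
  let ?PU = "{p. p permutes (UNIV :: 'n set)}"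
  have w: "weyl_w t = (\<Sum>p\<in>?PU. \<Sum>q\<in>?PU. of_int (sign p) * of_int (sign q) * (\<Prod>k\<in>UNIV. ?F p q k (t $ k)))"
    for t :: "real ^ 'n::_"
  proof -
    have "vdm t = (\<Sum>p\<in>?PU. of_int (sign p) * (\<Prod>k\<in>UNIV. ?U p k (t $ k)))"
      unfolding det_ups[symmetric] det_def by simp
    then have "weyl_w t = (\<Prod>i\<in>UNIV. arc (t $ i)) * ((\<Sum>p\<in>?PU. of_int (sign p) * (\<Prod>k\<in>UNIV. ?U p k (t $ k))) *
       (\<Sum>q\<in>?PU. of_int (sign q) * (\<Prod>k\<in>UNIV. ?U q k (t $ k))))"
      by (simp only: weyl_w_def power2_eq_square)
    also have "\<dots> = (\<Sum>p\<in>?PU. \<Sum>q\<in>?PU. (\<Prod>i\<in>UNIV. arc (t $ i)) *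
       ((of_int (sign p) * (\<Prod>k\<in>UNIV. ?U p k (t $ k))) * (of_int (sign q) * (\<Prod>k\<in>UNIV. ?U q k (t $ k)))))"
      by (subst sum_product) (simp only: sum_distrib_left)
    also have "\<dots> = (\<Sum>p\<in>?PU. \<Sum>q\<in>?PU. of_int (sign p) * of_int (sign q) * (\<Prod>k\<in>UNIV. ?F p q k (t $ k)))"
      by (intro sum.cong refl) (simp only: prod.distrib mult_ac)
    finally show ?thesis .
  qed
  have int1: "(\<integral>t. (\<Prod>k\<in>UNIV. ?F p q k (t $ k)) \<partial>lborel) = (if p = q then (2 * pi) ^ CARD('n) else 0)" for p q
  proof -
    have "(\<integral>t. (\<Prod>k\<in>UNIV. ?F p q k (t $ k)) \<partial>lborel) = (\<Prod>k\<in>UNIV. \<integral>x. ?F p q k x \<partial>lborel)"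
      by (rule integral_lborel_prod) (rule ups_orthogonal, auto)
    also have "\<dots> = (\<Prod>k\<in>UNIV. if p k = q k then 2 * pi else 0)"
      by (simp add: ups_orthogonal)
    also have "\<dots> = (if p = q then (2 * pi) ^ CARD('n) else 0)"
    proof (cases "p = q")
      case False
      then obtain k where "p k \<noteq> q k" by auto
      then show ?thesis using False by (auto intro!: prod_zero)
    qed simp
    finally show ?thesis .
  qed
  have int2: "integrable lborel (\<lambda>t :: real ^ 'n::_. \<Prod>k\<in>UNIV. ?F p q k (t $ k))" for p q
  proof (rule integrable_cube_support)
    show "continuous_on UNIV (\<lambda>t :: real ^ 'n::_. \<Prod>k\<in>UNIV. ?F p q k (t $ k))"
      by (intro continuous_intros continuous_on_compose2[OF continuous_arc[of UNIV]]
          continuous_on_compose2[OF continuous_ups[of UNIV]]) auto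
    show "(\<Prod>k\<in>UNIV. ?F p q k (t $ k)) = 0" if "t \<notin> cube" for t :: "real ^ 'n::_"
      using prod_arc_eq_0[OF that] by (simp add: prod.distrib)
  qed
  have sgn: "real_of_int (sign p) * real_of_int (sign p) = 1" for p :: "'n \<Rightarrow> 'n"
    by (simp add: sign_def)
  have "weyl_int (\<lambda>_ :: real ^ 'n::_. 1) = (\<Sum>p\<in>?PU. \<Sum>q\<in>?PU. of_int (sign p) * of_int (sign q) *
      (\<integral>t. (\<Prod>k\<in>UNIV. ?F p q k (t $ k)) \<partial>(lborel :: (real ^ 'n::_) measure)))"
    unfolding weyl_int_def mult_1_right w using int2
    by (simp add: Bochner_Integration.integral_sum del: mult_1_right)
  also have "\<dots> = (\<Sum>p\<in>?PU. \<Sum>q\<in>?PU. if q = p then (2 * pi) ^ CARD('n) else 0)"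
    unfolding int1 by (intro sum.cong refl) (auto simp: sgn)
  also have "\<dots> = fact CARD('n) * (2 * pi) ^ CARD('n)"
    by (simp add: card_permutations[OF refl])
  finally show ?thesis .
qed

section \<open>Monomials in the power sums and their loop expressions\<close>

definition mon :: "nat list \<Rightarrow> real ^ 'n::finite \<Rightarrow> real" where
  "mon ks t = (\<Prod>k\<leftarrow>ks. psum k t)"

lemma mon_simps [simp]: "mon [] t = 1" "mon (k # ks) t = psum k t * mon ks t"
  by (simp_all add: mon_def)

lemma mon_append: "mon (ks @ ls) t = mon ks t * mon ls t"
  by (induction ks) auto

lemma continuous_mon: "continuous_on S (mon ks)"
proof (induction ks)
  case Nil
  have "mon [] = (\<lambda>_ :: real ^ 'a. 1)" by auto
  then show ?case by simp
next
  case (Cons k ks)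
  have "mon (k # ks) = (\<lambda>t :: real ^ 'a. psum k t * mon ks t)" by auto
  then show ?case using Cons by (auto intro: continuous_intros continuous_psum)
qed

fun dmon :: "'n \<Rightarrow> nat list \<Rightarrow> real ^ 'n::finite \<Rightarrow> real" where
  "dmon i [] t = 0"
| "dmon i (k # ks) t = real k * ups k (t $ i) * mon ks t + dmon i ks t * psum k t"

lemma has_partial_psum: "has_partial (psum k) i (real k * ups k (t $ i)) t"
proof -
  have "has_partial (\<lambda>t. \<Sum>j\<in>UNIV. tau k (t $ j)) i (\<Sum>j\<in>UNIV. if j = i then real k * ups k (t $ j) else 0) t"
    by (intro has_partial_sum has_partial_comp_nth DERIV_tau)
  then show ?thesis unfolding psum_def by simp
qed

lemma has_partial_mon: "has_partial (mon ks) i (dmon i ks t) t"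
proof (induction ks)
  case Nil
  have "mon [] = (\<lambda>_ :: real ^ 'a. 1)" by auto
  then show ?case by (simp add: has_partial_const)
next
  case (Cons k ks)
  have "mon (k # ks) = (\<lambda>t :: real ^ 'a. psum k t * mon ks t)" by auto
  then show ?case using has_partial_mult[OF has_partial_psum Cons] by simp
qed

lemma continuous_dmon: "continuous_on S (dmon i ks)"
proof (induction ks)
  case Nil
  have "dmon i [] = (\<lambda>_. 0)" by auto
  then show ?case by simp
next
  case (Cons k ks)
  have "dmon i (k # ks) = (\<lambda>t. real k * ups k (t $ i) * mon ks t + dmon i ks t * psum k t)" by auto
  then show ?case using Cons
    by (auto intro!: continuous_intros continuous_psum continuous_mon continuous_on_compose2[OF continuous_ups[of UNIV]])
qed

text \<open>On the cube, the inner product of the gradients of \<open>psum k\<close> and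
  \<open>mon ls\<close> for the weight \<open>4 - x\<^sup>2\<close>, divided by \<open>k\<close>;
  this is \<open>sum_aux_a_dmon\<close>.\<close>

fun Gam :: "nat \<Rightarrow> nat list \<Rightarrow> real ^ 'n::finite \<Rightarrow> real" where
  "Gam k [] t = 0"
| "Gam k (l # ls) t = real l * (psum (nd k l) t - psum (k + l) t) * mon ls t + Gam k ls t * psum l t"

lemma continuous_Gam: "continuous_on S (Gam k ks)"
proof (induction ks)
  case Nil
  have "Gam k [] = (\<lambda>_ :: real ^ 'a. 0)" by auto
  then show ?case by simp
next
  case (Cons l ks)
  have "Gam k (l # ks) = (\<lambda>t :: real ^ 'a. real l * (psum (nd k l) t - psum (k + l) t) * mon ks t + Gam k ks t * psum l t)" by auto
  then show ?case using Cons
    by (auto intro!: continuous_intros continuous_psum continuous_mon)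
qed

lemma sum_aux_a_dmon:
  assumes "t \<in> cube"
  shows "(\<Sum>i\<in>UNIV. aux_a k (t $ i) * dmon i ls t) = real k * Gam k ls t"
proof (induction ls)
  case (Cons l ls)
  have A: "(\<Sum>i\<in>UNIV. aux_a k (t $ i) * (real l * ups l (t $ i))) = real k * (real l * (psum (nd k l) t - psum (k + l) t))"
  proof -
    have "aux_a k (t $ i) * (real l * ups l (t $ i)) = real k * real l * (tau (nd k l) (t $ i) - tau (k + l) (t $ i))" for i
      using ups_mult_ups[of "t $ i" k l] assms by (simp add: aux_a_def cube_def mult_ac)
    then show ?thesis by (simp add: psum_def sum_distrib_left sum_subtractf right_diff_distrib mult.assoc)
  qed
  have B: "(\<Sum>i\<in>UNIV. aux_a k (t $ i) * dmon i (l # ls) t) =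
      (\<Sum>i\<in>UNIV. aux_a k (t $ i) * (real l * ups l (t $ i))) * mon ls t + (\<Sum>i\<in>UNIV. aux_a k (t $ i) * dmon i ls t) * psum l t"
  proof -
    have "(\<Sum>i\<in>UNIV. aux_a k (t $ i) * dmon i (l # ls) t) =
        (\<Sum>i\<in>UNIV. aux_a k (t $ i) * (real l * ups l (t $ i)) * mon ls t + aux_a k (t $ i) * dmon i ls t * psum l t)"
      by (intro sum.cong refl) (simp add: algebra_simps)
    then show ?thesis by (simp only: sum.distrib sum_distrib_right)
  qed
  show ?case unfolding B A Cons Gam.simps by (simp add: algebra_simps)
qed simp

text \<open>On the cube and up to the factor \<open>- 1 / k\<close>, the weighted divergence of
  \<open>mon ls\<close> times the gradient of \<open>psum k\<close>.\<close>

definition loopf :: "nat \<Rightarrow> nat list \<Rightarrow> real ^ 'n::finite \<Rightarrow> real" where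
  "loopf k ls t = Lam k t * mon ls t - Gam k ls t"

lemma continuous_loopf: "continuous_on S (loopf k ls)"
  unfolding loopf_def by (intro continuous_intros continuous_Lam continuous_mon continuous_Gam)

text \<open>Testing a loop expression with \<open>f\<close> moves the divergence onto the gradient
  of \<open>f\<close>. For \<open>f = 1\<close> and \<open>k > 0\<close> this says that loop
  expressions have integral zero; for general \<open>f\<close> it leads to the Dirichlet
  form.\<close>

lemma weyl_loop_mult:
  fixes f :: "real ^ 'n::{finite,linorder} \<Rightarrow> real"
  assumes cont: "continuous_on UNIV f" "\<And>i. continuous_on UNIV (f' i)"
    and part: "\<And>i t. has_partial f i (f' i t) t"
  shows "real k * weyl_int (\<lambda>t. f t * loopf k ls t) =
    weyl_int (\<lambda>t. mon ls t * (\<Sum>i\<in>UNIV. aux_a k (t $ i) * f' i t))"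
proof -
  have 0: "weyl_int (\<lambda>t. real k * (Lam k t * (f t * mon ls t)) -
      (\<Sum>i\<in>UNIV. aux_a k (t $ i) * (f' i t * mon ls t + dmon i ls t * f t))) = 0"
    by (intro weyl_loop continuous_intros cont continuous_mon continuous_dmon has_partial_mult part has_partial_mon)
  have ca: "continuous_on UNIV (\<lambda>t. \<Sum>i\<in>UNIV. aux_a k (t $ i) * f' i t)"
    by (intro continuous_intros cont continuous_on_compose2[OF continuous_aux_a[of UNIV]]) auto
  have "weyl_int (\<lambda>t. real k * (f t * loopf k ls t)) =
      weyl_int (\<lambda>t. (real k * (Lam k t * (f t * mon ls t)) -
      (\<Sum>i\<in>UNIV. aux_a k (t $ i) * (f' i t * mon ls t + dmon i ls t * f t))) +
      mon ls t * (\<Sum>i\<in>UNIV. aux_a k (t $ i) * f' i t))"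
  proof (rule weyl_int_cong)
    fix t :: "real ^ 'n::_" assume t: "t \<in> cube"
    have "(\<Sum>i\<in>UNIV. aux_a k (t $ i) * (f' i t * mon ls t + dmon i ls t * f t)) =
       mon ls t * (\<Sum>i\<in>UNIV. aux_a k (t $ i) * f' i t) + (\<Sum>i\<in>UNIV. aux_a k (t $ i) * dmon i ls t) * f t"
      by (simp add: sum_distrib_right sum_distrib_left sum.distrib[symmetric] algebra_simps)
    then show "real k * (f t * loopf k ls t) = (real k * (Lam k t * (f t * mon ls t)) -
      (\<Sum>i\<in>UNIV. aux_a k (t $ i) * (f' i t * mon ls t + dmon i ls t * f t))) +
      mon ls t * (\<Sum>i\<in>UNIV. aux_a k (t $ i) * f' i t)"
      unfolding sum_aux_a_dmon[OF t] loopf_def by (simp add: algebra_simps)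
  qed
  also have "\<dots> = 0 + weyl_int (\<lambda>t. mon ls t * (\<Sum>i\<in>UNIV. aux_a k (t $ i) * f' i t))"
    unfolding 0[symmetric]
    by (intro weyl_int_add continuous_intros cont ca continuous_mon continuous_dmon continuous_Lam
        continuous_on_compose2[OF continuous_aux_a[of UNIV]]) auto
  finally show ?thesis by (simp add: weyl_int_cmult)
qed

section \<open>The symplectic adjoint\<close>

primrec matpow :: "'a::comm_ring_1 ^ 'k::finite ^ 'k \<Rightarrow> nat \<Rightarrow> 'a ^ 'k ^ 'k" where
  "matpow A 0 = mat 1"
| "matpow A (Suc n) = A ** matpow A n"

lemma matpow_add: "matpow A (m + n) = matpow A m ** matpow A n"
  by (induction m) (auto simp: matrix_mul_assoc)

definition msc :: "'a::comm_ring_1 \<Rightarrow> 'a ^ 'k ^ 'l \<Rightarrow> 'a ^ 'k ^ 'l" where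
  "msc c A = (\<chi> a b. c * A $ a $ b)"

lemma msc_nth [simp]: "msc c A $ a $ b = c * A $ a $ b"
  by (simp add: msc_def)

lemma mat_mult_nth: "(A ** B) $ a $ b = (\<Sum>c\<in>UNIV. A $ a $ c * B $ c $ b)"
  by (simp add: matrix_matrix_mult_def)

lemma mat_add_mult: "(A + B) ** C = A ** C + B ** C" for A B :: "'a::comm_ring_1 ^ 'k::finite ^ 'l"
  by (simp add: vec_eq_iff mat_mult_nth distrib_right sum.distrib)

lemma mat_mult_sum: "A ** (\<Sum>i\<in>I. f i) = (\<Sum>i\<in>I. A ** f i)" for A :: "'a::comm_ring_1 ^ 'k::finite ^ 'l"
  by (simp add: vec_eq_iff mat_mult_nth sum_distrib_left) (intro allI, rule sum.swap)

lemma msc_mult_left: "msc c A ** B = msc c (A ** B)"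
  by (simp add: vec_eq_iff mat_mult_nth sum_distrib_left mult.assoc)

lemma msc_mult_right: "A ** msc c B = msc c (A ** B)"
  by (simp add: vec_eq_iff mat_mult_nth sum_distrib_left mult.left_commute)

lemma trace_msc: "trace (msc c A) = c * trace A"
  by (simp add: trace_def sum_distrib_left)

lemma trace_cyclic: "trace (A ** B) = trace (B ** A)" for A B :: "'a::comm_ring_1 ^ 'k::finite ^ 'k"
  by (rule trace_mul_sym)

definition mat_adj :: "complex ^ 'k ^ 'k \<Rightarrow> complex ^ 'k ^ 'k" where
  "mat_adj A = transpose (cnj_matrix A)"

lemma mat_adj_nth [simp]: "mat_adj A $ a $ b = cnj (A $ b $ a)"
  by (simp add: mat_adj_def transpose_def cnj_matrix_def)

lemma mat_adj_mult: "mat_adj (A ** B) = mat_adj B ** mat_adj A"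
  by (simp add: vec_eq_iff mat_mult_nth mult.commute)

text \<open>\<open>J\<close> is a signed permutation matrix; \<open>swap_half\<close> is the
  permutation and \<open>half_sign\<close> the sign, so that products with \<open>J\<close> become
  relabelings of entries.\<close>

definition swap_half :: "'n + 'n \<Rightarrow> 'n + 'n" where
  "swap_half a = (case a of Inl i \<Rightarrow> Inr i | Inr i \<Rightarrow> Inl i)"

definition half_sign :: "'n + 'n \<Rightarrow> complex" where
  "half_sign a = (case a of Inl _ \<Rightarrow> 1 | Inr _ \<Rightarrow> - 1)"

lemma swap_half_swap_half [simp]: "swap_half (swap_half a) = a"
  by (cases a) (auto simp: swap_half_def)

lemma half_sign_swap_half [simp]: "half_sign (swap_half a) = - half_sign a"
  by (cases a) (auto simp: swap_half_def half_sign_def)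

lemma half_sign_sq [simp]: "half_sign a * half_sign a = 1"
  by (cases a) (auto simp: half_sign_def)

lemma symp_J_nth: "symp_J $ a $ b = (if b = swap_half a then half_sign a else 0)"
  for a b :: "'n::finite + 'n"
  by (cases a; cases b) (auto simp: symp_J_def swap_half_def half_sign_def)

lemma symp_J_mult_nth: "(symp_J ** A) $ a $ b = half_sign a * A $ swap_half a $ b"
  for A :: "complex ^ 'k ^ ('n::finite + 'n)"
  by (simp add: mat_mult_nth symp_J_nth if_distrib[where f="\<lambda>x. x * _"] cong: if_cong)

lemma symp_J_sq: "symp_J ** symp_J = - mat 1"
  by (simp add: vec_eq_iff symp_J_mult_nth) (auto simp: symp_J_nth mat_def)

lemma transpose_symp_J: "transpose symp_J = - symp_J"
  by (auto simp: vec_eq_iff transpose_def symp_J_nth)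

text \<open>The adjoint for the bilinear form with matrix \<open>J\<close>, as the inverse of
  \<open>J\<close> is \<open>- J\<close>. Symplectic matrices satisfy
  \<open>sig m ** m = mat 1\<close>, and the complex Lie algebra consists of the \<open>X\<close>
  with \<open>sig X = - X\<close>, so \<open>A - sig A\<close> always lies in it.\<close>

definition sig :: "complex ^ ('n + 'n) ^ ('n + 'n::finite) \<Rightarrow> complex ^ ('n + 'n) ^ ('n + 'n)" where
  "sig A = - (symp_J ** transpose A ** symp_J)"

lemma matrix_neg_left: "(- A) ** B = - (A ** B)" for A :: "'a::comm_ring_1 ^ 'k::finite ^ 'l"
  by (simp add: vec_eq_iff mat_mult_nth sum_negf)

lemma matrix_neg_right: "A ** (- B) = - (A ** B)" for A :: "'a::comm_ring_1 ^ 'k::finite ^ 'l"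
  by (simp add: vec_eq_iff mat_mult_nth sum_negf)

lemma transpose_add: "transpose (A + B) = transpose A + transpose B"
  by (simp add: vec_eq_iff transpose_def)

lemma transpose_neg: "transpose (- A) = - transpose A"
  by (simp add: vec_eq_iff transpose_def)

lemma transpose_msc: "transpose (msc c A) = msc c (transpose A)"
  by (simp add: vec_eq_iff transpose_def)

lemma msc_neg: "msc c (- A) = - msc c A"
  by (simp add: vec_eq_iff)

lemma sig_add: "sig (A + B) = sig A + sig B"
  by (simp add: sig_def transpose_add matrix_add_ldistrib mat_add_mult)

lemma sig_msc: "sig (msc c A) = msc c (sig A)"
  by (simp add: sig_def transpose_msc msc_mult_left msc_mult_right msc_neg)

lemma sig_mult: "sig (A ** B) = sig B ** sig A"
proof -
  have "sig B ** sig A = (symp_J ** transpose B) ** (symp_J ** symp_J) ** (transpose A ** symp_J)"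
    by (simp add: sig_def matrix_neg_left matrix_neg_right matrix_mul_assoc)
  also have "\<dots> = - (symp_J ** transpose B ** transpose A ** symp_J)"
    by (simp add: symp_J_sq matrix_neg_left matrix_neg_right matrix_mul_assoc)
  finally show ?thesis by (simp add: sig_def matrix_transpose_mul matrix_mul_assoc)
qed

lemma sig_sig: "sig (sig A) = A"
proof -
  have "sig (sig A) = (symp_J ** symp_J) ** A ** (symp_J ** symp_J)"
    by (simp add: sig_def transpose_neg matrix_transpose_mul transpose_symp_J matrix_neg_left
        matrix_neg_right matrix_mul_assoc)
  then show ?thesis by (simp add: symp_J_sq matrix_neg_left matrix_neg_right)
qed

lemma sig_one: "sig (mat 1) = mat 1"
  by (simp add: sig_def symp_J_sq)

lemma trace_neg: "trace (- A) = - trace A" for A :: "'a::comm_ring_1 ^ 'k::finite ^ 'k"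
  by (simp add: trace_def sum_negf)

lemma trace_transpose: "trace (transpose A) = trace A"
  by (simp add: trace_def transpose_def)

lemma trace_sig: "trace (sig A) = trace A"
proof -
  have "trace (sig A) = - trace (symp_J ** (transpose A ** symp_J))"
    by (simp add: sig_def trace_neg matrix_mul_assoc)
  also have "\<dots> = - trace (transpose A ** (symp_J ** symp_J))"
    by (subst trace_cyclic) (simp add: matrix_mul_assoc)
  finally show ?thesis by (simp add: symp_J_sq matrix_neg_right trace_neg trace_transpose)
qed

lemma sig_eq_iff: "sig m ** m = mat 1 \<longleftrightarrow> transpose m ** symp_J ** m = symp_J"
proof
  assume "sig m ** m = mat 1"
  then have "symp_J ** (sig m ** m) = symp_J" by simp
  moreover have "symp_J ** (sig m ** m) = - (symp_J ** symp_J) ** transpose m ** symp_J ** m"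
    by (simp add: sig_def matrix_neg_left matrix_neg_right matrix_mul_assoc)
  ultimately show "transpose m ** symp_J ** m = symp_J"
    by (simp add: symp_J_sq)
next
  assume *: "transpose m ** symp_J ** m = symp_J"
  have "sig m ** m = - (symp_J ** (transpose m ** symp_J ** m))"
    by (simp add: sig_def matrix_neg_left matrix_mul_assoc)
  then show "sig m ** m = mat 1" by (simp add: * symp_J_sq)
qed

lemma mat_adj_eq_iff: "mat_adj m ** m = mat 1 \<longleftrightarrow> transpose m ** cnj_matrix m = mat 1"
proof -
  have "(mat_adj m ** m) $ a $ b = cnj ((transpose m ** cnj_matrix m) $ a $ b)" for a b
    by (simp add: mat_mult_nth transpose_def cnj_matrix_def)
  moreover have "cnj ((mat 1 :: complex ^ 'a ^ 'a) $ a $ b) = mat 1 $ a $ b" for a b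
    by (simp add: mat_def)
  ultimately show ?thesis by (simp add: vec_eq_iff) (metis complex_cnj_cancel_iff)
qed

lemma USp_iff: "m \<in> USp \<longleftrightarrow> sig m ** m = mat 1 \<and> mat_adj m ** m = mat 1"
proof -
  have "invertible m" if "sig m ** m = mat 1"
    using that by (meson invertible_def matrix_left_right_inverse)
  then show ?thesis by (auto simp: USp_def sig_eq_iff mat_adj_eq_iff)
qed

lemma USp_right: "m \<in> USp \<Longrightarrow> m ** sig m = mat 1" "m \<in> USp \<Longrightarrow> m ** mat_adj m = mat 1"
  by (auto simp: USp_iff matrix_left_right_inverse)

lemma USp_sig_eq_adj: "m \<in> USp \<Longrightarrow> sig m = mat_adj m"
proof -
  assume m: "m \<in> USp"
  have "sig m = sig m ** (m ** mat_adj m)" using USp_right(2)[OF m] by simp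
  also have "\<dots> = (sig m ** m) ** mat_adj m" by (simp only: matrix_mul_assoc)
  finally show ?thesis using m by (simp add: USp_iff)
qed

lemma USp_mult: "a \<in> USp \<Longrightarrow> b \<in> USp \<Longrightarrow> a ** b \<in> USp"
proof -
  have *: "(X ** Y) ** (a ** b) = mat 1" if "Y ** a = mat 1" "X ** b = mat 1" for X Y
  proof -
    have "(X ** Y) ** (a ** b) = X ** (Y ** a) ** b" by (simp add: matrix_mul_assoc)
    then show ?thesis using that by simp
  qed
  assume "a \<in> USp" "b \<in> USp"
  then show ?thesis unfolding USp_iff sig_mult mat_adj_mult by (auto intro!: *)
qed

section \<open>Continuity, compactness and derivatives of matrix functions\<close>

lemma continuous_on_mat_mult [continuous_intros]:
  fixes f g :: "'a::topological_space \<Rightarrow> complex ^ 'k::finite ^ 'k"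
  assumes "continuous_on S f" "continuous_on S g"
  shows "continuous_on S (\<lambda>x. f x ** g x)"
  unfolding matrix_matrix_mult_def by (intro continuous_intros assms)

lemma continuous_on_matpow [continuous_intros]:
  fixes f :: "'a::topological_space \<Rightarrow> complex ^ 'k::finite ^ 'k"
  assumes "continuous_on S f"
  shows "continuous_on S (\<lambda>x. matpow (f x) n)"
  by (induction n) (auto intro: continuous_on_mat_mult assms)

lemma continuous_on_trace [continuous_intros]:
  fixes f :: "'a::topological_space \<Rightarrow> complex ^ 'k::finite ^ 'k"
  assumes "continuous_on S f"
  shows "continuous_on S (\<lambda>x. trace (f x))"
  unfolding trace_def by (intro continuous_intros assms)

lemma compact_USp: "compact (USp :: (complex ^ ('n + 'n) ^ ('n + 'n::finite)) set)"
proof (rule compact_eq_bounded_closed[THEN iffD2], intro conjI)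
  have "norm (m $ c $ a) \<le> 1" if "m \<in> USp" for m :: "complex ^ ('n + 'n) ^ ('n + 'n)" and a c
  proof -
    \<comment> \<open>Columns of a unitary matrix are unit vectors, so all entries have modulus at
      most one.\<close>
    have "(mat_adj m ** m) $ a $ a = 1" using that by (simp add: USp_iff mat_def)
    then have "(\<Sum>d\<in>UNIV. complex_of_real ((norm (m $ d $ a))\<^sup>2)) = 1"
      by (simp only: mat_mult_nth mat_adj_nth complex_norm_square mult.commute)
    then have "complex_of_real (\<Sum>d\<in>UNIV. (norm (m $ d $ a))\<^sup>2) = 1" by (simp only: of_real_sum)
    then have "(\<Sum>d\<in>UNIV. (norm (m $ d $ a))\<^sup>2) = 1" by (simp only: of_real_eq_1_iff)
    then have "(norm (m $ c $ a))\<^sup>2 \<le> 1"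
      using member_le_sum[of c UNIV "\<lambda>d. (norm (m $ d $ a))\<^sup>2"] by simp
    then show ?thesis by (simp add: power_le_one_iff abs_square_le_1)
  qed
  then have "norm m \<le> (\<Sum>c\<in>(UNIV :: ('n + 'n) set). \<Sum>a\<in>(UNIV :: ('n + 'n) set). 1)"
    if "m \<in> USp" for m :: "complex ^ ('n + 'n) ^ ('n + 'n)"
  proof -
    have "norm m \<le> (\<Sum>c\<in>UNIV. norm (m $ c))"
      unfolding norm_vec_def by (rule L2_set_le_sum) auto
    also have "\<dots> \<le> (\<Sum>c\<in>UNIV. \<Sum>a\<in>UNIV. norm (m $ c $ a))"
      unfolding norm_vec_def[of "m $ _"] by (intro sum_mono L2_set_le_sum) auto
    also have "\<dots> \<le> (\<Sum>c\<in>(UNIV :: ('n + 'n) set). \<Sum>a\<in>(UNIV :: ('n + 'n) set). 1)"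
      using \<open>\<And>m c a. m \<in> USp \<Longrightarrow> norm (m $ c $ a) \<le> 1\<close> that by (intro sum_mono) auto
    finally show ?thesis .
  qed
  then show "bounded (USp :: (complex ^ ('n + 'n) ^ ('n + 'n)) set)"
    unfolding bounded_iff by blast
  have "continuous_on UNIV (\<lambda>m :: complex ^ ('n + 'n) ^ ('n + 'n). sig m ** m)"
    unfolding sig_def transpose_def by (intro continuous_intros)
  moreover have "continuous_on UNIV (\<lambda>m :: complex ^ ('n + 'n) ^ ('n + 'n). mat_adj m ** m)"
    unfolding mat_adj_def transpose_def cnj_matrix_def by (intro continuous_intros)
  ultimately have "closed {m :: complex ^ ('n + 'n) ^ ('n + 'n). sig m ** m = mat 1 \<and> mat_adj m ** m = mat 1}"
    by (intro closed_Collect_conj closed_Collect_eq continuous_on_const)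
  also have "{m :: complex ^ ('n + 'n) ^ ('n + 'n). sig m ** m = mat 1 \<and> mat_adj m ** m = mat 1} = USp"
    by (auto simp: USp_iff)
  finally show "closed (USp :: (complex ^ ('n + 'n) ^ ('n + 'n)) set)" .
qed

text \<open>Entrywise derivatives, as \<open>**\<close> is not registered as a bounded bilinear operation.\<close>

definition mat_deriv :: "(real \<Rightarrow> complex ^ 'k ^ 'l) \<Rightarrow> complex ^ 'k ^ 'l \<Rightarrow> real \<Rightarrow> bool" where
  "mat_deriv A A' h \<longleftrightarrow> (\<forall>a b. ((\<lambda>h. A h $ a $ b) has_vector_derivative A' $ a $ b) (at h))"

lemma mat_deriv_const: "mat_deriv (\<lambda>_. A) 0 h"
  by (simp add: mat_deriv_def)

lemma mat_deriv_mult: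
  assumes "mat_deriv A A' h" "mat_deriv B B' h"
  shows "mat_deriv (\<lambda>h. A h ** B h) (A' ** B h + A h ** B') h"
proof -
  have "((\<lambda>h. \<Sum>c\<in>UNIV. A h $ a $ c * B h $ c $ b) has_vector_derivative
      (\<Sum>c\<in>UNIV. A h $ a $ c * B' $ c $ b + A' $ a $ c * B h $ c $ b)) (at h)" for a b
    using assms by (intro has_vector_derivative_sum has_vector_derivative_mult) (auto simp: mat_deriv_def)
  then show ?thesis by (simp add: mat_deriv_def mat_mult_nth sum.distrib add.commute)
qed

primrec dmatpow :: "complex ^ 'k::finite ^ 'k \<Rightarrow> complex ^ 'k ^ 'k \<Rightarrow> nat \<Rightarrow> complex ^ 'k ^ 'k" where
  "dmatpow A B 0 = 0"
| "dmatpow A B (Suc n) = B ** matpow A n + A ** dmatpow A B n"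

lemma mat_deriv_matpow:
  "mat_deriv A A' h \<Longrightarrow> mat_deriv (\<lambda>h. matpow (A h) n) (dmatpow (A h) A' n) h"
  by (induction n) (auto intro: mat_deriv_const mat_deriv_mult)

lemma mat_deriv_trace:
  "mat_deriv A A' h \<Longrightarrow> ((\<lambda>h. trace (A h)) has_vector_derivative trace A') (at h)"
  unfolding trace_def mat_deriv_def by (intro has_vector_derivative_sum) auto

text \<open>The direction \<open>X ** A\<close> is that of left multiplication by the flow of
  \<open>X\<close>. The exponents \<open>j < n\<close> on the left and \<open>n - j\<close> on the
  right are the source of the range of summation in \<open>cLam\<close>.\<close>

lemma dmatpow_eq: "dmatpow A (X ** A) n = (\<Sum>j<n. matpow A j ** X ** matpow A (n - j))"
proof (induction n)
  case (Suc n)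
  have "dmatpow A (X ** A) (Suc n) = X ** matpow A (Suc n) + (\<Sum>j<n. A ** (matpow A j ** X ** matpow A (n - j)))"
    by (simp add: Suc matrix_mul_assoc mat_mult_sum)
  also have "\<dots> = (\<Sum>j<Suc n. matpow A j ** X ** matpow A (Suc n - j))"
    by (subst sum.lessThan_Suc_shift) (simp add: matrix_mul_assoc)
  finally show ?case .
qed simp

section \<open>Loop equations for the Haar measure\<close>

lemma haar_integrable:
  fixes f :: "complex ^ ('n + 'n) ^ ('n + 'n::finite) \<Rightarrow> 'b::{banach,second_countable_topology}"
  assumes haar: "normalized_haar_measure USp M" and cont: "continuous_on USp f"
  shows "integrable M f"
proof -
  interpret prob_space M using haar by (simp add: normalized_haar_measure_def)
  have sets: "sets M = sets (restrict_space borel USp)"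
    using haar by (simp add: normalized_haar_measure_def)
  then have space: "space M = USp" by (auto dest: sets_eq_imp_space_eq simp: space_restrict_space)
  have "f \<in> borel_measurable (restrict_space borel USp)"
    using cont by (rule borel_measurable_continuous_on_restrict)
  then have meas: "f \<in> borel_measurable M"
    using measurable_cong_sets[OF sets refl] by blast
  have "bounded (f ` USp)"
    by (intro compact_imp_bounded compact_continuous_image compact_USp cont)
  then obtain B where "\<forall>y\<in>f ` USp. norm y \<le> B" by (auto simp: bounded_iff)
  then show ?thesis
    by (intro integrable_const_bound[of _ B] AE_I2 meas) (auto simp: space)
qed

lemma haar_space: "normalized_haar_measure G M \<Longrightarrow> space M = G"
  by (auto simp: normalized_haar_measure_def space_restrict_space dest: sets_eq_imp_space_eq)

lemma haar_invariant:
  fixes f :: "complex ^ ('n + 'n) ^ ('n + 'n::finite) \<Rightarrow> 'b::{banach,second_countable_topology}"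
  assumes haar: "normalized_haar_measure USp M" and cont: "continuous_on USp f" and a: "a \<in> USp"
  shows "(\<integral>m. f (a ** m) \<partial>M) = (\<integral>m. f m \<partial>M)"
proof -
  have sets: "sets M = sets (restrict_space borel USp)"
    using haar by (simp add: normalized_haar_measure_def)
  have "(\<lambda>m. a ** m) \<in> restrict_space borel USp \<rightarrow>\<^sub>M restrict_space borel USp"
    using USp_mult[OF a]
    by (intro measurable_restrict_space2 borel_measurable_continuous_on_restrict continuous_intros)
      (auto simp: space_restrict_space)
  then have m: "(\<lambda>m. a ** m) \<in> M \<rightarrow>\<^sub>M M"
    using measurable_cong_sets[OF sets sets] by blast
  have "(\<integral>m. f m \<partial>M) = (\<integral>m. f m \<partial>distr M M (\<lambda>m. a ** m))"
    using haar a by (simp add: normalized_haar_measure_def)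
  also have "\<dots> = (\<integral>m. f (a ** m) \<partial>M)"
    using haar_integrable[OF haar cont] by (intro integral_distr m) auto
  finally show ?thesis by simp
qed

section \<open>One-parameter subgroups attached to unit vectors\<close>

lemma mat_diff_mult: "(A - B) ** C = A ** C - B ** C" for A B :: "'a::comm_ring_1 ^ 'k::finite ^ 'l"
  by (simp add: vec_eq_iff mat_mult_nth left_diff_distrib sum_subtractf)

definition outer :: "complex ^ 'k \<Rightarrow> complex ^ 'k ^ 'k" where
  "outer v = (\<chi> a b. v $ a * cnj (v $ b))"

lemma outer_nth [simp]: "outer v $ a $ b = v $ a * cnj (v $ b)"
  by (simp add: outer_def)

lemma sig_nth: "sig A $ a $ b = half_sign a * half_sign b * A $ swap_half b $ swap_half a"
proof -
  have "sig A $ a $ b = - (symp_J ** (transpose A ** symp_J)) $ a $ b"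
    by (simp add: sig_def matrix_mul_assoc)
  also have "\<dots> = - (half_sign a * (transpose A ** symp_J) $ swap_half a $ b)"
    by (simp add: symp_J_mult_nth)
  also have "(transpose A ** symp_J) $ swap_half a $ b = (\<Sum>c\<in>UNIV. if c = swap_half b then A $ c $ swap_half a * half_sign c else 0)"
    unfolding mat_mult_nth transpose_def symp_J_nth
    by (intro sum.cong) (auto simp: swap_half_def split: sum.splits)
  finally show ?thesis by (simp add: mult_ac)
qed

lemma mat_adj_outer: "mat_adj (outer v) = outer v"
  by (simp add: vec_eq_iff mult.commute)

lemma cnj_half_sign [simp]: "cnj (half_sign a) = half_sign a"
  by (cases a) (auto simp: half_sign_def)

lemma mat_adj_sig: "mat_adj (sig A) = sig (mat_adj A)"
  by (simp add: vec_eq_iff sig_nth mult_ac)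

lemma outer_mult_outer:
  assumes "(\<Sum>a\<in>UNIV. v $ a * cnj (v $ a)) = 1"
  shows "outer v ** outer v = outer (v :: complex ^ 'k::finite)"
proof -
  have "(outer v ** outer v) $ a $ b = v $ a * cnj (v $ b) * (\<Sum>c\<in>UNIV. v $ c * cnj (v $ c))" for a b
    by (simp add: mat_mult_nth sum_distrib_left mult_ac)
  then show ?thesis using assms by (simp add: vec_eq_iff)
qed

lemma bij_swap_half: "bij swap_half"
  by (rule involuntory_imp_bij) simp

text \<open>For a unit vector \<open>v\<close> the two factors are the projections onto
  \<open>v\<close> and onto \<open>quat v\<close>, introduced below. These vectors are orthogonal
  because \<open>J\<close> is alternating: the sum \<open>?S\<close> changes sign under
  \<open>swap_half\<close>.\<close>

lemma outer_mult_sig_outer: "outer v ** sig (outer v) = 0"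
proof -
  have 0: "(\<Sum>c\<in>UNIV. half_sign c * cnj (v $ c) * cnj (v $ swap_half c)) = 0" (is "?S = 0")
  proof -
    have "?S = (\<Sum>c\<in>UNIV. half_sign (swap_half c) * cnj (v $ swap_half c) * cnj (v $ swap_half (swap_half c)))"
      by (rule sum.reindex_bij_betw[OF bij_swap_half, symmetric])
    also have "\<dots> = - ?S" by (simp add: sum_negf mult_ac)
    finally show ?thesis by simp
  qed
  have "(outer v ** sig (outer v)) $ a $ b =
      v $ a * half_sign b * v $ swap_half b * (\<Sum>c\<in>UNIV. half_sign c * cnj (v $ c) * cnj (v $ swap_half c))" for a b
    by (simp add: mat_mult_nth sig_nth sum_distrib_left mult_ac)
  then show ?thesis by (simp add: 0 vec_eq_iff)
qed

lemma sig_outer_mult_outer: "sig (outer v) ** outer v = 0"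
proof -
  have "mat_adj (outer v ** sig (outer v)) = 0"
    by (simp add: outer_mult_sig_outer vec_eq_iff)
  then show ?thesis by (simp add: mat_adj_mult mat_adj_sig mat_adj_outer)
qed

text \<open>For a unit vector \<open>v\<close>, the exponential of
  \<open>\<i> h (outer v - sig (outer v))\<close> in closed form, as both terms are projections and
  their products vanish.\<close>

definition rot :: "complex ^ ('n + 'n) \<Rightarrow> real \<Rightarrow> complex ^ ('n + 'n) ^ ('n + 'n::finite)" where
  "rot v h = mat 1 + msc (cis h - 1) (outer v) + msc (cis (- h) - 1) (sig (outer v))"

lemma rot_0: "rot v 0 = mat 1"
  by (simp add: rot_def vec_eq_iff)

lemma msc_add: "msc c (A + B) = msc c A + msc c B"
  by (simp add: vec_eq_iff distrib_left)

lemma msc_msc: "msc c (msc d A) = msc (c * d) A"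
  by (simp add: vec_eq_iff mult.assoc)

lemma msc_0 [simp]: "msc 0 A = 0" "msc c 0 = 0" "msc 1 A = A"
  by (simp_all add: vec_eq_iff)

lemma mat_adj_msc: "mat_adj (msc c A) = msc (cnj c) (mat_adj A)"
  by (simp add: vec_eq_iff)

lemma mat_adj_add: "mat_adj (A + B) = mat_adj A + mat_adj B"
  by (simp add: vec_eq_iff)

lemma mat_adj_one: "mat_adj (mat 1) = mat 1"
  by (auto simp: vec_eq_iff mat_def)

context
  fixes v :: "complex ^ ('n + 'n::finite)"
  assumes v: "(\<Sum>a\<in>UNIV. v $ a * cnj (v $ a)) = 1"
begin

lemma rot_in_USp: "rot v h \<in> USp"
proof -
  let ?P = "outer v" and ?Q = "sig (outer v)"
  let ?\<alpha> = "cis h - 1" and ?\<beta> = "cis (- h) - 1"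
  have Q: "?Q ** ?Q = ?Q" by (metis outer_mult_outer[OF v] sig_mult)
  \<comment> \<open>With \<open>1 + ?\<alpha> = cis h\<close> and
    \<open>1 + ?\<beta> = cis (- h)\<close> this says that the product of the two is 1.\<close>
  have ab: "?\<alpha> + ?\<beta> + ?\<alpha> * ?\<beta> = 0" "?\<beta> + ?\<alpha> + ?\<beta> * ?\<alpha> = 0"
    using cis_mult[of h "- h"] by (simp_all add: algebra_simps)
  let ?R = "mat 1 + msc ?\<beta> ?P + msc ?\<alpha> ?Q"
  have "?R ** rot v h = mat 1 + msc (?\<alpha> + ?\<beta> + ?\<beta> * ?\<alpha>) ?P + msc (?\<beta> + ?\<alpha> + ?\<alpha> * ?\<beta>) ?Q"
    unfolding rot_def
    by (simp add: matrix_add_ldistrib mat_add_mult msc_mult_left msc_mult_right msc_msc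
        outer_mult_outer[OF v] Q outer_mult_sig_outer sig_outer_mult_outer msc_add)
      (simp add: vec_eq_iff algebra_simps)
  also have "\<dots> = mat 1" using ab by (simp add: algebra_simps)
  finally have R: "?R ** rot v h = mat 1" .
  have "sig (rot v h) = ?R"
    by (simp add: rot_def sig_add sig_msc sig_one sig_sig add_ac)
  moreover have "mat_adj (rot v h) = ?R"
    by (simp add: rot_def mat_adj_add mat_adj_msc mat_adj_one mat_adj_outer mat_adj_sig cis_cnj)
  ultimately show ?thesis using R by (simp add: USp_iff)
qed

lemma mat_deriv_rot:
  "mat_deriv (\<lambda>h. rot v h ** m) (msc \<i> (outer v - sig (outer v)) ** (rot v h ** m)) h"
proof -
  let ?P = "outer v" and ?Q = "sig (outer v)"
  have Q: "?Q ** ?Q = ?Q" by (metis outer_mult_outer[OF v] sig_mult)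
  have d: "mat_deriv (rot v) (msc (\<i> * cis h) ?P + msc (- \<i> * cis (- h)) ?Q) h"
  proof -
    have c: "(cis has_vector_derivative \<i> * cis h) (at h)" for h
    proof -
      have "((\<lambda>z. exp (\<i> * z)) has_field_derivative \<i> * exp (\<i> * complex_of_real h)) (at (complex_of_real h))"
        by (auto intro!: derivative_eq_intros)
      from has_vector_derivative_real_field[OF this] show ?thesis by (simp add: cis_conv_exp[abs_def])
    qed
    have c': "((\<lambda>h. cis (- h)) has_vector_derivative - \<i> * cis (- h)) (at h)"
    proof -
      have "(uminus has_vector_derivative - 1) (at h)"
        using DERIV_minus[OF DERIV_ident, of h] by (simp add: has_real_derivative_iff_has_vector_derivative)
      from vector_diff_chain_at[OF this c[of "- h"]] show ?thesis by (simp add: o_def)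
    qed
    show ?thesis unfolding mat_deriv_def rot_def
      by (auto intro!: derivative_eq_intros c c' simp: algebra_simps)
  qed
  have "(msc (\<i> * cis h) ?P + msc (- \<i> * cis (- h)) ?Q) = msc \<i> (?P - ?Q) ** rot v h"
  proof -
    have "(?P - ?Q) ** ?P = ?P" "(?P - ?Q) ** ?Q = - ?Q"
      by (simp_all add: mat_diff_mult outer_mult_outer[OF v] Q outer_mult_sig_outer sig_outer_mult_outer)
    then have E: "(?P - ?Q) ** rot v h = (?P - ?Q) + msc (cis h - 1) ?P + msc (cis (- h) - 1) (- ?Q)"
      by (simp add: rot_def matrix_add_ldistrib msc_mult_right)
    show ?thesis unfolding msc_mult_left E by (simp add: vec_eq_iff algebra_simps)
  qed
  with mat_deriv_mult[OF d mat_deriv_const[of m]] show ?thesis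
    by (simp add: matrix_mul_assoc)
qed

end

section \<open>Trace monomials and their derivatives\<close>

definition trp :: "nat \<Rightarrow> complex ^ 'k::finite ^ 'k \<Rightarrow> complex" where
  "trp k m = trace (matpow m k)"

primrec cmon :: "nat list \<Rightarrow> complex ^ 'k::finite ^ 'k \<Rightarrow> complex" where
  "cmon [] m = 1"
| "cmon (l # ls) m = trp l m * cmon ls m"

primrec dcmon :: "complex ^ 'k::finite ^ 'k \<Rightarrow> nat list \<Rightarrow> complex ^ 'k ^ 'k \<Rightarrow> complex" where
  "dcmon X [] m = 0"
| "dcmon X (l # ls) m = of_nat l * trace (X ** matpow m l) * cmon ls m + trp l m * dcmon X ls m"

lemma trace_add: "trace (A + B) = trace A + trace B" for A :: "'a::comm_ring_1 ^ 'k::finite ^ 'k"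
  by (simp add: trace_def sum.distrib)

lemma trace_sum: "trace (\<Sum>i\<in>I. f i) = (\<Sum>i\<in>I. trace (f i))" for f :: "'i \<Rightarrow> 'a::comm_ring_1 ^ 'k::finite ^ 'k"
  unfolding trace_def sum_component by (rule sum.swap)

lemma trace_dmatpow: "trace (dmatpow m (X ** m) l) = of_nat l * trace (X ** matpow m l)"
proof -
  have "trace (matpow m j ** X ** matpow m (l - j)) = trace (X ** matpow m l)" if "j < l" for j
  proof -
    have "trace (matpow m j ** X ** matpow m (l - j)) = trace (matpow m (l - j) ** (matpow m j ** X))"
      by (rule trace_cyclic)
    also have "\<dots> = trace ((matpow m (l - j) ** matpow m j) ** X)" by (simp only: matrix_mul_assoc)
    also have "\<dots> = trace (X ** (matpow m (l - j) ** matpow m j))" by (rule trace_cyclic)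
    finally have "trace (matpow m j ** X ** matpow m (l - j)) = trace (X ** (matpow m (l - j) ** matpow m j))" .
    then show ?thesis using that by (simp add: matpow_add[symmetric])
  qed
  then show ?thesis by (simp add: dmatpow_eq trace_sum)
qed

lemma continuous_cmon: "continuous_on S (cmon ls)"
proof (induction ls)
  case Nil
  have "cmon [] = (\<lambda>_ :: complex ^ 'a ^ 'a. 1)" by auto
  then show ?case by simp
next
  case (Cons l ls)
  have "cmon (l # ls) = (\<lambda>m :: complex ^ 'a ^ 'a. trp l m * cmon ls m)" by auto
  then show ?case using Cons unfolding trp_def by (auto intro!: continuous_intros)
qed

lemma continuous_dcmon: "continuous_on S (dcmon X ls)"
proof (induction ls)
  case Nil
  have "dcmon X [] = (\<lambda>_. 0)" by auto
  then show ?case by simp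
next
  case (Cons l ls)
  have "dcmon X (l # ls) = (\<lambda>m. of_nat l * trace (X ** matpow m l) * cmon ls m + trp l m * dcmon X ls m)" by auto
  then show ?case using Cons unfolding trp_def by (auto intro!: continuous_intros continuous_cmon)
qed

text \<open>The derivative of \<open>trace (Y ** matpow m k) * cmon ls m\<close> in the direction
  \<open>X ** m\<close>. The matrix \<open>Y\<close> will select an entry of m^k, so that entries
  can be summed against directions in \<open>sum_haar_d_elmat\<close>.\<close>

definition haar_d :: "complex ^ 'k::finite ^ 'k \<Rightarrow> nat \<Rightarrow> nat list \<Rightarrow> complex ^ 'k ^ 'k \<Rightarrow> complex ^ 'k ^ 'k \<Rightarrow> complex" where
  "haar_d Y k ls X m = trace (Y ** dmatpow m (X ** m) k) * cmon ls m + trace (Y ** matpow m k) * dcmon X ls m"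

lemma continuous_dmatpow: "continuous_on S (\<lambda>m. dmatpow m (X ** m) k)"
  unfolding dmatpow_eq by (intro continuous_intros)

lemma continuous_haar_d: "continuous_on S (haar_d Y k ls X)"
  unfolding haar_d_def by (intro continuous_intros continuous_cmon continuous_dcmon continuous_dmatpow)

lemma deriv_cmon:
  assumes "mat_deriv A (X ** A h) h"
  shows "((\<lambda>h. cmon ls (A h)) has_vector_derivative dcmon X ls (A h)) (at h)"
proof (induction ls)
  case (Cons l ls)
  have "((\<lambda>h. trp l (A h)) has_vector_derivative of_nat l * trace (X ** matpow (A h) l)) (at h)"
    using mat_deriv_trace[OF mat_deriv_matpow[OF assms, of l]] by (simp add: trp_def trace_dmatpow)
  from has_vector_derivative_mult[OF this Cons] show ?case by (simp add: add.commute)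
qed simp

lemma haar_d_outer:
  fixes v :: "complex ^ ('n + 'n::finite)"
  assumes haar: "normalized_haar_measure USp M" and v: "(\<Sum>a\<in>UNIV. v $ a * cnj (v $ a)) = 1"
  shows "(\<integral>m. haar_d Y k ls (msc \<i> (outer v - sig (outer v))) m \<partial>M) = 0"
proof -
  interpret prob_space M using haar by (simp add: normalized_haar_measure_def)
  let ?X = "msc \<i> (outer v - sig (outer v))"
  define f where "f m = trace (Y ** matpow m k) * cmon ls m" for m
  have cf: "continuous_on S f" for S
    unfolding f_def by (intro continuous_intros continuous_cmon)
  have "bounded (haar_d Y k ls ?X ` USp)"
    by (intro compact_imp_bounded compact_continuous_image compact_USp continuous_haar_d)
  then obtain B where B: "\<forall>y\<in>haar_d Y k ls ?X ` USp. norm y \<le> B" by (auto simp: bounded_iff)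
  show ?thesis
  proof (rule integral_eq_0_flow[where f = f and \<phi> = "\<lambda>h m. rot v h ** m" and g = "\<lambda>_. B"])
    show "integrable M f" by (rule haar_integrable[OF haar cf])
    show "haar_d Y k ls ?X \<in> borel_measurable M"
      using haar_integrable[OF haar continuous_haar_d] by auto
    show "integrable M (\<lambda>m. f (rot v h ** m))" for h
      by (intro haar_integrable[OF haar] continuous_on_compose2[OF cf[of UNIV]] continuous_intros) auto
    show "(\<integral>m. f (rot v h ** m) \<partial>M) = (\<integral>m. f m \<partial>M)" for h
      by (rule haar_invariant[OF haar cf rot_in_USp[OF v]])
    show "((\<lambda>h. f (rot v h ** m)) has_vector_derivative haar_d Y k ls ?X (rot v h ** m)) (at h)" for h m
    proof -
      note d = mat_deriv_rot[OF v, of m h]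
      have "mat_deriv (\<lambda>h. Y ** matpow (rot v h ** m) k) (0 ** matpow (rot v h ** m) k + Y ** dmatpow (rot v h ** m) (?X ** (rot v h ** m)) k) h"
        by (rule mat_deriv_mult[OF mat_deriv_const mat_deriv_matpow[OF d]])
      from has_vector_derivative_mult[OF mat_deriv_trace[OF this] deriv_cmon[OF d, of ls]]
      show ?thesis by (simp add: f_def haar_d_def add.commute)
    qed
    show "norm (haar_d Y k ls ?X (rot v h ** m)) \<le> B" if "m \<in> space M" for h m
      using B USp_mult[OF rot_in_USp[OF v]] that haar_space[OF haar] by auto
  qed (simp_all add: rot_0)
qed

lemma dcmon_add: "dcmon (X + X') ls m = dcmon X ls m + dcmon X' ls m"
  by (induction ls) (auto simp: mat_add_mult trace_add algebra_simps)

lemma dcmon_msc: "dcmon (msc c X) ls m = c * dcmon X ls m"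
  by (induction ls) (auto simp: msc_mult_left trace_msc algebra_simps)

lemma dmatpow_add: "dmatpow A (B + B') n = dmatpow A B n + dmatpow A B' n"
  by (induction n) (auto simp: mat_add_mult matrix_add_ldistrib algebra_simps)

lemma dmatpow_msc: "dmatpow A (msc c B) n = msc c (dmatpow A B n)"
  by (induction n) (auto simp: msc_mult_left msc_mult_right msc_add)

lemma haar_d_add: "haar_d Y k ls (X + X') m = haar_d Y k ls X m + haar_d Y k ls X' m"
  by (simp add: haar_d_def dcmon_add mat_add_mult dmatpow_add matrix_add_ldistrib trace_add algebra_simps)

lemma haar_d_msc: "haar_d Y k ls (msc c X) m = c * haar_d Y k ls X m"
  by (simp add: haar_d_def dcmon_msc msc_mult_left dmatpow_msc msc_mult_right trace_msc algebra_simps)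

definition elmat :: "'k \<Rightarrow> 'k \<Rightarrow> complex ^ 'k ^ 'k" where
  "elmat a b = (\<chi> c d. if c = a \<and> d = b then 1 else 0)"

text \<open>Left invariance is applied only along the skew-Hermitian directions
  \<open>\<i> (outer v - sig (outer v))\<close>. Since \<open>haar_d\<close> is complex linear in
  the direction, the identity extends to the complex span of all \<open>outer v\<close>, which is
  the full matrix space.\<close>

lemma haar_d_elmat:
  fixes a b :: "'n + 'n::finite"
  assumes haar: "normalized_haar_measure USp M"
  shows "(\<integral>m. haar_d Y k ls (elmat a b - sig (elmat a b)) m \<partial>M) = 0"
proof -
  define T where "T A = (\<integral>m. haar_d Y k ls (A + msc (- 1) (sig A)) m \<partial>M)" for A :: "complex ^ ('n + 'n) ^ ('n + 'n)"
  have int: "integrable M (haar_d Y k ls X)" for X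
    by (rule haar_integrable[OF haar continuous_haar_d])
  have T_add: "T (A + B) = T A + T B" for A B
  proof -
    have "A + B + msc (- 1) (sig (A + B)) = (A + msc (- 1) (sig A)) + (B + msc (- 1) (sig B))"
      by (simp add: sig_add msc_add)
    moreover have "(\<integral>m. haar_d Y k ls (X + X') m \<partial>M) = (\<integral>m. haar_d Y k ls X m \<partial>M) + (\<integral>m. haar_d Y k ls X' m \<partial>M)"
      for X X' unfolding haar_d_add by (rule Bochner_Integration.integral_add[OF int int])
    ultimately show ?thesis unfolding T_def by simp
  qed
  have T_msc: "T (msc c A) = c * T A" for c A
  proof -
    have "msc c A + msc (- 1) (sig (msc c A)) = msc c (A + msc (- 1) (sig A))"
      by (simp add: sig_msc msc_add msc_msc mult.commute)
    moreover have "(\<integral>m. haar_d Y k ls (msc c X) m \<partial>M) = c * (\<integral>m. haar_d Y k ls X m \<partial>M)" for X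
      unfolding haar_d_msc by simp
    ultimately show ?thesis unfolding T_def by simp
  qed
  have diff: "A - B = A + msc (- 1) B" for A B :: "complex ^ ('n + 'n) ^ ('n + 'n)"
    by (simp add: vec_eq_iff)
  have T_outer: "T (outer v) = 0" for v
  proof (cases "v = 0")
    case True
    then have "outer v = msc 0 (outer v)" by (simp add: vec_eq_iff)
    then show ?thesis using T_msc[of 0 "outer v"] by simp
  next
    case False
    define r where "r = (\<Sum>a\<in>UNIV. (norm (v $ a))\<^sup>2)"
    have r: "r > 0"
    proof -
      obtain a where "v $ a \<noteq> 0" using False by (auto simp: vec_eq_iff)
      then show ?thesis unfolding r_def by (intro sum_pos2[of _ a]) auto
    qed
    define u where "u = (\<chi> a. v $ a / complex_of_real (sqrt r))"
    have "(\<Sum>a\<in>UNIV. u $ a * cnj (u $ a)) = (\<Sum>a\<in>UNIV. complex_of_real ((norm (v $ a))\<^sup>2) / complex_of_real r)"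
    proof (intro sum.cong refl)
      fix a
      have "u $ a * cnj (u $ a) = (v $ a * cnj (v $ a)) / complex_of_real (sqrt r * sqrt r)"
        by (simp only: u_def vec_lambda_beta complex_cnj_divide complex_cnj_complex_of_real of_real_mult
            times_divide_times_eq)
      then show "u $ a * cnj (u $ a) = complex_of_real ((norm (v $ a))\<^sup>2) / complex_of_real r"
        using r by (simp only: complex_norm_square real_sqrt_mult_self abs_of_pos)
    qed
    also have "\<dots> = complex_of_real r / complex_of_real r"
      by (simp only: r_def sum_divide_distrib of_real_sum)
    also have "\<dots> = 1" using r by simp
    finally have u: "(\<Sum>a\<in>UNIV. u $ a * cnj (u $ a)) = 1" .
    have "\<i> * T (outer u) = T (msc \<i> (outer u))" by (simp add: T_msc)
    also have "\<dots> = 0"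
      using haar_d_outer[OF haar u, of Y k ls] unfolding T_def diff by (simp add: msc_add msc_msc sig_msc mult.commute)
    finally have "T (outer u) = 0" by simp
    moreover have "outer v = msc (complex_of_real r) (outer u)"
      using r by (simp add: vec_eq_iff u_def flip: of_real_mult)
    ultimately show ?thesis by (simp add: T_msc)
  qed
  have ax: "axis c 1 $ d = (if d = c then 1 else (0::complex))" for c d :: "'n + 'n"
    by (simp add: axis_def)
  have "T (elmat a b) = 0"
  proof (cases "a = b")
    case True
    then have "elmat a b = outer (axis a 1)"
      by (auto simp: vec_eq_iff elmat_def ax)
    then show ?thesis by (simp add: T_outer)
  next
    case False
    have o: "outer (axis c 1) = elmat c c" for c :: "'n + 'n"
      by (auto simp: vec_eq_iff elmat_def ax)
    have 1: "outer (axis a 1 + axis b 1) = elmat a a + elmat b b + (elmat a b + elmat b a)"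
      using False by (auto simp: vec_eq_iff elmat_def ax)
    \<comment> \<open>The conjugation in \<open>outer\<close> gives the coefficients
      \<open>- \<i>\<close> and \<open>\<i>\<close>, so this equation separates
      \<open>T (elmat a b)\<close> from \<open>T (elmat b a)\<close>.\<close>
    have 2: "outer (axis a 1 + \<i> *s axis b 1) = elmat a a + elmat b b + (msc (- \<i>) (elmat a b) + msc \<i> (elmat b a))"
      using False by (auto simp: vec_eq_iff elmat_def ax)
    have z: "T (elmat c c) = 0" for c using T_outer[of "axis c 1"] o by simp
    have "T (elmat a b) + T (elmat b a) = 0"
      using T_outer[of "axis a 1 + axis b 1"] unfolding 1 by (simp add: T_add z)
    moreover have "- \<i> * T (elmat a b) + \<i> * T (elmat b a) = 0"
      using T_outer[of "axis a 1 + \<i> *s axis b 1"] unfolding 2 by (simp add: T_add z T_msc)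
    then have "T (elmat a b) = T (elmat b a)" by simp
    ultimately show ?thesis by simp
  qed
  then show ?thesis by (simp add: T_def diff)
qed

primrec cGam :: "nat \<Rightarrow> nat list \<Rightarrow> complex ^ 'k::finite ^ 'k \<Rightarrow> complex" where
  "cGam k [] m = 0"
| "cGam k (l # ls) m = of_nat l * (trp (nd k l) m - trp (k + l) m) * cmon ls m + cGam k ls m * trp l m"

definition cLam :: "nat \<Rightarrow> complex ^ 'k::finite ^ 'k \<Rightarrow> complex" where
  "cLam k m = (\<Sum>j<k. trp j m * trp (k - j) m + trp (nd k (2 * j)) m)"

lemma elmat_mult_nth: "(elmat a b ** A) $ c $ d = (if c = a then A $ b $ d else 0)"
proof -
  have "(elmat a b ** A) $ c $ d = (\<Sum>e\<in>UNIV. if e = b then (if c = a then A $ b $ d else 0) else 0)"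
    unfolding mat_mult_nth by (intro sum.cong refl) (auto simp: elmat_def)
  then show ?thesis by simp
qed

lemma trace_elmat_mult: "trace (elmat a b ** A) = A $ b $ a"
  by (simp add: trace_def elmat_mult_nth)

lemma sig_matpow: "m \<in> USp \<Longrightarrow> sig (matpow m n) ** matpow m n = mat 1 \<and> matpow m n \<in> USp"
proof -
  assume m: "m \<in> USp"
  have "matpow m n \<in> USp"
  proof (induction n)
    case 0
    show ?case by (simp add: USp_iff sig_one mat_adj_one)
  qed (simp add: USp_mult m)
  then show ?thesis by (simp add: USp_iff)
qed

text \<open>\<open>sig\<close> inverts elements of \<open>USp\<close>, so this is the trace of m^(j
  - l); a negative exponent may be replaced by its absolute value because \<open>sig\<close>
  preserves traces.\<close>

lemma trace_matpow_sig:
  assumes "m \<in> USp"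
  shows "trace (matpow m j ** sig (matpow m l)) = trp (nd j l) m"
proof (cases "l \<le> j")
  case True
  then have "matpow m j = matpow m (j - l) ** matpow m l" by (simp flip: matpow_add)
  then have "matpow m j ** sig (matpow m l) = matpow m (j - l) ** (matpow m l ** sig (matpow m l))"
    by (simp add: matrix_mul_assoc)
  then show ?thesis
    using USp_right(1)[of "matpow m l"] sig_matpow[OF assms, of l] True by (simp add: trp_def nd_def)
next
  case False
  then have "matpow m l = matpow m j ** matpow m (l - j)" by (simp flip: matpow_add)
  then have "matpow m j ** sig (matpow m l) = matpow m j ** sig (matpow m (l - j)) ** sig (matpow m j)"
    by (simp add: sig_mult matrix_mul_assoc)
  also have "trace \<dots> = trace ((sig (matpow m j) ** matpow m j) ** sig (matpow m (l - j)))"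
    by (subst trace_cyclic) (simp add: matrix_mul_assoc)
  finally show ?thesis
    using sig_matpow[OF assms, of j] False by (simp add: trace_sig trp_def nd_def)
qed

text \<open>Contraction with the Casimir element: the elementary matrices give the product of two
  traces, and their images under \<open>sig\<close>, the conjugates of \<open>elmat b a\<close> by
  \<open>J\<close>, give the single trace with \<open>sig B\<close>.\<close>

lemma sum_trace_casimir:
  fixes A B :: "complex ^ ('n + 'n) ^ ('n + 'n::finite)"
  shows "(\<Sum>a\<in>UNIV. \<Sum>b\<in>UNIV. (A ** (elmat a b - sig (elmat a b)) ** B) $ a $ b) =
    trace A * trace B + trace (A ** sig B)"
proof -
  have e: "(A ** elmat a b ** B) $ a $ b = A $ a $ a * B $ b $ b" for a b
  proof -
    have "(A ** elmat a b ** B) $ a $ b = (\<Sum>c\<in>UNIV. A $ a $ c * (elmat a b ** B) $ c $ b)"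
      by (simp add: mat_mult_nth[of A] flip: matrix_mul_assoc)
    also have "\<dots> = (\<Sum>c\<in>UNIV. if c = a then A $ a $ a * B $ b $ b else 0)"
      by (intro sum.cong refl) (auto simp: elmat_mult_nth)
    finally show ?thesis by simp
  qed
  have s: "(A ** sig (elmat a b) ** B) $ a $ b = - (A ** symp_J) $ a $ b * (symp_J ** B) $ a $ b" for a b
  proof -
    have t: "transpose (elmat a b) = elmat b a" by (auto simp: vec_eq_iff transpose_def elmat_def)
    have "A ** sig (elmat a b) ** B = - ((A ** symp_J) ** (elmat b a ** (symp_J ** B)))"
      by (simp add: sig_def t matrix_neg_left matrix_neg_right matrix_mul_assoc)
    then have "(A ** sig (elmat a b) ** B) $ a $ b =
        - (\<Sum>c\<in>UNIV. (A ** symp_J) $ a $ c * (elmat b a ** (symp_J ** B)) $ c $ b)"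
      by (simp add: mat_mult_nth[of "A ** symp_J"])
    also have "(\<Sum>c\<in>UNIV. (A ** symp_J) $ a $ c * (elmat b a ** (symp_J ** B)) $ c $ b) =
       (\<Sum>c\<in>UNIV. if c = b then (A ** symp_J) $ a $ b * (symp_J ** B) $ a $ b else 0)"
      by (intro sum.cong refl) (auto simp: elmat_mult_nth)
    finally show ?thesis by simp
  qed
  have "(\<Sum>a\<in>UNIV. \<Sum>b\<in>UNIV. (A ** symp_J) $ a $ b * (symp_J ** B) $ a $ b) =
      trace ((A ** symp_J) ** transpose (symp_J ** B))"
    by (simp add: trace_def mat_mult_nth[of "A ** symp_J"] transpose_def)
  also have "(A ** symp_J) ** transpose (symp_J ** B) = A ** sig B"
    by (simp add: matrix_transpose_mul transpose_symp_J sig_def matrix_neg_right matrix_mul_assoc)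
  finally have s': "(\<Sum>a\<in>UNIV. \<Sum>b\<in>UNIV. (A ** symp_J) $ a $ b * (symp_J ** B) $ a $ b) = trace (A ** sig B)" .
  have d: "A ** (X - Y) ** B = A ** X ** B + - (A ** Y ** B)" for X Y
    by (simp add: diff_conv_add_uminus matrix_add_ldistrib mat_add_mult matrix_neg_left matrix_neg_right
        del: add_uminus_conv_diff)
  show ?thesis
    unfolding d by (simp add: e s sum.distrib s' trace_def[of A] trace_def[of B] sum_product)
qed

text \<open>Taking \<open>Y = elmat b a\<close> pairs each direction with its dual. Differentiating
  m^k itself produces \<open>cLam\<close> by \<open>sum_trace_casimir\<close>; differentiating
  another factor contracts m^k with \<open>matpow m l - sig (matpow m l)\<close> and produces
  \<open>- cGam\<close>.\<close>

lemma sum_haar_d_elmat: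
  fixes m :: "complex ^ ('n + 'n) ^ ('n + 'n::finite)"
  assumes m: "m \<in> USp"
  shows "(\<Sum>a\<in>UNIV. \<Sum>b\<in>UNIV. haar_d (elmat b a) k ls (elmat a b - sig (elmat a b)) m) =
    cLam k m * cmon ls m - cGam k ls m"
proof -
  let ?X = "\<lambda>a b. elmat a b - sig (elmat a b)"
  have 1: "(\<Sum>a\<in>UNIV. \<Sum>b\<in>UNIV. trace (elmat b a ** dmatpow m (?X a b ** m) k)) = cLam k m"
  proof -
    have "(\<Sum>a\<in>UNIV. \<Sum>b\<in>UNIV. trace (elmat b a ** dmatpow m (?X a b ** m) k)) =
        (\<Sum>j<k. \<Sum>a\<in>UNIV. \<Sum>b\<in>UNIV. (matpow m j ** ?X a b ** matpow m (k - j)) $ a $ b)"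
      unfolding trace_elmat_mult dmatpow_eq sum_component
      by (simp only: sum.swap[where A = "{..<k}" and B = UNIV])
    also have "\<dots> = cLam k m"
      unfolding cLam_def
    proof (intro sum.cong refl)
      fix j assume "j \<in> {..<k}"
      then have "nd j (k - j) = nd k (2 * j)" by (auto simp: nd_def)
      then show "(\<Sum>a\<in>UNIV. \<Sum>b\<in>UNIV. (matpow m j ** ?X a b ** matpow m (k - j)) $ a $ b) =
          trp j m * trp (k - j) m + trp (nd k (2 * j)) m"
        unfolding sum_trace_casimir trace_matpow_sig[OF m] by (simp add: trp_def)
    qed
    finally show ?thesis .
  qed
  have 2: "(\<Sum>a\<in>UNIV. \<Sum>b\<in>UNIV. trace (elmat b a ** matpow m k) * dcmon (?X a b) ls m) = - cGam k ls m" for ls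
  proof (induction ls)
    case (Cons l ls)
    have t: "trace (?X a b ** matpow m l) = matpow m l $ b $ a - sig (matpow m l) $ b $ a" for a b
    proof -
      have "trace (sig (elmat a b) ** matpow m l) = trace (sig (sig (matpow m l) ** elmat a b))"
        by (simp add: sig_mult sig_sig)
      also have "\<dots> = trace (elmat a b ** sig (matpow m l))"
        unfolding trace_sig by (rule trace_cyclic)
      finally have "trace (sig (elmat a b) ** matpow m l) = sig (matpow m l) $ b $ a"
        by (simp add: trace_elmat_mult)
      then show ?thesis
        by (simp add: diff_conv_add_uminus mat_add_mult trace_add matrix_neg_left trace_neg trace_elmat_mult
            del: add_uminus_conv_diff)
    qed
    have tr: "(\<Sum>a\<in>UNIV. \<Sum>b\<in>UNIV. A $ a $ b * B $ b $ a) = trace (A ** B)" for A B :: "complex ^ ('n + 'n) ^ ('n + 'n)"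
      by (simp add: trace_def mat_mult_nth)
    have A: "(\<Sum>a\<in>UNIV. \<Sum>b\<in>UNIV. trace (elmat b a ** matpow m k) * trace (?X a b ** matpow m l)) =
        trp (k + l) m - trp (nd k l) m"
      unfolding t trace_elmat_mult right_diff_distrib sum_subtractf tr trace_matpow_sig[OF m]
      by (simp add: trp_def matpow_add)
    have B: "(\<Sum>a\<in>UNIV. \<Sum>b\<in>UNIV. trace (elmat b a ** matpow m k) * dcmon (?X a b) (l # ls) m) =
        of_nat l * cmon ls m * (\<Sum>a\<in>UNIV. \<Sum>b\<in>UNIV. trace (elmat b a ** matpow m k) * trace (?X a b ** matpow m l)) +
        trp l m * (\<Sum>a\<in>UNIV. \<Sum>b\<in>UNIV. trace (elmat b a ** matpow m k) * dcmon (?X a b) ls m)"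
      unfolding sum_distrib_left sum.distrib[symmetric] by (intro sum.cong refl) (simp add: algebra_simps)
    show ?case unfolding B A Cons cGam.simps by (simp add: algebra_simps)
  qed simp
  have "(\<Sum>a\<in>UNIV. \<Sum>b\<in>UNIV. haar_d (elmat b a) k ls (?X a b) m) =
      (\<Sum>a\<in>UNIV. \<Sum>b\<in>UNIV. trace (elmat b a ** dmatpow m (?X a b ** m) k)) * cmon ls m +
      (\<Sum>a\<in>UNIV. \<Sum>b\<in>UNIV. trace (elmat b a ** matpow m k) * dcmon (?X a b) ls m)"
    by (simp add: haar_d_def sum.distrib sum_distrib_right)
  then show ?thesis unfolding 1 2 by simp
qed

theorem haar_loop:
  fixes M :: "(complex ^ ('n + 'n) ^ ('n + 'n::finite)) measure"
  assumes haar: "normalized_haar_measure USp M"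
  shows "(\<integral>m. cLam k m * cmon ls m - cGam k ls m \<partial>M) = 0"
proof -
  have "(\<integral>m. cLam k m * cmon ls m - cGam k ls m \<partial>M) =
      (\<integral>m. (\<Sum>a\<in>UNIV. \<Sum>b\<in>UNIV. haar_d (elmat b a) k ls (elmat a b - sig (elmat a b)) m) \<partial>M)"
    by (intro Bochner_Integration.integral_cong refl) (simp add: sum_haar_d_elmat haar_space[OF haar])
  also have "\<dots> = (\<Sum>a\<in>UNIV. \<Sum>b\<in>UNIV. \<integral>m. haar_d (elmat b a) k ls (elmat a b - sig (elmat a b)) m \<partial>M)"
    using haar_integrable[OF haar continuous_haar_d]
    by (simp add: Bochner_Integration.integral_sum Bochner_Integration.integrable_sum)
  finally show ?thesis by (simp add: haar_d_elmat[OF haar])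
qed

section \<open>Diagonalization in the compact symplectic group\<close>

definition cip :: "complex ^ 'k::finite \<Rightarrow> complex ^ 'k \<Rightarrow> complex" where
  "cip x y = (\<Sum>a\<in>UNIV. cnj (x $ a) * y $ a)"

lemma cip_add: "cip x (y + z) = cip x y + cip x z"
  by (simp add: cip_def distrib_left sum.distrib)

lemma cip_scale: "cip x (c *s y) = c * cip x y"
  by (simp add: cip_def sum_distrib_left mult.left_commute)

lemma cip_scale_left: "cip (c *s x) y = cnj c * cip x y"
  by (simp add: cip_def sum_distrib_left mult.assoc)

lemma cnj_cip: "cnj (cip x y) = cip y x"
  by (simp add: cip_def mult.commute)

lemma inner_eq_Re_cip: "x \<bullet> y = Re (cip x y)"
  by (simp add: inner_vec_def cip_def inner_complex_def)

lemma cip_self: "cip x x = complex_of_real ((norm x)\<^sup>2)"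
proof -
  have "cip x x = complex_of_real (\<Sum>a\<in>UNIV. (norm (x $ a))\<^sup>2)"
    unfolding cip_def of_real_sum by (intro sum.cong refl) (simp only: complex_norm_square mult.commute)
  then show ?thesis by (simp add: norm_vec_def L2_set_def sum_nonneg)
qed

lemma cip_adj: "cip x (m *v y) = cip (mat_adj m *v x) y"
proof -
  have "cip x (m *v y) = (\<Sum>a\<in>UNIV. \<Sum>b\<in>UNIV. cnj (x $ a) * (m $ a $ b * y $ b))"
    by (simp add: cip_def matrix_vector_mult_def sum_distrib_left)
  also have "\<dots> = (\<Sum>b\<in>UNIV. \<Sum>a\<in>UNIV. cnj (x $ a) * (m $ a $ b * y $ b))"
    by (rule sum.swap)
  also have "\<dots> = cip (mat_adj m *v x) y"
    by (simp add: cip_def matrix_vector_mult_def sum_distrib_right sum_distrib_left mult_ac)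
  finally show ?thesis .
qed

text \<open>The quaternionic structure \<open>x \<mapsto> - J cnj(x)\<close>, which commutes with the action of \<open>USp\<close>.\<close>

definition quat :: "complex ^ ('n + 'n) \<Rightarrow> complex ^ ('n + 'n::finite)" where
  "quat x = (\<chi> a. - half_sign a * cnj (x $ swap_half a))"

lemma quat_nth [simp]: "quat x $ a = - half_sign a * cnj (x $ swap_half a)"
  by (simp add: quat_def)

lemma quat_quat: "quat (quat x) = - x"
  by (simp add: vec_eq_iff mult.assoc[symmetric])

lemma quat_scale: "quat (c *s x) = cnj c *s quat x"
  by (simp add: vec_eq_iff)

lemma cip_quat_quat: "cip (quat x) (quat y) = cnj (cip x y)"
proof -
  have "cip (quat x) (quat y) = (\<Sum>a\<in>UNIV. (half_sign a * half_sign a) * (x $ swap_half a * cnj (y $ swap_half a)))"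
    unfolding cip_def
    by (intro sum.cong refl) (simp only: quat_nth complex_cnj_mult complex_cnj_cnj complex_cnj_minus
        cnj_half_sign mult_minus_left mult_minus_right minus_minus mult_ac)
  also have "\<dots> = (\<Sum>a\<in>UNIV. x $ swap_half a * cnj (y $ swap_half a))" by simp
  also have "\<dots> = (\<Sum>a\<in>UNIV. x $ a * cnj (y $ a))"
    by (rule sum.reindex_bij_betw[OF bij_swap_half])
  finally show ?thesis by (simp add: cip_def)
qed

lemma cip_quat: "cip x (quat y) = - cip y (quat x)"
proof -
  have "cip x (quat y) = (\<Sum>a\<in>UNIV. cnj (x $ swap_half a) * quat y $ swap_half a)"
    unfolding cip_def by (rule sum.reindex_bij_betw[OF bij_swap_half, symmetric])
  then show ?thesis by (simp add: cip_def sum_negf mult_ac)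
qed

lemma cip_quat_self: "cip x (quat x) = 0"
  using cip_quat[of x x] by simp

text \<open>In \<open>USp\<close> both adjoints are the inverse. Read entrywise,
  \<open>sig m = mat_adj m\<close> says that \<open>m\<close> is its own complex conjugate up to
  conjugation by \<open>J\<close>.\<close>

lemma USp_quat:
  assumes "m \<in> USp"
  shows "m *v quat x = quat (m *v x)"
proof -
  have e: "m $ a $ b * half_sign b = half_sign a * cnj (m $ swap_half a $ swap_half b)" for a b
  proof -
    have "sig m $ swap_half b $ swap_half a = mat_adj m $ swap_half b $ swap_half a"
      by (simp add: USp_sig_eq_adj[OF assms])
    then have "half_sign b * half_sign a * m $ a $ b = cnj (m $ swap_half a $ swap_half b)"
      by (simp add: sig_nth)
    then have "half_sign a * cnj (m $ swap_half a $ swap_half b) = (half_sign a * half_sign a) * (m $ a $ b * half_sign b)"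
      by (simp only: mult_ac)
    then show ?thesis by simp
  qed
  have "(m *v quat x) $ a = quat (m *v x) $ a" for a
  proof -
    have "(m *v quat x) $ a = - (\<Sum>b\<in>UNIV. (m $ a $ b * half_sign b) * cnj (x $ swap_half b))"
      by (simp add: matrix_vector_mult_def sum_negf mult.assoc)
    also have "\<dots> = - half_sign a * (\<Sum>b\<in>UNIV. cnj (m $ swap_half a $ swap_half b) * cnj (x $ swap_half b))"
      unfolding e by (simp add: sum_distrib_left mult.assoc sum_negf)
    also have "(\<Sum>b\<in>UNIV. cnj (m $ swap_half a $ swap_half b) * cnj (x $ swap_half b)) =
        (\<Sum>b\<in>UNIV. cnj (m $ swap_half a $ b) * cnj (x $ b))"
      by (rule sum.reindex_bij_betw[OF bij_swap_half])
    finally show ?thesis by (simp add: matrix_vector_mult_def)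
  qed
  then show ?thesis by (simp add: vec_eq_iff)
qed

lemma USp_adj_vec: "m \<in> USp \<Longrightarrow> mat_adj m *v (m *v x) = x" "m \<in> USp \<Longrightarrow> m *v (mat_adj m *v x) = x"
  by (simp_all add: matrix_vector_mul_assoc USp_right) (simp_all add: USp_iff)

lemma USp_cip: "m \<in> USp \<Longrightarrow> cip (m *v x) (m *v y) = cip x y"
  by (simp add: cip_adj USp_adj_vec)

text \<open>A null vector of a positive semidefinite form lies in its kernel: otherwise the form
  along the line through \<open>y\<close> in direction \<open>b\<close> is a nonconstant affine
  function of \<open>s\<close>. The chosen \<open>s\<close> makes it \<open>- 1\<close>.\<close>

lemma psd_kernel:
  fixes B :: "'a::real_vector \<Rightarrow> 'a \<Rightarrow> real"
  assumes bil: "\<And>s. B (y + s *\<^sub>R b) (y + s *\<^sub>R b) = B y y + 2 * s * B b y + s\<^sup>2 * B b b"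
    and nn: "\<And>s. 0 \<le> B (y + s *\<^sub>R b) (y + s *\<^sub>R b)" and b: "B b b = 0"
  shows "B b y = 0"
proof (rule ccontr)
  assume ne: "B b y \<noteq> 0"
  define s where "s = - (B y y + 1) / (2 * B b y)"
  have "2 * s * B b y = - (B y y + 1)" using ne by (simp add: s_def)
  then show False using nn[of s] unfolding bil b by simp
qed

lemma scaleR_eq_scale: "r *\<^sub>R x = complex_of_real r *s (x :: complex ^ 'k)"
  by (simp add: vec_eq_iff scaleR_conv_of_real[symmetric])

text \<open>An eigenvector is found by maximizing \<open>Re \<langle>w, m w\<rangle>\<close>, the quadratic form of the self-adjoint
  operator \<open>(m + m\<inverse>) / 2\<close>, on the unit sphere of \<open>W\<close>.\<close>

lemma ex_eigenvector:
  fixes m :: "complex ^ ('n + 'n) ^ ('n + 'n::finite)" and W :: "(complex ^ ('n + 'n)) set"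
  assumes m: "m \<in> USp"
    and W: "closed W" "\<And>x y. x \<in> W \<Longrightarrow> y \<in> W \<Longrightarrow> x + y \<in> W" "\<And>c x. x \<in> W \<Longrightarrow> c *s x \<in> W"
      "\<And>x. x \<in> W \<Longrightarrow> m *v x \<in> W" "\<And>x. x \<in> W \<Longrightarrow> mat_adj m *v x \<in> W" "\<And>x. x \<in> W \<Longrightarrow> quat x \<in> W"
    and w: "w \<in> W" "w \<noteq> 0"
  obtains z \<theta> where "z \<in> W" "cip z z = 1" "\<theta> \<in> {0..pi}" "m *v z = cis \<theta> *s z"
proof -
  have WR: "r *\<^sub>R x \<in> W" if "x \<in> W" for r x unfolding scaleR_eq_scale by (rule W(3)[OF that])
  let ?K = "W \<inter> sphere 0 1"
  have "compact ?K" by (intro closed_Int_compact W) auto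
  moreover have "w /\<^sub>R norm w \<in> ?K" using w by (auto intro: WR)
  then have "?K \<noteq> {}" by blast
  moreover have "continuous_on ?K (\<lambda>x. x \<bullet> (m *v x))"
    unfolding matrix_vector_mult_def by (intro continuous_intros)
  ultimately obtain w0 where w0: "w0 \<in> ?K" "\<And>x. x \<in> ?K \<Longrightarrow> x \<bullet> (m *v x) \<le> w0 \<bullet> (m *v w0)"
    using continuous_attains_sup[of ?K "\<lambda>x. x \<bullet> (m *v x)"] by blast
  define c where "c = w0 \<bullet> (m *v w0)"
  have n0: "norm w0 = 1" "w0 \<in> W" using w0 by auto
  have sc: "m *v (r *\<^sub>R x) = r *\<^sub>R (m *v x)" for r x
    unfolding scaleR_eq_scale by (simp add: vector_scalar_commute)
  \<comment> \<open>\<open>c\<close> times the inner product minus the form of the self-adjoint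
    operator; maximality of \<open>w0\<close> makes it nonnegative on \<open>W\<close>, and
    \<open>w0\<close> is a null vector.\<close>
  define B where "B x y = c * (x \<bullet> y) - (x \<bullet> (m *v y) + y \<bullet> (m *v x)) / 2" for x y
  have B_nn: "0 \<le> B x x" if "x \<in> W" for x
  proof (cases "x = 0")
    case False
    let ?x = "x /\<^sub>R norm x"
    have "?x \<bullet> (m *v ?x) \<le> c" unfolding c_def using False that by (intro w0(2)) (auto intro: WR)
    then have "(x \<bullet> (m *v x)) / (norm x)\<^sup>2 \<le> c"
      by (simp add: sc power2_eq_square divide_inverse mult_ac)
    then have "x \<bullet> (m *v x) \<le> c * (norm x)\<^sup>2"
      using False by (simp add: divide_le_eq)
    then show ?thesis by (simp add: B_def power2_norm_eq_inner)
  qed (simp add: B_def)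
  have B0: "B w0 y = 0" if "y \<in> W" for y
  proof (rule psd_kernel[where B = B and b = w0 and y = y])
    show "B (y + s *\<^sub>R w0) (y + s *\<^sub>R w0) = B y y + 2 * s * B w0 y + s\<^sup>2 * B w0 w0" for s
      by (simp add: B_def sc matrix_vector_right_distrib inner_add inner_commute algebra_simps power2_eq_square)
    show "0 \<le> B (y + s *\<^sub>R w0) (y + s *\<^sub>R w0)" for s
      by (intro B_nn W(2) that WR n0)
    show "B w0 w0 = 0" using n0 by (simp add: B_def c_def power2_norm_eq_inner[symmetric])
  qed
  \<comment> \<open>\<open>y\<close> represents the functional \<open>B w0\<close>, so
    \<open>B w0 y\<close> is its squared norm; since it vanishes, \<open>w0\<close> is an
    eigenvector of \<open>m + mat_adj m\<close> with eigenvalue \<open>2 * c\<close>.\<close>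
  define y where "y = c *\<^sub>R w0 - (1 / 2) *\<^sub>R (m *v w0 + mat_adj m *v w0)"
  have "y \<in> W"
    unfolding y_def diff_conv_add_uminus scaleR_minus_left[symmetric] by (intro W WR n0)
  have adj: "w0 \<bullet> (m *v x) = (mat_adj m *v w0) \<bullet> x" for x
    by (simp add: inner_eq_Re_cip cip_adj)
  have "B w0 y = c * (w0 \<bullet> y) - ((mat_adj m *v w0) \<bullet> y + (m *v w0) \<bullet> y) / 2"
    unfolding B_def adj by (simp only: inner_commute[of y])
  also have "\<dots> = (c *\<^sub>R w0 - (1 / 2) *\<^sub>R (m *v w0 + mat_adj m *v w0)) \<bullet> y"
    by (simp add: inner_diff_left inner_add_left algebra_simps add_divide_distrib)
  also have "\<dots> = y \<bullet> y" by (simp only: y_def[symmetric])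
  finally have "B w0 y = y \<bullet> y" .
  then have "y = 0" using B0[OF \<open>y \<in> W\<close>] by simp
  then have e: "m *v w0 + mat_adj m *v w0 = (2 * c) *\<^sub>R w0"
  proof -
    have "c *\<^sub>R w0 = (1 / 2) *\<^sub>R (m *v w0 + mat_adj m *v w0)" using \<open>y = 0\<close> by (simp add: y_def)
    then have "2 *\<^sub>R (c *\<^sub>R w0) = 2 *\<^sub>R ((1 / 2) *\<^sub>R (m *v w0 + mat_adj m *v w0))" by simp
    then show ?thesis by simp
  qed
  have "\<bar>c\<bar> \<le> norm w0 * norm (m *v w0)" unfolding c_def by (rule Cauchy_Schwarz_ineq2)
  moreover have "norm (m *v w0) = norm w0"
  proof -
    have "complex_of_real ((norm (m *v w0))\<^sup>2) = complex_of_real ((norm w0)\<^sup>2)"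
      using USp_cip[OF m, of w0 w0] by (simp only: cip_self)
    then have "(norm (m *v w0))\<^sup>2 = (norm w0)\<^sup>2" by (simp only: of_real_eq_iff)
    then show ?thesis by (rule power2_eq_imp_eq) auto
  qed
  ultimately have c1: "\<bar>c\<bar> \<le> 1" using n0 by simp
  define \<theta> where "\<theta> = arccos c"
  have \<theta>: "\<theta> \<in> {0..pi}" "cos \<theta> = c"
    using c1 arccos_lbound[of c] arccos_ubound[of c] cos_arccos[of c] by (auto simp: \<theta>_def)
  have cc: "cis \<theta> + cis (- \<theta>) = complex_of_real (2 * c)" "cis \<theta> * cis (- \<theta>) = 1"
    using \<theta>(2) by (simp_all add: complex_eq_iff cis_mult)
  have "m *v (m *v w0 + mat_adj m *v w0) = m *v ((2 * c) *\<^sub>R w0)" using e by simp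
  then have mm: "m *v (m *v w0) = complex_of_real (2 * c) *s (m *v w0) - w0"
    unfolding sc matrix_vector_right_distrib USp_adj_vec(2)[OF m] scaleR_eq_scale
    by (simp add: algebra_simps vector_scalar_commute)
  \<comment> \<open>On \<open>w0\<close> the matrix \<open>m\<close> satisfies a quadratic equation
    with roots \<open>cis \<theta>\<close> and \<open>cis (- \<theta>)\<close>. Either
    \<open>u = 0\<close> and \<open>w0\<close> is an eigenvector for \<open>cis \<theta>\<close>, or
    \<open>u\<close> is one for \<open>cis (- \<theta>)\<close> and \<open>quat u\<close> is one for
    \<open>cis \<theta>\<close>; this keeps the angle in \<open>{0..pi}\<close>.\<close>
  define u where "u = m *v w0 - cis \<theta> *s w0"
  obtain z where z: "z \<in> W" "z \<noteq> 0" "m *v z = cis \<theta> *s z"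
  proof (cases "u = 0")
    case True
    moreover have "w0 \<noteq> 0" using n0(1) by auto
    ultimately show ?thesis using that[of w0] n0(2) by (simp add: u_def)
  next
    case False
    have uW: "u \<in> W"
    proof -
      have e: "u = m *v w0 + (- cis \<theta>) *s w0" by (simp add: u_def vec_eq_iff)
      show ?thesis unfolding e by (intro W(2) W(3) W(4) n0(2))
    qed
    have "m *v u = cis (- \<theta>) *s u"
    proof -
      have "m *v u = (m *v (m *v w0)) - cis \<theta> *s (m *v w0)"
        by (simp add: u_def matrix_vector_mult_diff_distrib vector_scalar_commute)
      also have "\<dots> = (cis \<theta> + cis (- \<theta>)) *s (m *v w0) - (cis \<theta> * cis (- \<theta>)) *s w0 - cis \<theta> *s (m *v w0)"
        unfolding mm cc by simp
      also have "\<dots> = cis (- \<theta>) *s u"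
        by (simp add: u_def vec_eq_iff algebra_simps)
      finally show ?thesis .
    qed
    then have "m *v quat u = cis \<theta> *s quat u"
      by (simp add: USp_quat[OF m] quat_scale cis_cnj)
    moreover have "quat u \<noteq> 0"
    proof
      assume "quat u = 0"
      moreover have "quat (0 :: complex ^ ('n + 'n)) = 0" by (simp add: vec_eq_iff)
      ultimately show False using False quat_quat[of u] by simp
    qed
    ultimately show ?thesis using that[of "quat u"] W(6)[OF uW] by blast
  qed
  show thesis
  proof (rule that)
    show "z /\<^sub>R norm z \<in> W" by (rule WR[OF z(1)])
    show "cip (z /\<^sub>R norm z) (z /\<^sub>R norm z) = 1" using z(2) by (simp add: cip_self)
    show "m *v (z /\<^sub>R norm z) = cis \<theta> *s (z /\<^sub>R norm z)"
      unfolding sc z(3) by (simp add: vec_eq_iff)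
    show "\<theta> \<in> {0..pi}" by (rule \<theta>)
  qed
qed

definition eigensystem ::
    "complex ^ ('n + 'n) ^ ('n + 'n::finite) \<Rightarrow> 'n set \<Rightarrow> ('n \<Rightarrow> complex ^ ('n + 'n)) \<Rightarrow> ('n \<Rightarrow> real) \<Rightarrow> bool" where
  "eigensystem m A v \<theta> \<longleftrightarrow>
    (\<forall>i\<in>A. \<theta> i \<in> {0..pi} \<and> m *v v i = cis (\<theta> i) *s v i \<and> cip (v i) (v i) = 1) \<and>
    (\<forall>i\<in>A. \<forall>j\<in>A. i \<noteq> j \<longrightarrow> cip (v i) (v j) = 0) \<and>
    (\<forall>i\<in>A. \<forall>j\<in>A. cip (v i) (quat (v j)) = 0)"

text \<open>Induction on the set of indices served so far: the orthogonal complement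
  \<open>W\<close> of the vectors \<open>v i\<close> and \<open>quat (v i)\<close> satisfies the
  invariance hypotheses of \<open>ex_eigenvector\<close>.\<close>

lemma ex_eigensystem:
  fixes m :: "complex ^ ('n + 'n) ^ ('n + 'n::finite)"
  assumes m: "m \<in> USp"
  shows "\<exists>v \<theta>. eigensystem m A v \<theta>"
proof (induction A rule: infinite_finite_induct)
  case (insert a A)
  then obtain v \<theta> where E: "eigensystem m A v \<theta>" by blast
  define W where "W = {x. \<forall>i\<in>A. cip (v i) x = 0 \<and> cip (quat (v i)) x = 0}"
  have ev: "m *v v i = cis (\<theta> i) *s v i" "m *v quat (v i) = cis (- \<theta> i) *s quat (v i)" if "i \<in> A" for i
    using E that USp_quat[OF m, of "v i"] by (auto simp: eigensystem_def quat_scale cis_cnj)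
  have stab: "cip u (m *v x) = 0" "cip u (mat_adj m *v x) = 0"
    if "cip u x = 0" "m *v u = cis t *s u" for u x t
  proof -
    have "cip (m *v u) (m *v x) = 0" using that(1) by (simp add: USp_cip[OF m])
    then show "cip u (m *v x) = 0" unfolding that(2) by (simp add: cip_scale_left)
    have "mat_adj (mat_adj m) = m" by (simp add: vec_eq_iff)
    then have "cip u (mat_adj m *v x) = cip (m *v u) x" by (simp add: cip_adj)
    then show "cip u (mat_adj m *v x) = 0" unfolding that(2) using that(1) by (simp add: cip_scale_left)
  qed
  have Wcl: "closed W"
    unfolding W_def cip_def Ball_def
    by (intro closed_Collect_all closed_Collect_imp closed_Collect_conj closed_Collect_eq
        open_Collect_const continuous_intros)
  have Wadd: "x + y \<in> W" if "x \<in> W" "y \<in> W" for x y using that by (simp add: W_def cip_add)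
  have Wsc: "c *s x \<in> W" if "x \<in> W" for c x using that by (simp add: W_def cip_scale)
  have Wm: "m *v x \<in> W" "mat_adj m *v x \<in> W" if "x \<in> W" for x
    using that stab ev unfolding W_def by blast+
  have Wq: "quat x \<in> W" if "x \<in> W" for x
  proof -
    have "cip (v i) (quat x) = - cnj (cip (quat (v i)) x)" for i
      by (simp add: cip_quat[of "v i"] cnj_cip)
    then show ?thesis using that by (simp add: W_def cip_quat_quat)
  qed
  obtain w where w: "w \<in> W" "w \<noteq> 0"
  proof -
    \<comment> \<open>A count of real dimensions: each index contributes four vectors, and
      \<open>4 * card A\<close> is below the real dimension \<open>4 * CARD('n)\<close>. The
      multiples by \<open>\<i>\<close> make real orthogonality imply that \<open>cip\<close>
      vanishes.\<close>
    let ?S = "v ` A \<union> (\<lambda>i. \<i> *s v i) ` A \<union> (\<lambda>i. quat (v i)) ` A \<union> (\<lambda>i. \<i> *s quat (v i)) ` A"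
    have "card A < CARD('n)" using insert by (intro psubset_card_mono) auto
    moreover have "card ?S \<le> card A + card A + card A + card A"
      using insert(1)
      by (intro order.trans[OF card_Un_le] add_mono card_image_le) auto
    ultimately have "card ?S < DIM(complex ^ ('n + 'n))" by simp
    moreover have "dim ?S \<le> card ?S" using insert(1) by (intro dim_le_card') auto
    ultimately have "dim ?S < DIM(complex ^ ('n + 'n))" by linarith
    then obtain x where x: "x \<noteq> 0" "\<And>y. y \<in> span ?S \<Longrightarrow> orthogonal x y"
      by (rule orthogonal_to_subspace_exists) blast
    have z: "cip u x = 0" if "u \<in> ?S" "\<i> *s u \<in> ?S" for u
    proof -
      have "orthogonal x u" by (rule x(2)[OF span_base[OF that(1)]])
      moreover have "orthogonal x (\<i> *s u)" by (rule x(2)[OF span_base[OF that(2)]])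
      ultimately have "u \<bullet> x = 0" "(\<i> *s u) \<bullet> x = 0"
        by (simp_all only: orthogonal_def inner_commute[of x])
      then show ?thesis by (simp add: inner_eq_Re_cip cip_scale_left complex_eq_iff)
    qed
    have "x \<in> W" unfolding W_def using z by auto
    then show ?thesis using that x by blast
  qed
  obtain z \<theta>' where z: "z \<in> W" "cip z z = 1" "\<theta>' \<in> {0..pi}" "m *v z = cis \<theta>' *s z"
    using ex_eigenvector[OF m Wcl Wadd Wsc Wm Wq w] by blast
  have o: "cip (v i) z = 0" "cip z (v i) = 0" "cip (v i) (quat z) = 0" "cip z (quat (v i)) = 0" if "i \<in> A" for i
  proof -
    show 1: "cip (v i) z = 0" and 2: "cip (v i) (quat z) = 0" using z(1) Wq[OF z(1)] that by (auto simp: W_def)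
    show "cip z (v i) = 0" using 1 cnj_cip[of "v i" z] by simp
    show "cip z (quat (v i)) = 0" using 2 cip_quat[of z "v i"] by simp
  qed
  have "eigensystem m (insert a A) (v(a := z)) (\<theta>(a := \<theta>'))"
    using E z o \<open>a \<notin> A\<close> cip_quat_self[of z] unfolding eigensystem_def by auto
  then show ?case by blast
qed (auto simp: eigensystem_def)

lemma torus_elt_nth:
  "torus_elt \<theta> $ a $ b = (if a = b then (case a of Inl j \<Rightarrow> cis (\<theta> $ j) | Inr j \<Rightarrow> cis (- \<theta> $ j)) else 0)"
  by (simp add: torus_elt_def cis_conv_exp split: sum.split)

theorem USp_diagonalize:
  fixes m :: "complex ^ ('n + 'n) ^ ('n + 'n::finite)"
  assumes m: "m \<in> USp"
  obtains x \<theta> where "x \<in> USp" "\<And>i. \<theta> $ i \<in> {0..pi}" "m ** x = x ** torus_elt \<theta>"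
proof -
  obtain v \<theta> where E: "eigensystem m UNIV v \<theta>" using ex_eigensystem[OF m] by blast
  \<comment> \<open>Orthonormality of the columns makes \<open>x\<close> unitary; placing
    \<open>quat (v i)\<close> in the column matching that of \<open>v i\<close> makes it
    symplectic.\<close>
  define x :: "complex ^ ('n + 'n) ^ ('n + 'n)"
    where "x = (\<chi> a b. case b of Inl i \<Rightarrow> v i $ a | Inr i \<Rightarrow> quat (v i) $ a)"
  have q: "cip (quat (v i)) (v j) = 0" for i j
    using E cnj_cip[of "v j" "quat (v i)"] by (simp add: eigensystem_def)
  have "mat_adj x ** x = mat 1"
  proof -
    have "(mat_adj x ** x) $ a $ b = (mat 1 :: complex ^ ('n + 'n) ^ ('n + 'n)) $ a $ b" for a b
    proof -
      have "(mat_adj x ** x) $ a $ b = cip (case a of Inl i \<Rightarrow> v i | Inr i \<Rightarrow> quat (v i))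
          (case b of Inl i \<Rightarrow> v i | Inr i \<Rightarrow> quat (v i))"
        unfolding mat_mult_nth cip_def by (cases a; cases b) (simp_all add: x_def)
      then show ?thesis using E q
        by (cases a; cases b) (auto simp: eigensystem_def mat_def cip_quat_quat)
    qed
    then show ?thesis by (simp add: vec_eq_iff)
  qed
  moreover have "sig x = mat_adj x"
  proof -
    have "sig x $ a $ b = mat_adj x $ a $ b" for a b
      by (cases a; cases b) (simp_all add: sig_nth x_def swap_half_def half_sign_def)
    then show ?thesis by (simp add: vec_eq_iff)
  qed
  ultimately have x: "x \<in> USp" by (simp add: USp_iff)
  have "m ** x = x ** torus_elt (\<chi> i. \<theta> i)"
  proof -
    have l: "(m ** x) $ a $ b = (m *v (case b of Inl i \<Rightarrow> v i | Inr i \<Rightarrow> quat (v i))) $ a" for a b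
      unfolding mat_mult_nth matrix_vector_mult_def by (cases b) (simp_all add: x_def)
    have r: "(x ** torus_elt (\<chi> i. \<theta> i)) $ a $ b =
        x $ a $ b * (case b of Inl j \<Rightarrow> cis (\<theta> j) | Inr j \<Rightarrow> cis (- \<theta> j))" for a b
      unfolding mat_mult_nth torus_elt_nth
      by (cases b) (simp_all add: if_distrib[where f="\<lambda>y. _ * y"] cong: if_cong)
    have "(m ** x) $ a $ b = (x ** torus_elt (\<chi> i. \<theta> i)) $ a $ b" for a b
      unfolding l r using E USp_quat[OF m]
      by (cases b) (auto simp: eigensystem_def quat_scale cis_cnj x_def)
    then show ?thesis by (simp add: vec_eq_iff)
  qed
  then show thesis using that[OF x, of "\<chi> i. \<theta> i"] E by (auto simp: eigensystem_def)
qed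

section \<open>The torus and the values of central functions on it\<close>

lemma torus_elt_add: "torus_elt \<theta> ** torus_elt \<phi> = torus_elt (\<theta> + \<phi>)"
proof -
  have "(torus_elt \<theta> ** torus_elt \<phi>) $ a $ b = torus_elt (\<theta> + \<phi>) $ a $ b" for a b
  proof -
    have "(torus_elt \<theta> ** torus_elt \<phi>) $ a $ b = (\<Sum>c\<in>UNIV. if c = a then torus_elt \<theta> $ a $ a * torus_elt \<phi> $ a $ b else 0)"
      unfolding mat_mult_nth by (intro sum.cong refl) (auto simp: torus_elt_nth)
    then show ?thesis
      by (cases a; cases b) (auto simp: torus_elt_nth cis_mult)
  qed
  then show ?thesis by (simp add: vec_eq_iff)
qed

lemma torus_elt_0: "torus_elt 0 = (mat 1 :: complex ^ ('n + 'n) ^ ('n + 'n::finite))"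
proof -
  have "torus_elt 0 $ a $ b = mat 1 $ a $ b" for a b :: "'n + 'n"
    by (cases a; cases b) (auto simp: torus_elt_nth mat_def)
  then show ?thesis by (simp add: vec_eq_iff)
qed

lemma torus_elt_USp: "torus_elt \<theta> \<in> USp"
proof -
  have "sig (torus_elt \<theta>) $ a $ b = torus_elt (- \<theta>) $ a $ b" "mat_adj (torus_elt \<theta>) $ a $ b = torus_elt (- \<theta>) $ a $ b" for a b
    by (cases a; cases b; auto simp: sig_nth torus_elt_nth swap_half_def half_sign_def cis_cnj)+
  then have "sig (torus_elt \<theta>) = torus_elt (- \<theta>)" "mat_adj (torus_elt \<theta>) = torus_elt (- \<theta>)"
    by (simp_all add: vec_eq_iff)
  then show ?thesis by (simp add: USp_iff torus_elt_add torus_elt_0)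
qed

lemma matpow_torus_elt: "matpow (torus_elt \<theta>) k = torus_elt (real k *\<^sub>R \<theta>)"
  by (induction k) (auto simp: torus_elt_0 torus_elt_add algebra_simps)

lemma trp_torus_elt: "trp k (torus_elt \<theta>) = complex_of_real (psum k (\<chi> i. 2 * cos (\<theta> $ i)))"
proof -
  have "trp k (torus_elt \<theta>) = (\<Sum>i\<in>UNIV. cis (real k * \<theta> $ i)) + (\<Sum>i\<in>UNIV. cis (- (real k * \<theta> $ i)))"
    unfolding trp_def matpow_torus_elt trace_def UNIV_sum
    by (subst sum.union_disjoint) (auto simp: sum.reindex torus_elt_nth)
  also have "\<dots> = complex_of_real (psum k (\<chi> i. 2 * cos (\<theta> $ i)))"
    by (simp add: psum_def tau_2_cos sum.distrib[symmetric] complex_eq_iff sum_distrib_left)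
  finally show ?thesis .
qed

lemma USp_inv: "x \<in> USp \<Longrightarrow> matrix_inv x = sig x"
proof -
  assume x: "x \<in> USp"
  then have "\<exists>y. x ** y = mat 1 \<and> y ** x = mat 1" by (simp add: USp_def invertible_def)
  then have "x ** matrix_inv x = mat 1 \<and> matrix_inv x ** x = mat 1"
    unfolding matrix_inv_def by (rule someI_ex)
  then have "matrix_inv x ** x = mat 1" ..
  then have "matrix_inv x ** (x ** sig x) = sig x" by (simp only: matrix_mul_assoc matrix_mul_lid)
  then show ?thesis using USp_right(1)[OF x] by simp
qed

lemma USp_eigenangles:
  fixes m :: "complex ^ ('n + 'n) ^ ('n + 'n::finite)"
  assumes m: "m \<in> USp"
  obtains \<theta> where "\<And>i. \<theta> $ i \<in> {0..pi}"
    "\<And>k. trp k m = complex_of_real (psum k (\<chi> i. 2 * cos (\<theta> $ i)))"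
    "\<And>F. central_on USp F \<Longrightarrow> F m = F (torus_elt \<theta>)"
proof -
  obtain x \<theta> where x: "x \<in> USp" "\<And>i. \<theta> $ i \<in> {0..pi}" "m ** x = x ** torus_elt \<theta>"
    using USp_diagonalize[OF m] by blast
  have "m = m ** (x ** sig x)" using USp_right(1)[OF x(1)] by simp
  then have me: "m = x ** torus_elt \<theta> ** sig x" by (simp only: matrix_mul_assoc x(3))
  have "matpow m k ** x = x ** matpow (torus_elt \<theta>) k" for k
  proof (induction k)
    case (Suc k)
    have "matpow m (Suc k) ** x = m ** (matpow m k ** x)" by (simp add: matrix_mul_assoc)
    also have "\<dots> = (m ** x) ** matpow (torus_elt \<theta>) k" by (simp only: Suc matrix_mul_assoc)
    finally show ?case by (simp only: x(3) matpow.simps matrix_mul_assoc)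
  qed simp
  then have "trp k m = trp k (torus_elt \<theta>)" for k
  proof -
    assume *: "\<And>k. matpow m k ** x = x ** matpow (torus_elt \<theta>) k"
    have "trp k m = trace (matpow m k ** (x ** sig x))" using USp_right(1)[OF x(1)] by (simp add: trp_def)
    also have "\<dots> = trace ((matpow m k ** x) ** sig x)" by (simp only: matrix_mul_assoc)
    also have "\<dots> = trace (sig x ** (matpow m k ** x))" by (rule trace_cyclic)
    also have "\<dots> = trace ((sig x ** x) ** matpow (torus_elt \<theta>) k)" by (simp only: * matrix_mul_assoc)
    finally show ?thesis using x(1) by (simp add: USp_iff trp_def)
  qed
  moreover have "F m = F (torus_elt \<theta>)" if "central_on USp F" for F
    using that x(1) torus_elt_USp[of \<theta>] unfolding me central_on_def USp_inv[OF x(1), symmetric] by blast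
  ultimately show thesis using that[of \<theta>] x(2) trp_torus_elt[of _ \<theta>] by simp
qed

text \<open>A permutation matrix that acts in the same way on both halves of the indices lies in
  \<open>USp\<close> and conjugates one torus element to the other.\<close>

lemma central_torus_permute:
  fixes F :: "complex ^ ('n + 'n) ^ ('n + 'n::finite) \<Rightarrow> complex"
  assumes F: "central_on USp F" and p: "p permutes UNIV"
  shows "F (torus_elt (\<chi> i. \<theta> $ p i)) = F (torus_elt \<theta>)"
proof -
  let ?p = "map_sum p p"
  define x :: "complex ^ ('n + 'n) ^ ('n + 'n)" where "x = (\<chi> a b. if a = ?p b then 1 else 0)"
  have inj: "?p a = ?p b \<longleftrightarrow> a = b" for a b
    using permutes_inj[OF p] by (cases a; cases b) (auto simp: inj_def)
  have sw: "swap_half (?p a) = ?p (swap_half a)" "half_sign (?p a) = half_sign a" for a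
    by (cases a; simp add: swap_half_def half_sign_def)+
  have "mat_adj x ** x = mat 1"
  proof -
    have "(mat_adj x ** x) $ a $ b = (\<Sum>c\<in>UNIV. if c = ?p a then (if a = b then 1 else 0) else 0)" for a b
      unfolding mat_mult_nth by (intro sum.cong refl) (auto simp: x_def inj)
    then show ?thesis by (simp add: vec_eq_iff mat_def)
  qed
  moreover have "sig x = mat_adj x"
  proof -
    have "sig x $ a $ b = mat_adj x $ a $ b" for a b
    proof -
      have "swap_half b = ?p (swap_half a) \<longleftrightarrow> b = ?p a" by (metis sw(1) swap_half_swap_half)
      then show ?thesis by (auto simp: sig_nth x_def sw)
    qed
    then show ?thesis by (simp add: vec_eq_iff)
  qed
  ultimately have x: "x \<in> USp" by (simp add: USp_iff)
  have "torus_elt \<theta> ** x = x ** torus_elt (\<chi> i. \<theta> $ p i)"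
  proof -
    have "(torus_elt \<theta> ** x) $ a $ b = (x ** torus_elt (\<chi> i. \<theta> $ p i)) $ a $ b" for a b
    proof -
      have "(torus_elt \<theta> ** x) $ a $ b = (\<Sum>c\<in>UNIV. if c = a then torus_elt \<theta> $ a $ a * x $ a $ b else 0)"
        unfolding mat_mult_nth by (intro sum.cong refl) (auto simp: torus_elt_nth)
      moreover have "(x ** torus_elt (\<chi> i. \<theta> $ p i)) $ a $ b =
          (\<Sum>c\<in>UNIV. if c = b then x $ a $ b * torus_elt (\<chi> i. \<theta> $ p i) $ b $ b else 0)"
        unfolding mat_mult_nth by (intro sum.cong refl) (auto simp: torus_elt_nth)
      ultimately show ?thesis
        by (cases a; cases b) (auto simp: x_def torus_elt_nth)
    qed
    then show ?thesis by (simp add: vec_eq_iff)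
  qed
  then have "x ** torus_elt (\<chi> i. \<theta> $ p i) ** sig x = torus_elt \<theta> ** (x ** sig x)"
    by (simp add: matrix_mul_assoc)
  then have "torus_elt \<theta> = x ** torus_elt (\<chi> i. \<theta> $ p i) ** matrix_inv x"
    using USp_right(1)[OF x] USp_inv[OF x] by simp
  then show ?thesis
    using F x torus_elt_USp[of "\<chi> i. \<theta> $ p i"] unfolding central_on_def by simp
qed

section \<open>Uniqueness of solutions of the loop equations\<close>

text \<open>Zeros are excluded because \<open>psum 0\<close> is constant; this makes the set finite
  for each \<open>n\<close>. Lists that differ only in order are all kept, as they serve only to
  span.\<close>

definition idx :: "nat \<Rightarrow> nat list set" where
  "idx n = {ks. 0 \<notin> set ks \<and> sum_list ks \<le> n}"

lemma finite_idx: "finite (idx n)"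
proof (rule finite_subset)
  show "idx n \<subseteq> {ks. set ks \<subseteq> {..n} \<and> length ks \<le> n}"
  proof
    fix ks assume ks: "ks \<in> idx n"
    have "length ks \<le> sum_list ks"
    proof -
      have "0 \<notin> set ks" using ks by (simp add: idx_def)
      then show ?thesis
      proof (induction ks)
        case (Cons k ks)
        then have "length ks \<le> sum_list ks" "0 < k" by auto
        then show ?case by simp
      qed simp
    qed
    moreover have "k \<le> n" if "k \<in> set ks" for k
      using member_le_sum_list[OF that] ks by (simp add: idx_def)
    ultimately show "ks \<in> {ks. set ks \<subseteq> {..n} \<and> length ks \<le> n}"
      using ks by (auto simp: idx_def)
  qed
  show "finite {ks. set ks \<subseteq> {..n} \<and> length ks \<le> n}"
    by (rule finite_lists_length_le) simp
qed

text \<open>Polynomials in the power sums of weighted degree at most \<open>n\<close>, where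
  \<open>psum k\<close> has weight \<open>k\<close>.\<close>

definition mon_span :: "nat \<Rightarrow> (real ^ 'n::finite \<Rightarrow> real) \<Rightarrow> bool" where
  "mon_span n f \<longleftrightarrow> (\<exists>c. \<forall>t. f t = (\<Sum>ks\<in>idx n. c ks * mon ks t))"

lemma mon_span_cong: "mon_span n f \<Longrightarrow> (\<And>t. g t = f t) \<Longrightarrow> mon_span n g"
  by (simp add: mon_span_def)

lemma mon_span_add: "mon_span n f \<Longrightarrow> mon_span n g \<Longrightarrow> mon_span n (\<lambda>t. f t + g t)"
  unfolding mon_span_def
proof (elim exE)
  fix c d assume "\<forall>t. f t = (\<Sum>ks\<in>idx n. c ks * mon ks t)" "\<forall>t. g t = (\<Sum>ks\<in>idx n. d ks * mon ks t)"
  then show "\<exists>c. \<forall>t. f t + g t = (\<Sum>ks\<in>idx n. c ks * mon ks t)"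
    by (intro exI[of _ "\<lambda>ks. c ks + d ks"]) (simp add: distrib_right sum.distrib)
qed

lemma mon_span_cmult: "mon_span n f \<Longrightarrow> mon_span n (\<lambda>t. a * f t)"
  unfolding mon_span_def
proof (elim exE)
  fix c assume "\<forall>t. f t = (\<Sum>ks\<in>idx n. c ks * mon ks t)"
  then show "\<exists>c. \<forall>t. a * f t = (\<Sum>ks\<in>idx n. c ks * mon ks t)"
    by (intro exI[of _ "\<lambda>ks. a * c ks"]) (simp add: sum_distrib_left mult.assoc)
qed

lemma mon_span_0: "mon_span n (\<lambda>t. 0)"
  unfolding mon_span_def by (rule exI[of _ "\<lambda>_. 0"]) simp

lemma mon_span_sum: "(\<And>i. i \<in> I \<Longrightarrow> mon_span n (f i)) \<Longrightarrow> mon_span n (\<lambda>t. \<Sum>i\<in>I. f i t)"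
  by (induction I rule: infinite_finite_induct) (auto intro: mon_span_0 mon_span_add)

lemma mon_span_diff:
  assumes "mon_span n f" "mon_span n g"
  shows "mon_span n (\<lambda>t. f t - g t)"
  using mon_span_add[OF assms(1) mon_span_cmult[OF assms(2), of "-1"]] by simp

lemma psum_0: "psum 0 t = 2 * real CARD('n)" for t :: "real ^ 'n::finite"
  by (simp add: psum_def)

lemma mon_span_mon:
  assumes "sum_list ks \<le> n"
  shows "mon_span n (mon ks :: real ^ 'n::finite \<Rightarrow> real)"
proof -
  define m where "m = filter (\<lambda>k. k \<noteq> 0) ks"
  have "sum_list m = sum_list ks" unfolding m_def by (induction ks) auto
  then have m: "m \<in> idx n" using assms by (auto simp: idx_def m_def)
  \<comment> \<open>Each zero in the list contributes the constant \<open>psum 0 t\<close>, which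
    \<open>a\<close> absorbs.\<close>
  have "\<exists>a. \<forall>t :: real ^ 'n. mon ks t = a * mon m t"
    unfolding m_def
  proof (induction ks)
    case Nil
    show ?case by (rule exI[of _ 1]) simp
  next
    case (Cons k ks)
    then obtain a where "\<forall>t :: real ^ 'n. mon ks t = a * mon (filter (\<lambda>k. k \<noteq> 0) ks) t" by blast
    then show ?case
      by (cases "k = 0") (auto simp: psum_0 intro!: exI[of _ "2 * real CARD('n) * a"] exI[of _ a])
  qed
  then obtain a where a: "\<And>t :: real ^ 'n. mon ks t = a * mon m t" by blast
  have "mon_span n (\<lambda>t :: real ^ 'n. \<Sum>l\<in>idx n. (if l = m then 1 else 0) * mon l t)"
    unfolding mon_span_def by (rule exI[of _ "\<lambda>l. if l = m then 1 else 0"]) simp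
  then have "mon_span n (mon m :: real ^ 'n \<Rightarrow> real)"
    by (rule mon_span_cong) (use m in \<open>simp add: finite_idx if_distrib[where f="\<lambda>x. x * _"] cong: if_cong\<close>)
  from mon_span_cmult[OF this, of a] show ?thesis
    by (rule mon_span_cong) (rule a)
qed

lemma mon_span_mono:
  assumes "mon_span m f" "m \<le> n"
  shows "mon_span n f"
proof -
  obtain c where c: "\<And>t. f t = (\<Sum>ks\<in>idx m. c ks * mon ks t)" using assms by (auto simp: mon_span_def)
  have "mon_span n (\<lambda>t. \<Sum>ks\<in>idx m. c ks * mon ks t)"
    by (intro mon_span_sum mon_span_cmult mon_span_mon) (use assms(2) in \<open>auto simp: idx_def\<close>)
  then show ?thesis by (rule mon_span_cong) (rule c)
qed

lemma mon_span_mult: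
  assumes "mon_span m f" "mon_span n g"
  shows "mon_span (m + n) (\<lambda>t. f t * g t)"
proof -
  obtain c where c: "\<And>t. f t = (\<Sum>ks\<in>idx m. c ks * mon ks t)" using assms by (auto simp: mon_span_def)
  obtain d where d: "\<And>t. g t = (\<Sum>ks\<in>idx n. d ks * mon ks t)" using assms by (auto simp: mon_span_def)
  have "mon_span (m + n) (\<lambda>t. \<Sum>ks\<in>idx m. \<Sum>ls\<in>idx n. (c ks * d ls) * mon (ks @ ls) t)"
    by (intro mon_span_sum mon_span_cmult mon_span_mon) (auto simp: idx_def)
  then show ?thesis
    by (rule mon_span_cong) (simp add: c d sum_product mon_append mult_ac)
qed

lemma nd_le: "nd k l \<le> k + l" "l \<le> 2 * k \<Longrightarrow> nd k l \<le> k"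
  by (auto simp: nd_def)

lemma mon_span_psum: "k \<le> n \<Longrightarrow> mon_span n (psum k :: real ^ 'n::finite \<Rightarrow> real)"
  using mon_span_mon[of "[k]" n] by (simp add: mon_span_def)

lemma mon_span_Gam: "mon_span (k + sum_list ls) (Gam k ls :: real ^ 'n::finite \<Rightarrow> real)"
proof (induction ls)
  case Nil
  show ?case by (rule mon_span_cong[OF mon_span_0]) simp
next
  case (Cons l ls)
  have "mon_span ((k + l) + sum_list ls)
      (\<lambda>t :: real ^ 'n. (real l * (psum (nd k l) t - psum (k + l) t)) * mon ls t)"
    by (intro mon_span_mult mon_span_cmult mon_span_diff mon_span_psum mon_span_mon nd_le order_refl)
  moreover have "mon_span ((k + sum_list ls) + l) (\<lambda>t :: real ^ 'n. Gam k ls t * psum l t)"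
    by (intro mon_span_mult Cons mon_span_psum order_refl)
  ultimately have "mon_span (k + sum_list (l # ls))
      (\<lambda>t :: real ^ 'n. (real l * (psum (nd k l) t - psum (k + l) t)) * mon ls t + Gam k ls t * psum l t)"
    by (intro mon_span_add) (simp_all add: add_ac)
  then show ?case by (rule mon_span_cong) simp
qed

text \<open>The degree bound that lets the uniqueness argument run inside the finite-dimensional
  space of degree \<open>n\<close>.\<close>

lemma mon_span_loopf:
  assumes "k + sum_list ls \<le> n"
  shows "mon_span n (loopf k ls :: real ^ 'n::finite \<Rightarrow> real)"
proof -
  have "mon_span k (Lam k :: real ^ 'n \<Rightarrow> real)"
  proof -
    have "mon_span k (\<lambda>t :: real ^ 'n. \<Sum>j<k. mon [j, k - j] t + mon [nd k (2 * j)] t)"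
      by (intro mon_span_sum mon_span_add mon_span_mon) (auto simp: nd_def)
    then show ?thesis by (rule mon_span_cong) (simp add: Lam_def)
  qed
  then have "mon_span (k + sum_list ls) (\<lambda>t :: real ^ 'n. Lam k t * mon ls t - Gam k ls t)"
    by (intro mon_span_diff mon_span_mult mon_span_mon mon_span_Gam order_refl)
  then show ?thesis unfolding loopf_def[abs_def] by (rule mon_span_mono) (rule assms)
qed

lemma mon_span_continuous: "mon_span n f \<Longrightarrow> continuous_on S f"
proof -
  assume "mon_span n f"
  then obtain c where "f = (\<lambda>t. \<Sum>ks\<in>idx n. c ks * mon ks t)" by (auto simp: mon_span_def)
  then show ?thesis by (auto intro!: continuous_intros continuous_mon)
qed

lemma mon_span_has_partial:
  fixes f :: "real ^ 'n::finite \<Rightarrow> real"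
  assumes "mon_span n f"
  obtains f' :: "'n \<Rightarrow> real ^ 'n \<Rightarrow> real" where "\<And>i t. has_partial f i (f' i t) t" "\<And>i S. continuous_on S (f' i)"
    "\<exists>c. \<forall>i t. f' i t = (\<Sum>ks\<in>idx n. c ks * dmon i ks t)"
proof -
  obtain c where f: "f = (\<lambda>t. \<Sum>ks\<in>idx n. c ks * mon ks t)" using assms by (auto simp: mon_span_def)
  define f' where "f' i t = (\<Sum>ks\<in>idx n. c ks * dmon i ks t)" for i :: 'n and t
  show thesis
  proof (rule that)
    show "has_partial f i (f' i t) t" for i t
      unfolding f f'_def
    proof (rule has_partial_sum)
      fix ks show "has_partial (\<lambda>t. c ks * mon ks t) i (c ks * dmon i ks t) t"
        using has_partial_mult[OF has_partial_const[of "c ks" i t] has_partial_mon[of ks i t]] by (simp add: mult.commute)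
    qed
    show "continuous_on S (f' i)" for i S
      unfolding f'_def by (intro continuous_intros continuous_dmon)
    show "\<exists>c. \<forall>i t. f' i t = (\<Sum>ks\<in>idx n. c ks * dmon i ks t)" by (auto simp: f'_def)
  qed
qed

section \<open>The inner product with the Weyl density\<close>

definition weyl_ip :: "(real ^ 'n::{finite,linorder} \<Rightarrow> real) \<Rightarrow> (real ^ 'n::_ \<Rightarrow> real) \<Rightarrow> real" where
  "weyl_ip f g = weyl_int (\<lambda>t. f t * g t)"

lemma weyl_ip_commute: "weyl_ip f g = weyl_ip g f"
  by (simp add: weyl_ip_def mult.commute)

lemma weyl_ip_add_scale:
  assumes "continuous_on UNIV f" "continuous_on UNIV g" "continuous_on UNIV h"
  shows "weyl_ip (\<lambda>t. f t + s * g t) h = weyl_ip f h + s * weyl_ip g h"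
proof -
  have "weyl_ip (\<lambda>t. f t + s * g t) h = weyl_int (\<lambda>t. f t * h t + s * (g t * h t))"
    by (simp add: weyl_ip_def distrib_right mult.assoc)
  also have "\<dots> = weyl_ip f h + weyl_int (\<lambda>t. s * (g t * h t))"
    unfolding weyl_ip_def by (intro weyl_int_add continuous_intros assms)
  finally show ?thesis by (simp add: weyl_int_cmult weyl_ip_def)
qed

lemma weyl_ip_sum:
  assumes "\<And>i. i \<in> I \<Longrightarrow> continuous_on UNIV (g i)" "continuous_on UNIV h"
  shows "weyl_ip (\<lambda>t. \<Sum>i\<in>I. c i * g i t) h = (\<Sum>i\<in>I. c i * weyl_ip (g i) h)"
proof -
  have "weyl_ip (\<lambda>t. \<Sum>i\<in>I. c i * g i t) h = weyl_int (\<lambda>t. \<Sum>i\<in>I. c i * (g i t * h t))"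
    by (simp add: weyl_ip_def sum_distrib_right mult.assoc)
  also have "\<dots> = (\<Sum>i\<in>I. weyl_int (\<lambda>t. c i * (g i t * h t)))"
    by (intro weyl_int_sum continuous_intros assms) auto
  finally show ?thesis by (simp add: weyl_int_cmult weyl_ip_def)
qed

lemma weyl_ip_nonneg: "0 \<le> weyl_ip f f"
  unfolding weyl_ip_def weyl_int_def by (intro integral_nonneg_AE) (simp add: weyl_w_nonneg)

text \<open>The form is only semidefinite, as it does not see values outside the cube; a function of
  norm zero is nevertheless orthogonal to everything, by the argument of \<open>psd_kernel\<close>.
  This covers the degenerate case in \<open>ex_projection\<close>.\<close>

lemma weyl_ip_null:
  assumes c: "continuous_on UNIV b" "continuous_on UNIV y" and b: "weyl_ip b b = 0"
  shows "weyl_ip y b = 0"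
proof (rule ccontr)
  assume ne: "weyl_ip y b \<noteq> 0"
  have exp: "weyl_ip (\<lambda>t. y t + s * b t) (\<lambda>t. y t + s * b t) = weyl_ip y y + 2 * s * weyl_ip y b" for s
  proof -
    have cs: "continuous_on UNIV (\<lambda>t. y t + s * b t)" by (intro continuous_intros c)
    have "weyl_ip (\<lambda>t. y t + s * b t) (\<lambda>t. y t + s * b t) =
        weyl_ip y (\<lambda>t. y t + s * b t) + s * weyl_ip b (\<lambda>t. y t + s * b t)"
      by (rule weyl_ip_add_scale[OF c(2,1) cs])
    also have "weyl_ip y (\<lambda>t. y t + s * b t) = weyl_ip y y + s * weyl_ip b y"
      by (subst weyl_ip_commute) (rule weyl_ip_add_scale[OF c(2,1,2)])
    also have "weyl_ip b (\<lambda>t. y t + s * b t) = weyl_ip y b + s * weyl_ip b b"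
      by (subst weyl_ip_commute) (rule weyl_ip_add_scale[OF c(2,1,1)])
    finally show ?thesis using b by (simp add: weyl_ip_commute[of b y])
  qed
  define s where "s = - (weyl_ip y y + 1) / (2 * weyl_ip y b)"
  have "2 * s * weyl_ip y b = - (weyl_ip y y + 1)" using ne by (simp add: s_def)
  then show False using weyl_ip_nonneg[of "\<lambda>t. y t + s * b t"] unfolding exp by simp
qed

text \<open>Gram-Schmidt; if the new vector is degenerate, the division by zero gives the coefficient 0.\<close>

lemma ex_projection:
  fixes b :: "'j \<Rightarrow> real ^ 'n::{finite,linorder} \<Rightarrow> real"
  assumes "finite J" and cb: "\<And>j. continuous_on UNIV (b j)" and cv: "continuous_on UNIV v"
  shows "\<exists>c. \<forall>i\<in>J. weyl_ip (\<lambda>t. v t - (\<Sum>j\<in>J. c j * b j t)) (b i) = 0"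
  using assms(1) cv
proof (induction J arbitrary: v rule: finite_induct)
  case (insert a J)
  obtain c where c: "\<forall>i\<in>J. weyl_ip (\<lambda>t. b a t - (\<Sum>j\<in>J. c j * b j t)) (b i) = 0"
    using insert.IH[OF cb] by blast
  obtain d where d: "\<forall>i\<in>J. weyl_ip (\<lambda>t. v t - (\<Sum>j\<in>J. d j * b j t)) (b i) = 0"
    using insert.IH[OF insert.prems] by blast
  define b' where "b' t = b a t - (\<Sum>j\<in>J. c j * b j t)" for t
  define v' where "v' t = v t - (\<Sum>j\<in>J. d j * b j t)" for t
  have cb': "continuous_on UNIV b'" unfolding b'_def by (intro continuous_intros cb)
  have cv': "continuous_on UNIV v'" unfolding v'_def by (intro continuous_intros cb insert.prems)
  have orth: "weyl_ip u (b a) = weyl_ip u b'" if "continuous_on UNIV u" "\<forall>i\<in>J. weyl_ip u (b i) = 0" for u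
  proof -
    have "weyl_ip (\<lambda>t. b' t + 1 * (\<Sum>j\<in>J. c j * b j t)) u = weyl_ip b' u + 1 * weyl_ip (\<lambda>t. \<Sum>j\<in>J. c j * b j t) u"
      by (intro weyl_ip_add_scale cb' that continuous_intros cb)
    also have "weyl_ip (\<lambda>t. \<Sum>j\<in>J. c j * b j t) u = (\<Sum>j\<in>J. c j * weyl_ip (b j) u)"
      by (intro weyl_ip_sum cb that)
    also have "\<dots> = 0" using that(2) by (simp add: weyl_ip_commute[of _ u])
    also have "(\<lambda>t. b' t + 1 * (\<Sum>j\<in>J. c j * b j t)) = b a" by (auto simp: b'_def)
    finally show ?thesis by (simp add: weyl_ip_commute[of u])
  qed
  define s where "s = weyl_ip v' b' / weyl_ip b' b'"
  have s: "weyl_ip v' b' = s * weyl_ip b' b'"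
    using weyl_ip_null[OF cb' cv'] by (simp add: s_def)
  define u where "u t = v' t + (- s) * b' t" for t
  have cu: "continuous_on UNIV u" unfolding u_def by (intro continuous_intros cv' cb')
  have uJ: "weyl_ip u (b i) = 0" if "i \<in> J" for i
  proof -
    have "weyl_ip u (b i) = weyl_ip v' (b i) + (- s) * weyl_ip b' (b i)"
      unfolding u_def by (intro weyl_ip_add_scale cv' cb' cb)
    then show ?thesis using c d that by (simp add: b'_def[abs_def] v'_def[abs_def])
  qed
  have "weyl_ip u (b a) = weyl_ip u b'" using uJ by (intro orth cu) simp
  also have "\<dots> = weyl_ip v' b' + (- s) * weyl_ip b' b'"
    unfolding u_def by (intro weyl_ip_add_scale cv' cb')
  also have "\<dots> = 0" using s by simp
  finally have ua: "weyl_ip u (b a) = 0" .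
  define e where "e j = (if j = a then s else d j - s * c j)" for j
  have "u = (\<lambda>t. v t - (\<Sum>j\<in>insert a J. e j * b j t))"
  proof
    fix t
    have "(\<Sum>j\<in>J. e j * b j t) = (\<Sum>j\<in>J. d j * b j t) - s * (\<Sum>j\<in>J. c j * b j t)"
      unfolding sum_distrib_left sum_subtractf[symmetric]
      using insert(2) by (intro sum.cong refl) (auto simp: e_def algebra_simps)
    then show "u t = v t - (\<Sum>j\<in>insert a J. e j * b j t)"
      using insert(1,2) by (simp add: u_def v'_def b'_def e_def algebra_simps)
  qed
  then show ?case using ua uJ by auto
qed simp

text \<open>The integrand of the Dirichlet form. Its arguments are families of partial derivatives,
  so that explicit formulas such as \<open>dmon\<close> can be inserted.\<close>

definition grad_form :: "('n::finite \<Rightarrow> real ^ 'n \<Rightarrow> real) \<Rightarrow> ('n \<Rightarrow> real ^ 'n \<Rightarrow> real) \<Rightarrow> real ^ 'n \<Rightarrow> real" where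
  "grad_form f g t = (\<Sum>i\<in>UNIV. (4 - (t $ i)\<^sup>2) * f i t * g i t)"

text \<open>Leibniz rule: the gradient of a monomial is a sum, over its factors
  \<open>psum k\<close>, of the remaining monomial times the gradient of \<open>psum k\<close>, and
  \<open>orth\<close> disposes of each term. The prefix \<open>pre\<close> collects the factors
  already passed.\<close>

lemma weyl_grad_form_dmon:
  fixes z' :: "'n \<Rightarrow> real ^ 'n::{finite,linorder} \<Rightarrow> real"
  assumes cz: "\<And>i. continuous_on UNIV (z' i)"
    and orth: "\<And>us k vs. ks = us @ k # vs \<Longrightarrow>
      weyl_int (\<lambda>t. mon (pre @ us @ vs) t * (\<Sum>i\<in>UNIV. aux_a k (t $ i) * z' i t)) = 0"
  shows "weyl_int (\<lambda>t. mon pre t * grad_form (\<lambda>i. dmon i ks) z' t) = 0"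
  using orth
proof (induction ks arbitrary: pre)
  case Nil
  show ?case by (simp add: grad_form_def weyl_int_def)
next
  case (Cons k ks)
  have cg: "continuous_on UNIV (grad_form (\<lambda>i. dmon i ks) z')"
    unfolding grad_form_def by (intro continuous_intros cz continuous_dmon)
  have ca: "continuous_on UNIV (\<lambda>t. \<Sum>i\<in>UNIV. aux_a k (t $ i) * z' i t)"
    by (intro continuous_intros cz continuous_on_compose2[OF continuous_aux_a[of UNIV]]) auto
  have e: "mon pre t * grad_form (\<lambda>i. dmon i (k # ks)) z' t =
      mon (pre @ ks) t * (\<Sum>i\<in>UNIV. aux_a k (t $ i) * z' i t) +
      mon (pre @ [k]) t * grad_form (\<lambda>i. dmon i ks) z' t" for t
  proof -
    have "grad_form (\<lambda>i. dmon i (k # ks)) z' t =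
        mon ks t * (\<Sum>i\<in>UNIV. aux_a k (t $ i) * z' i t) + psum k t * grad_form (\<lambda>i. dmon i ks) z' t"
      unfolding grad_form_def aux_a_def sum_distrib_left sum.distrib[symmetric]
      by (intro sum.cong refl) (simp add: algebra_simps)
    then show ?thesis by (simp add: mon_append algebra_simps)
  qed
  have "weyl_int (\<lambda>t. mon pre t * grad_form (\<lambda>i. dmon i (k # ks)) z' t) =
      weyl_int (\<lambda>t. mon (pre @ ks) t * (\<Sum>i\<in>UNIV. aux_a k (t $ i) * z' i t)) +
      weyl_int (\<lambda>t. mon (pre @ [k]) t * grad_form (\<lambda>i. dmon i ks) z' t)"
    unfolding e by (intro weyl_int_add continuous_intros continuous_mon cg ca)
  also have "weyl_int (\<lambda>t. mon (pre @ ks) t * (\<Sum>i\<in>UNIV. aux_a k (t $ i) * z' i t)) = 0"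
    using Cons.prems[of "[]" k ks] by simp
  also have "weyl_int (\<lambda>t. mon (pre @ [k]) t * grad_form (\<lambda>i. dmon i ks) z' t) = 0"
    by (rule Cons.IH) (use Cons.prems[of "k # _"] in simp)
  finally show ?case by simp
qed

text \<open>The weighted integrand is continuous and nonnegative, so it vanishes identically. In the
  open box the weight is positive off the null set \<open>vdm t = 0\<close>, and an open set
  contained in a null set is empty.\<close>

lemma weyl_int_grad_form_eq_0:
  fixes z' :: "'n \<Rightarrow> real ^ 'n::{finite,linorder} \<Rightarrow> real"
  assumes cz: "\<And>i. continuous_on UNIV (z' i)"
    and z0: "weyl_int (grad_form z' z') = 0" and t: "t \<in> box (\<chi> i. -2) (\<chi> i. 2)"
  shows "z' i t = 0"
proof -
  have nn: "0 \<le> weyl_w t * grad_form z' z' t" for t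
  proof (cases "t \<in> cube")
    case True
    have "0 \<le> (4 - (t $ j)\<^sup>2) * z' j t * z' j t" for j
    proof -
      have "0 \<le> 4 - (t $ j)\<^sup>2"
        using True abs_le_square_iff[of "t $ j" 2] by (auto simp: cube_def abs_le_iff minus_le_iff)
      then show ?thesis by (simp add: mult.assoc)
    qed
    then have "0 \<le> grad_form z' z' t" unfolding grad_form_def by (intro sum_nonneg)
    then show ?thesis by (simp add: weyl_w_nonneg)
  qed (simp add: weyl_w_eq_0)
  have cg: "continuous_on UNIV (grad_form z' z')"
    unfolding grad_form_def by (intro continuous_intros cz)
  have open0: "open {t. weyl_w t * grad_form z' z' t \<noteq> 0}"
    by (intro open_Collect_neq continuous_intros continuous_weyl_w cg)
  have "AE t in lborel. weyl_w t * grad_form z' z' t = 0"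
    using z0 integral_nonneg_eq_0_iff_AE[OF integrable_weyl[OF cg]] nn by (simp add: weyl_int_def)
  then have "{t. weyl_w t * grad_form z' z' t \<noteq> 0} \<in> null_sets lborel"
    using AE_iff_null_sets[of "{t. weyl_w t * grad_form z' z' t \<noteq> 0}" lborel] open0 by (simp add: borel_open)
  then have "negligible {t. weyl_w t * grad_form z' z' t \<noteq> 0}"
    unfolding negligible_iff_null_sets by (rule null_sets_completionI)
  then have all0: "weyl_w t * grad_form z' z' t = 0" for t
    using open_not_negligible[OF open0] by blast
  let ?I = "box (\<chi> i. -2) (\<chi> i. 2) :: (real ^ 'n::_) set"
  have "{t \<in> ?I. z' i t \<noteq> 0} \<subseteq> {t. vdm t = 0}"
  proof
    fix t assume t: "t \<in> {t \<in> ?I. z' i t \<noteq> 0}"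
    have lt: "-2 < t $ j \<and> t $ j < 2" for j using t by (auto simp: mem_box_cart)
    have pos: "0 < 4 - (t $ j)\<^sup>2" for j
      using lt[of j] abs_square_less_1[of "t $ j / 2"] by (simp add: power_divide abs_less_iff)
    have "grad_form z' z' t > 0"
      unfolding grad_form_def
    proof (rule sum_pos2[of UNIV i])
      show "0 < (4 - (t $ i)\<^sup>2) * z' i t * z' i t"
        using pos[of i] t by (simp add: mult.assoc zero_less_mult_iff) (metis linorder_neqE_linordered_idom)
      show "0 \<le> (4 - (t $ j)\<^sup>2) * z' j t * z' j t" for j
        using pos[of j] by (simp add: mult.assoc)
    qed auto
    then have "weyl_w t = 0" using all0[of t] by simp
    moreover have "arc (t $ j) \<noteq> 0" for j using lt[of j] by (simp add: arc_eq_0_iff)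
    ultimately show "t \<in> {t. vdm t = 0}" by (simp add: weyl_w_def)
  qed
  then have neg: "negligible {t \<in> ?I. z' i t \<noteq> 0}"
    using negligible_vdm negligible_subset by blast
  have "open {t \<in> ?I. z' i t \<noteq> 0}"
    unfolding Collect_conj_eq by (intro open_Int open_Collect_neq cz continuous_intros) (simp add: open_box)
  then have "{t \<in> ?I. z' i t \<noteq> 0} = {}" using open_not_negligible neg by blast
  then show ?thesis using t by blast
qed

text \<open>Coordinates are changed one at a time; in the induction \<open>A\<close> is the set of
  those where the two points may still differ.\<close>

lemma constant_on_box:
  fixes z :: "real ^ 'n::finite \<Rightarrow> real"
  assumes part: "\<And>i t. has_partial z i (z' i t) t"
    and zero: "\<And>i t. t \<in> box (\<chi> i. -2) (\<chi> i. 2) \<Longrightarrow> z' i t = 0"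
    and xy: "x \<in> box (\<chi> i. -2) (\<chi> i. 2)" "y \<in> box (\<chi> i. -2) (\<chi> i. 2)"
  shows "z x = z y"
proof -
  let ?I = "box (\<chi> i. -2) (\<chi> i. 2) :: (real ^ 'n::_) set"
  have "\<forall>x y. x \<in> ?I \<longrightarrow> y \<in> ?I \<longrightarrow> (\<forall>i. i \<notin> A \<longrightarrow> x $ i = y $ i) \<longrightarrow> z x = z y" if "finite A" for A :: "'n set"
    using that
  proof (induction A rule: finite_induct)
    case empty
    show ?case
    proof (intro allI impI)
      fix x y :: "real ^ 'n" assume "\<forall>i. i \<notin> {} \<longrightarrow> x $ i = y $ i"
      then have "x = y" by (simp add: vec_eq_iff)
      then show "z x = z y" by simp
    qed
  next
    case (insert a A)
    show ?case
    proof (intro allI impI)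
      fix x y :: "real ^ 'n" assume x: "x \<in> ?I" and y: "y \<in> ?I" and eq: "\<forall>i. i \<notin> insert a A \<longrightarrow> x $ i = y $ i"
      let ?f = "\<lambda>h. x + h *\<^sub>R axis a 1"
      define d where "d = y $ a - x $ a"
      have inI: "?f h \<in> ?I \<longleftrightarrow> -2 - x $ a < h \<and> h < 2 - x $ a" for h
      proof -
        have "?f h \<in> ?I \<longleftrightarrow> (\<forall>i. -2 < x $ i + h * axis a 1 $ i \<and> x $ i + h * axis a 1 $ i < 2)"
          by (simp add: mem_box_cart)
        also have "\<dots> \<longleftrightarrow> -2 < x $ a + h \<and> x $ a + h < 2"
          using x by (auto simp: axis_def mem_box_cart)
        finally show ?thesis by auto
      qed
      have "\<exists>c. \<forall>h\<in>{-2 - x $ a<..<2 - x $ a}. z (?f h) = c"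
      proof (rule has_field_derivative_zero_constant)
        fix h assume "h \<in> {-2 - x $ a<..<2 - x $ a}"
        then have "?f h \<in> ?I" by (simp add: inI)
        then show "((\<lambda>h. z (?f h)) has_field_derivative 0) (at h within {-2 - x $ a<..<2 - x $ a})"
          using has_partial_shift[of z a "z' a (?f h)" x h, OF part] zero by (auto intro: has_field_derivative_at_within)
      qed (simp add: convex_real_interval)
      moreover have "0 \<in> {-2 - x $ a<..<2 - x $ a}" "d \<in> {-2 - x $ a<..<2 - x $ a}"
        using x y by (auto simp: mem_box_cart d_def)
      ultimately have "z (?f 0) = z (?f d)" by metis
      moreover have "z (?f d) = z y"
      proof -
        have "?f d \<in> ?I" using \<open>d \<in> _\<close> by (simp add: inI)
        moreover have "\<forall>i. i \<notin> A \<longrightarrow> ?f d $ i = y $ i"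
          using eq by (auto simp: axis_def d_def)
        ultimately show ?thesis using insert.IH y by blast
      qed
      ultimately show "z x = z y" by simp
    qed
  qed
  from this[of UNIV, OF finite, rule_format, OF xy] show ?thesis by blast
qed

text \<open>By \<open>weyl_loop_mult\<close> the hypothesis annihilates the pairing of the gradient
  of \<open>z\<close> with \<open>mon ls\<close> times the gradient of \<open>psum k\<close>. The
  gradient of \<open>z\<close> is itself a combination of such products, so its Dirichlet energy is
  zero; continuity passes from the open box to the cube.\<close>

lemma orthogonal_imp_constant:
  fixes z :: "real ^ 'n::{finite,linorder} \<Rightarrow> real"
  assumes z: "mon_span n z"
    and orth: "\<And>k ls. k > 0 \<Longrightarrow> ls \<in> idx n \<Longrightarrow> k + sum_list ls \<le> n \<Longrightarrow> weyl_ip z (loopf k ls) = 0"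
  shows "\<exists>a. \<forall>t\<in>cube. z t = a"
proof -
  obtain z' where part: "\<And>i t. has_partial z i (z' i t) t" and cz: "\<And>i S. continuous_on S (z' i)"
    and "\<exists>c. \<forall>i t. z' i t = (\<Sum>ks\<in>idx n. c ks * dmon i ks t)"
    using mon_span_has_partial[OF z] by blast
  then obtain c where c: "\<And>i t. z' i t = (\<Sum>ks\<in>idx n. c ks * dmon i ks t)" by blast
  have cont: "continuous_on S z" for S by (rule mon_span_continuous[OF z])
  have 0: "weyl_int (grad_form (\<lambda>i. dmon i ks) z') = 0" if "ks \<in> idx n" for ks
  proof -
    have "weyl_int (\<lambda>t. mon [] t * grad_form (\<lambda>i. dmon i ks) z' t) = 0"
    proof (rule weyl_grad_form_dmon[OF cz])
      fix us k vs assume ks: "ks = us @ k # vs"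
      have "k > 0" "us @ vs \<in> idx n" "k + sum_list (us @ vs) \<le> n"
        using that by (auto simp: ks idx_def)
      then have "weyl_ip z (loopf k (us @ vs)) = 0" by (rule orth)
      then show "weyl_int (\<lambda>t. mon ([] @ us @ vs) t * (\<Sum>i\<in>UNIV. aux_a k (t $ i) * z' i t)) = 0"
        using weyl_loop_mult[OF cont cz part, of k "us @ vs"] by (simp add: weyl_ip_def)
    qed
    then show ?thesis by simp
  qed
  have "grad_form z' z' t = (\<Sum>ks\<in>idx n. c ks * grad_form (\<lambda>i. dmon i ks) z' t)" for t
  proof -
    have "grad_form z' z' t = (\<Sum>i\<in>UNIV. \<Sum>ks\<in>idx n. c ks * ((4 - (t $ i)\<^sup>2) * dmon i ks t * z' i t))"
      unfolding grad_form_def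
      by (intro sum.cong refl, subst (1) c) (simp add: sum_distrib_left sum_distrib_right mult_ac)
    also have "\<dots> = (\<Sum>ks\<in>idx n. c ks * grad_form (\<lambda>i. dmon i ks) z' t)"
      unfolding grad_form_def sum_distrib_left by (rule sum.swap)
    finally show ?thesis .
  qed
  then have "weyl_int (grad_form z' z') = weyl_int (\<lambda>t. \<Sum>ks\<in>idx n. c ks * grad_form (\<lambda>i. dmon i ks) z' t)"
    by (intro weyl_int_cong)
  also have "\<dots> = (\<Sum>ks\<in>idx n. weyl_int (\<lambda>t. c ks * grad_form (\<lambda>i. dmon i ks) z' t))"
    unfolding grad_form_def by (intro weyl_int_sum continuous_intros cz continuous_dmon)
  also have "\<dots> = 0" using 0 by (simp add: weyl_int_cmult)
  finally have g0: "weyl_int (grad_form z' z') = 0" .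
  let ?I = "box (\<chi> i. -2) (\<chi> i. 2) :: (real ^ 'n::_) set"
  have "0 \<in> ?I" by (simp add: mem_box_cart)
  have "z t = z 0" if "t \<in> ?I" for t
    by (rule constant_on_box[OF part weyl_int_grad_form_eq_0[OF cz g0] that \<open>0 \<in> ?I\<close>])
  moreover have "closure ?I = cube"
    unfolding cube_eq_cbox using \<open>0 \<in> ?I\<close> by (intro closure_box) blast
  ultimately have "z t = z 0" if "t \<in> cube" for t
    using continuous_constant_on_closure[OF cont, of ?I "z 0" t] that by simp
  then show ?thesis by blast
qed

text \<open>After a multiple of 1 is subtracted, \<open>v\<close> is made orthogonal to the loop
  expressions by subtracting a combination of them; the remainder is constant on the cube. As
  \<open>weyl_int\<close> vanishes on \<open>v0\<close> and on loop expressions, the constant is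
  zero, so on the cube \<open>v\<close> is \<open>\<kappa>\<close> plus loop expressions, which
  \<open>E\<close> annihilates.\<close>

lemma loop_functional_unique:
  fixes E :: "(real ^ 'n::{finite,linorder} \<Rightarrow> real) \<Rightarrow> real"
  assumes lin: "\<And>(J :: (nat \<times> nat list) option set) c f. finite J \<Longrightarrow> (\<And>j. j \<in> J \<Longrightarrow> \<exists>m. mon_span m (f j)) \<Longrightarrow>
      E (\<lambda>t. \<Sum>j\<in>J. c j * f j t) = (\<Sum>j\<in>J. c j * E (f j))"
    and cong: "\<And>f g. (\<And>t. t \<in> cube \<Longrightarrow> f t = g t) \<Longrightarrow> E f = E g"
    and one: "E (\<lambda>_. 1) = 1"
    and loop: "\<And>k ls. E (loopf k ls) = 0"
    and v: "mon_span n v"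
  shows "E v * weyl_int (\<lambda>_ :: real ^ 'n::_. 1) = weyl_int v"
proof -
  let ?w = "weyl_int (\<lambda>_ :: real ^ 'n::_. 1)"
  have w: "?w > 0" by (simp add: weyl_int_1)
  have span1: "mon_span n (\<lambda>_ :: real ^ 'n::_. 1)"
    using mon_span_mon[of "[]" n] by (simp add: mon_span_def)
  define \<kappa> where "\<kappa> = weyl_int v / ?w"
  define v0 where "v0 t = v t - \<kappa> * 1" for t
  have v0: "mon_span n v0" unfolding v0_def by (intro mon_span_diff mon_span_cmult v span1)
  define J where "J = {(k, ls). 0 < k \<and> ls \<in> idx n \<and> k + sum_list ls \<le> n}"
  have "finite J"
    by (rule finite_subset[of _ "{..n} \<times> idx n"]) (auto simp: J_def finite_idx)
  define b :: "nat \<times> nat list \<Rightarrow> real ^ 'n::_ \<Rightarrow> real" where "b j = loopf (fst j) (snd j)" for j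
  have bspan: "mon_span n (b j :: real ^ 'n::_ \<Rightarrow> real)" if "j \<in> J" for j
    using that unfolding b_def J_def by (intro mon_span_loopf) auto
  have bcont: "continuous_on S (b j)" for j S unfolding b_def by (rule continuous_loopf)
  obtain c where c: "\<forall>i\<in>J. weyl_ip (\<lambda>t. v0 t - (\<Sum>j\<in>J. c j * b j t)) (b i) = 0"
    using ex_projection[of J b v0, OF \<open>finite J\<close> bcont mon_span_continuous[OF v0]] by blast
  define z where "z t = v0 t - (\<Sum>j\<in>J. c j * b j t)" for t
  have zspan: "mon_span n z"
    unfolding z_def by (intro mon_span_diff v0 mon_span_sum mon_span_cmult bspan)
  have "\<exists>a. \<forall>t\<in>cube. z t = a"
  proof (rule orthogonal_imp_constant[OF zspan])
    fix k ls assume "k > 0" "ls \<in> idx n" "k + sum_list ls \<le> n"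
    then have "(k, ls) \<in> J" by (simp add: J_def)
    then have "weyl_ip z (b (k, ls)) = 0" using c unfolding z_def[abs_def] by blast
    then show "weyl_ip z (loopf k ls) = 0" by (simp add: b_def)
  qed
  then obtain a where a: "\<And>t. t \<in> cube \<Longrightarrow> z t = a" by blast
  have wb: "weyl_int (b j) = 0" if "j \<in> J" for j
  proof -
    have "real (fst j) * weyl_int (\<lambda>t :: real ^ 'n::_. 1 * loopf (fst j) (snd j) t) =
        weyl_int (\<lambda>t :: real ^ 'n::_. mon (snd j) t * (\<Sum>i\<in>UNIV. aux_a (fst j) (t $ i) * 0))"
      by (rule weyl_loop_mult[where f = "\<lambda>_. 1" and f' = "\<lambda>_ _. 0"]) (auto simp: has_partial_const)
    also have "\<dots> = 0" by (simp add: weyl_int_def)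
    finally show ?thesis using that by (auto simp: J_def b_def)
  qed
  have wv0: "weyl_int v0 = 0"
  proof -
    have "weyl_int (\<lambda>t. v t + (- \<kappa>) * 1) = weyl_int v + weyl_int (\<lambda>t :: real ^ 'n::_. (- \<kappa>) * 1)"
      by (intro weyl_int_add mon_span_continuous[OF v] continuous_intros)
    also have "weyl_int (\<lambda>t :: real ^ 'n::_. (- \<kappa>) * 1) = - \<kappa> * ?w" by (rule weyl_int_cmult)
    finally show ?thesis using w by (simp add: v0_def[abs_def] \<kappa>_def)
  qed
  have "weyl_int v0 = weyl_int (\<lambda>t. a * 1 + (\<Sum>j\<in>J. c j * b j t))"
    by (rule weyl_int_cong) (simp add: a[symmetric] z_def)
  also have "\<dots> = weyl_int (\<lambda>t :: real ^ 'n::_. a * 1) + weyl_int (\<lambda>t. \<Sum>j\<in>J. c j * b j t)"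
    by (intro weyl_int_add continuous_intros bcont)
  also have "weyl_int (\<lambda>t :: real ^ 'n::_. a * 1) = a * ?w" by (rule weyl_int_cmult)
  also have "weyl_int (\<lambda>t. \<Sum>j\<in>J. c j * b j t) = (\<Sum>j\<in>J. weyl_int (\<lambda>t. c j * b j t))"
    by (intro weyl_int_sum continuous_intros bcont)
  also have "\<dots> = 0" by (simp add: weyl_int_cmult wb)
  finally have "a = 0" using wv0 w by simp
  \<comment> \<open>\<open>None\<close> indexes the constant function and \<open>Some j\<close> the
    loop expression \<open>b j\<close>; hence the type \<open>option\<close> in the assumption
    \<open>lin\<close>.\<close>
  have "E v = E (\<lambda>t. \<Sum>j\<in>insert None (Some ` J).
      (case j of None \<Rightarrow> \<kappa> | Some j \<Rightarrow> c j) * (case j of None \<Rightarrow> \<lambda>_. 1 | Some j \<Rightarrow> b j) t)"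
  proof (rule cong)
    fix t :: "real ^ 'n::_" assume "t \<in> cube"
    then have "v t = \<kappa> + (\<Sum>j\<in>J. c j * b j t)" using a[of t] \<open>a = 0\<close> by (simp add: z_def v0_def)
    then show "v t = (\<Sum>j\<in>insert None (Some ` J).
      (case j of None \<Rightarrow> \<kappa> | Some j \<Rightarrow> c j) * (case j of None \<Rightarrow> \<lambda>_. 1 | Some j \<Rightarrow> b j) t)"
      using \<open>finite J\<close> by (simp add: sum.reindex)
  qed
  also have "\<dots> = (\<Sum>j\<in>insert None (Some ` J).
      (case j of None \<Rightarrow> \<kappa> | Some j \<Rightarrow> c j) * E (case j of None \<Rightarrow> \<lambda>_. 1 | Some j \<Rightarrow> b j))"
    using \<open>finite J\<close> span1 bspan by (intro lin) (auto split: option.splits)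
  also have "\<dots> = \<kappa>"
    using \<open>finite J\<close> by (simp add: sum.reindex one b_def loop)
  finally show ?thesis using w by (simp add: \<kappa>_def)
qed

text \<open>Multiplication by \<open>x\<close> shifts the index of \<open>tau\<close> by one in both
  directions, so the induction on \<open>m\<close> has to run for all \<open>k\<close>. The case
  \<open>k = 0\<close> gives twice the ordinary power sums.\<close>

lemma ex_mon_span_power_sum:
  "\<exists>n. mon_span n (\<lambda>t :: real ^ 'n::finite. \<Sum>j\<in>UNIV. (t $ j) ^ m * tau k (t $ j))"
proof (induction m arbitrary: k)
  case 0
  then show ?case using mon_span_psum[of k k] by (auto simp: psum_def[abs_def])
next
  case (Suc m)
  have x: "x * tau k x = tau (Suc k) x + tau (nd k 1) x" for x
    by (cases k) (auto simp: nd_def)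
  obtain a b where "mon_span a (\<lambda>t :: real ^ 'n. \<Sum>j\<in>UNIV. (t $ j) ^ m * tau (Suc k) (t $ j))"
    "mon_span b (\<lambda>t :: real ^ 'n. \<Sum>j\<in>UNIV. (t $ j) ^ m * tau (nd k 1) (t $ j))"
    using Suc by blast
  then have "mon_span (max a b) (\<lambda>t :: real ^ 'n. (\<Sum>j\<in>UNIV. (t $ j) ^ m * tau (Suc k) (t $ j)) +
      (\<Sum>j\<in>UNIV. (t $ j) ^ m * tau (nd k 1) (t $ j)))"
    by (intro mon_span_add) (auto elim: mon_span_mono)
  then have "mon_span (max a b) (\<lambda>t :: real ^ 'n. \<Sum>j\<in>UNIV. (t $ j) ^ Suc m * tau k (t $ j))"
  proof (rule mon_span_cong)
    fix t :: "real ^ 'n"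
    have "y ^ Suc m * tau k y = y ^ m * tau (Suc k) y + y ^ m * tau (nd k 1) y" for y
      by (simp only: power_Suc2 mult.assoc x distrib_left)
    then show "(\<Sum>j\<in>UNIV. (t $ j) ^ Suc m * tau k (t $ j)) =
        (\<Sum>j\<in>UNIV. (t $ j) ^ m * tau (Suc k) (t $ j)) + (\<Sum>j\<in>UNIV. (t $ j) ^ m * tau (nd k 1) (t $ j))"
      by (simp only: sum.distrib)
  qed
  then show ?case by blast
qed

section \<open>Polynomials in the Viete coordinates as polynomials in the power sums\<close>

definition poly_span :: "(real ^ 'n::finite \<Rightarrow> real) \<Rightarrow> bool" where
  "poly_span f \<longleftrightarrow> (\<exists>n. mon_span n f)"

lemma poly_span_add: "poly_span f \<Longrightarrow> poly_span g \<Longrightarrow> poly_span (\<lambda>t. f t + g t)"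
  unfolding poly_span_def
  by (metis mon_span_add mon_span_mono max.cobounded1 max.cobounded2)

lemma poly_span_mult: "poly_span f \<Longrightarrow> poly_span g \<Longrightarrow> poly_span (\<lambda>t. f t * g t)"
  unfolding poly_span_def using mon_span_mult by blast

lemma poly_span_const: "poly_span (\<lambda>_. c)"
  unfolding poly_span_def
  by (rule exI[of _ 0], rule mon_span_cong[OF mon_span_cmult[OF mon_span_mon[of "[]"], of 0 c]]) auto

lemma poly_span_sum: "(\<And>i. i \<in> I \<Longrightarrow> poly_span (f i)) \<Longrightarrow> poly_span (\<lambda>t. \<Sum>i\<in>I. f i t)"
  by (induction I rule: infinite_finite_induct) (auto intro: poly_span_const poly_span_add)

lemma poly_span_esym: "poly_span (\<lambda>t :: real ^ 'n::{finite,linorder}. esym UNIV n (($) t))"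
proof (induction n rule: less_induct)
  case (less n)
  show ?case
  proof (cases "n = 0")
    case False
    have ps: "poly_span (\<lambda>t :: real ^ 'n::_. \<Sum>j\<in>UNIV. (- t $ j) ^ m)" for m
    proof -
      have "poly_span (\<lambda>t :: real ^ 'n::_. ((-1) ^ m / 2) * (\<Sum>j\<in>UNIV. (t $ j) ^ m * tau 0 (t $ j)))"
        using ex_mon_span_power_sum[of m 0, where 'n='n]
        by (intro poly_span_mult poly_span_const) (simp add: poly_span_def)
      also have "(\<lambda>t :: real ^ 'n::_. ((-1) ^ m / 2) * (\<Sum>j\<in>UNIV. (t $ j) ^ m * tau 0 (t $ j))) =
          (\<lambda>t. \<Sum>j\<in>UNIV. (- t $ j) ^ m)"
        by (auto simp: sum_distrib_left power_minus[of "_ $ _"] intro!: sum.cong)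
      finally show ?thesis .
    qed
    \<comment> \<open>Newton's identity solved for \<open>esym UNIV n\<close>, with division by
      \<open>n\<close>.\<close>
    have "poly_span (\<lambda>t :: real ^ 'n::_. (- 1 / real n) *
        (\<Sum>m\<in>{1..n}. (\<Sum>j\<in>UNIV. (- t $ j) ^ m) * esym UNIV (n - m) (($) t)))"
      by (intro poly_span_mult poly_span_const poly_span_sum[of "{1..n}"] ps less) (use False in auto)
    also have "(\<lambda>t :: real ^ 'n::_. (- 1 / real n) *
        (\<Sum>m\<in>{1..n}. (\<Sum>j\<in>UNIV. (- t $ j) ^ m) * esym UNIV (n - m) (($) t))) = (\<lambda>t. esym UNIV n (($) t))"
      unfolding newton_identity[OF finite] using False by auto
    finally show ?thesis .
  qed (simp add: poly_span_const)
qed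

lemma poly_span_viete:
  assumes "real_polynomial_function R"
  shows "poly_span (\<lambda>t :: real ^ 'n::{finite,linorder}. R (viete t))"
  using assms
proof (induction R rule: real_polynomial_function.induct)
  case (linear f)
  have "f (viete t) = (\<Sum>i\<in>UNIV. f (axis i 1) * esym UNIV (Suc (rk i)) (($) t))" for t :: "real ^ 'n::_"
  proof -
    have "viete t = (\<Sum>i\<in>UNIV. (viete t $ i) *\<^sub>R axis i 1)"
      by (simp add: vec_eq_iff axis_def if_distrib[where f="\<lambda>x. _ * x"] cong: if_cong)
    then have "f (viete t) = (\<Sum>i\<in>UNIV. (viete t $ i) *\<^sub>R f (axis i 1))"
      using linear by (metis (no_types, lifting) bounded_linear.linear linear_scale linear_sum sum.cong)
    then show ?thesis by (simp add: viete_nth mult.commute)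
  qed
  then show ?case by (simp only:) (intro poly_span_sum poly_span_mult poly_span_const poly_span_esym)
qed (auto intro: poly_span_const poly_span_add poly_span_mult)

section \<open>From power sums to continuous functions\<close>

text \<open>\<open>T\<close> is any choice of eigenvalue coordinates. The functions
  \<open>mon ls (T m)\<close> are integrable because they agree on \<open>USp\<close> with the
  continuous functions \<open>cmon ls\<close>, and in the same way \<open>haar_loop\<close> becomes
  the loop hypothesis of \<open>loop_functional_unique\<close>.\<close>

lemma haar_mon_span:
  fixes M :: "(complex ^ ('n + 'n) ^ ('n + 'n::{finite,linorder})) measure"
    and T :: "complex ^ ('n + 'n) ^ ('n + 'n) \<Rightarrow> real ^ 'n::_"
  assumes haar: "normalized_haar_measure USp M"
    and T: "\<And>m k. m \<in> USp \<Longrightarrow> trp k m = complex_of_real (psum k (T m))" "\<And>m. m \<in> USp \<Longrightarrow> T m \<in> cube"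
    and f: "mon_span n f"
  shows "integrable M (\<lambda>m. f (T m))"
    and "(\<integral>m. f (T m) \<partial>M) * weyl_int (\<lambda>_ :: real ^ 'n::_. 1) = weyl_int f"
proof -
  interpret prob_space M using haar by (simp add: normalized_haar_measure_def)
  note sp = haar_space[OF haar]
  have cmon: "cmon ls m = complex_of_real (mon ls (T m))" if "m \<in> USp" for ls m
    by (induction ls) (simp_all add: T(1)[OF that])
  have cGam: "cGam k ls m = complex_of_real (Gam k ls (T m))" if "m \<in> USp" for k ls m
    by (induction ls) (simp_all add: T(1)[OF that] cmon[OF that])
  have cLam: "cLam k m = complex_of_real (Lam k (T m))" if "m \<in> USp" for k m
    by (simp add: cLam_def Lam_def T(1)[OF that])
  have int_mon: "integrable M (\<lambda>m. mon ls (T m))" for ls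
  proof -
    have "integrable M (\<lambda>m. Re (cmon ls m))"
      by (rule integrable_Re[OF haar_integrable[OF haar continuous_cmon]])
    also have "integrable M (\<lambda>m. Re (cmon ls m)) = integrable M (\<lambda>m. mon ls (T m))"
      by (intro Bochner_Integration.integrable_cong refl) (simp add: sp cmon)
    finally show ?thesis .
  qed
  have int: "integrable M (\<lambda>m. g (T m))" if g: "mon_span k g" for g k
  proof -
    obtain c where "g = (\<lambda>t. \<Sum>ks\<in>idx k. c ks * mon ks t)" using g by (auto simp: mon_span_def)
    then show ?thesis using int_mon by simp
  qed
  show "integrable M (\<lambda>m. f (T m))" by (rule int[OF f])
  show "(\<integral>m. f (T m) \<partial>M) * weyl_int (\<lambda>_ :: real ^ 'n::_. 1) = weyl_int f"
  proof (rule loop_functional_unique[where E = "\<lambda>f. \<integral>m. f (T m) \<partial>M", OF _ _ _ _ f])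
    show "(\<integral>m. 1 \<partial>M) = (1 :: real)" by (simp add: prob_space)
  next
    show "(\<integral>m. f (T m) \<partial>M) = (\<integral>m. g (T m) \<partial>M)" if "\<And>t. t \<in> cube \<Longrightarrow> f t = g t" for f g
      using that T(2) by (intro Bochner_Integration.integral_cong refl) (simp add: sp)
    show "(\<integral>m. loopf k ls (T m) \<partial>M) = 0" for k ls
    proof -
      have "complex_of_real (\<integral>m. loopf k ls (T m) \<partial>M) = (\<integral>m. complex_of_real (loopf k ls (T m)) \<partial>M)" by simp
      also have "\<dots> = (\<integral>m. cLam k m * cmon ls m - cGam k ls m \<partial>M)"
        by (intro Bochner_Integration.integral_cong refl) (simp add: sp cmon cGam cLam loopf_def)
      also have "\<dots> = 0" by (rule haar_loop[OF haar])
      finally show ?thesis by simp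
    qed
    show "(\<integral>m. (\<Sum>j\<in>J. c j * f j (T m)) \<partial>M) = (\<Sum>j\<in>J. c j * (\<integral>m. f j (T m) \<partial>M))"
      if "finite J" "\<And>j. j \<in> J \<Longrightarrow> \<exists>m. mon_span m (f j)" for J :: "(nat \<times> nat list) option set" and c and f :: "_ \<Rightarrow> real ^ 'n::_ \<Rightarrow> real"
    proof -
      have "integrable M (\<lambda>m. c j * f j (T m))" if "j \<in> J" for j
        using \<open>\<And>j. j \<in> J \<Longrightarrow> \<exists>m. mon_span m (f j)\<close>[OF that] int by auto
      then show ?thesis by (subst Bochner_Integration.integral_sum) auto
    qed
  qed
qed

lemma alcove_fun_exists:
  fixes F :: "complex ^ ('n + 'n) ^ ('n + 'n::{finite,linorder}) \<Rightarrow> complex"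
  assumes cont: "continuous_on USp F" and central: "central_on USp F"
  obtains f where "continuous_on sym_alcove f"
    "\<And>\<theta>. (\<forall>i. \<theta> $ i \<in> {0..pi}) \<Longrightarrow> f (viete (\<chi> i. 2 * cos (\<theta> $ i))) = F (torus_elt \<theta>)"
proof -
  \<comment> \<open>\<open>arccos\<close> picks the angles in \<open>{0..pi}\<close>. By centrality
    \<open>G\<close> is symmetric in the coordinates, hence constant on the fibres of
    \<open>viete\<close>.\<close>
  define G where "G t = F (torus_elt (\<chi> i. arccos (t $ i / 2)))" for t :: "real ^ 'n::_"
  have torus_cont: "continuous_on UNIV (torus_elt :: real ^ 'n::_ \<Rightarrow> complex ^ ('n + 'n) ^ ('n + 'n))"
  proof -
    have *: "continuous_on UNIV (\<lambda>\<theta> :: real ^ 'n::_. torus_elt \<theta> $ a $ b)" for a b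
      unfolding torus_elt_def
      by (cases a; cases b; cases "a = b") (auto intro!: continuous_intros)
    have "continuous_on UNIV (\<lambda>\<theta> :: real ^ 'n::_. \<chi> a b. torus_elt \<theta> $ a $ b)"
      by (intro continuous_on_vec_lambda *)
    moreover have "(\<lambda>\<theta> :: real ^ 'n::_. \<chi> a b. torus_elt \<theta> $ a $ b) = torus_elt"
      by (simp add: fun_eq_iff vec_eq_iff)
    ultimately show ?thesis by simp
  qed
  have cG: "continuous_on cube G"
    unfolding G_def
  proof (rule continuous_on_compose2[OF cont])
    show "continuous_on cube (\<lambda>t :: real ^ 'n::_. torus_elt (\<chi> i. arccos (t $ i / 2)))"
      by (intro continuous_on_compose2[OF torus_cont] continuous_intros continuous_on_arccos) (auto simp: cube_def)
  qed (auto simp: torus_elt_USp)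
  have inv: "G s = G t" if st: "viete s = viete t" for s t :: "real ^ 'n::_"
  proof -
    obtain p where p: "p permutes UNIV" "\<And>i. s $ i = t $ p i" using viete_eq_imp_permutes[OF st] by blast
    have "(\<chi> i. arccos (s $ i / 2)) = (\<chi> i. (\<chi> i. arccos (t $ i / 2)) $ p i)" by (simp add: p(2))
    then show ?thesis
      unfolding G_def using central_torus_permute[OF central p(1), of "\<chi> i. arccos (t $ i / 2)"] by simp
  qed
  define f where "f s = G (SOME t. t \<in> cube \<and> viete t = s)" for s
  have f: "f (viete t) = G t" if "t \<in> cube" for t
  proof -
    have "(SOME u. u \<in> cube \<and> viete u = viete t) \<in> cube \<and> viete (SOME u. u \<in> cube \<and> viete u = viete t) = viete t"
      by (rule someI[of _ t]) (use that in simp)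
    then show ?thesis unfolding f_def by (intro inv) blast
  qed
  show thesis
  proof (rule that)
    show "continuous_on sym_alcove f"
      \<comment> \<open>\<open>viete\<close> maps closed subsets of the compact cube to compact
        sets, so \<open>f\<close> inherits continuity from \<open>G\<close> as on a
        quotient.\<close>
      unfolding continuous_on_closed_vimage[OF compact_imp_closed[OF compact_sym_alcove]]
    proof (intro allI impI)
      fix B :: "complex set" assume "closed B"
      have "closed (G -` B \<inter> cube)"
        using cG \<open>closed B\<close> continuous_on_closed_vimage[OF compact_imp_closed[OF compact_cube]] by blast
      then have "compact (cube \<inter> (G -` B \<inter> cube))" by (intro compact_Int_closed compact_cube)
      then have "compact (viete ` (cube \<inter> (G -` B \<inter> cube)))"
        by (intro compact_continuous_image continuous_viete)
      moreover have "f -` B \<inter> sym_alcove = viete ` (cube \<inter> (G -` B \<inter> cube))"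
        using f by (auto simp: sym_alcove_eq)
      ultimately show "closed (f -` B \<inter> sym_alcove)" by (simp add: compact_imp_closed)
    qed
    fix \<theta> :: "real ^ 'n::_" assume \<theta>: "\<forall>i. \<theta> $ i \<in> {0..pi}"
    have "(\<chi> i. 2 * cos (\<theta> $ i)) \<in> cube" by (simp add: cube_def)
    moreover have "(\<chi> i. arccos (2 * cos (\<theta> $ i) / 2)) = \<theta>" using \<theta> by (simp add: vec_eq_iff arccos_cos)
    ultimately show "f (viete (\<chi> i. 2 * cos (\<theta> $ i))) = F (torus_elt \<theta>)" by (simp add: f G_def)
  qed
qed

lemma cube_cos:
  assumes "t \<in> cube"
  obtains \<theta> where "\<forall>i. \<theta> $ i \<in> {0..pi}" "t = (\<chi> i. 2 * cos (\<theta> $ i))"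
proof
  have t: "-1 \<le> t $ i / 2" "t $ i / 2 \<le> 1" for i using assms by (auto simp: cube_def)
  show "\<forall>i. (\<chi> i. arccos (t $ i / 2)) $ i \<in> {0..pi}" using t by (simp add: arccos_lbound arccos_ubound)
  show "t = (\<chi> i. 2 * cos ((\<chi> i. arccos (t $ i / 2)) $ i))" using t by (simp add: vec_eq_iff cos_arccos)
qed

lemma alcove_fun:
  fixes F :: "complex ^ ('n + 'n) ^ ('n + 'n::{finite,linorder}) \<Rightarrow> complex"
  assumes cont: "continuous_on USp F" and central: "central_on USp F"
  shows "continuous_on sym_alcove (alcove_fun F)"
    and "\<And>\<theta>. (\<forall>i. \<theta> $ i \<in> {0..pi}) \<Longrightarrow> alcove_fun F (viete (\<chi> i. 2 * cos (\<theta> $ i))) = F (torus_elt \<theta>)"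
proof -
  let ?P = "\<lambda>f. f \<in> extensional sym_alcove \<and> continuous_on sym_alcove f \<and>
     (\<forall>\<theta>. (\<forall>i. \<theta> $ i \<in> {0..pi}) \<longrightarrow> f (viete (\<chi> i. 2 * cos (\<theta> $ i))) = F (torus_elt \<theta>))"
  have "\<exists>!f. ?P f"
  proof -
    obtain f where f: "continuous_on sym_alcove f"
      "\<And>\<theta>. (\<forall>i. \<theta> $ i \<in> {0..pi}) \<Longrightarrow> f (viete (\<chi> i. 2 * cos (\<theta> $ i))) = F (torus_elt \<theta>)"
      using alcove_fun_exists[OF assms] by blast
    have "(\<chi> i. 2 * cos (\<theta> $ i)) \<in> cube" for \<theta> :: "real ^ 'n::_" by (simp add: cube_def)
    then have inS: "viete (\<chi> i. 2 * cos (\<theta> $ i)) \<in> sym_alcove" for \<theta> :: "real ^ 'n::_"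
      by (auto simp: sym_alcove_eq)
    have cr: "continuous_on sym_alcove (restrict f sym_alcove)"
      using f(1) continuous_on_cong[OF refl, of sym_alcove "restrict f sym_alcove" f] by simp
    have "?P (restrict f sym_alcove)" using cr f(2) inS by simp
    moreover have "g = h" if "?P g" "?P h" for g h
    proof (rule extensionalityI)
      fix s assume "s \<in> (sym_alcove :: (real ^ 'n::_) set)"
      then obtain t where t: "t \<in> cube" "s = viete t" by (auto simp: sym_alcove_eq)
      then obtain \<theta> where "\<forall>i. \<theta> $ i \<in> {0..pi}" "t = (\<chi> i. 2 * cos (\<theta> $ i))" using cube_cos by blast
      then show "g s = h s" using that t(2) by simp
    qed (use that in auto)
    ultimately show ?thesis by blast
  qed
  from theI'[OF this] have P: "?P (alcove_fun F)" unfolding alcove_fun_def .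
  show "continuous_on sym_alcove (alcove_fun F)" using P by blast
  show "alcove_fun F (viete (\<chi> i. 2 * cos (\<theta> $ i))) = F (torus_elt \<theta>)" if "\<forall>i. \<theta> $ i \<in> {0..pi}" for \<theta>
    using P that by blast
qed

lemma continuous_nu: "continuous_on S nu"
  unfolding nu_def mpoly_eval_def by (intro continuous_intros) auto

lemma nu_nonneg: "s \<in> sym_alcove \<Longrightarrow> 0 \<le> nu s"
proof -
  assume "s \<in> sym_alcove"
  then obtain t where t: "t \<in> cube" "s = viete t" by (auto simp: sym_alcove_eq)
  have "0 \<le> (\<Prod>j\<in>UNIV. sqrt (4 - (t $ j)\<^sup>2))"
  proof (intro prod_nonneg ballI)
    fix j
    have "(t $ j)\<^sup>2 \<le> 2\<^sup>2" using t(1) abs_le_square_iff[of "t $ j" 2] by (auto simp: cube_def abs_le_iff minus_le_iff)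
    then show "0 \<le> sqrt (4 - (t $ j)\<^sup>2)" by simp
  qed
  then show ?thesis unfolding t(2) nu_viete by simp
qed

text \<open>\<open>nu\<close> supplies the second factor \<open>\<bar>vdm t\<bar>\<close> and the
  semicircle weights, so the integrand on the cube is \<open>weyl_w\<close> divided by
  \<open>(2 * pi) ^ CARD('n)\<close>. Together with the g! sheets of \<open>viete\<close> this is
  exactly the mass found in \<open>weyl_int_1\<close>.\<close>

lemma integral_nu:
  fixes \<psi> :: "real ^ 'n::{finite,linorder} \<Rightarrow> real"
  assumes cont: "continuous_on sym_alcove \<psi>"
  shows "(LINT s:sym_alcove|lborel. \<psi> s * nu s) * weyl_int (\<lambda>_ :: real ^ 'n::_. 1) = weyl_int (\<lambda>t. \<psi> (viete t))"
proof -
  have "fact CARD('n) * (LINT s:sym_alcove|lborel. \<psi> s * nu s) =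
      (LINT t:cube|lborel. \<bar>vdm t\<bar> * (\<psi> (viete t) * nu (viete t)))"
    by (rule integral_sym_alcove) (intro continuous_intros cont continuous_nu)
  also have "\<dots> = (\<integral>t. (1 / (2 * pi) ^ CARD('n)) * (weyl_w t * \<psi> (viete t)) \<partial>lborel)"
    unfolding set_lebesgue_integral_def
  proof (intro Bochner_Integration.integral_cong refl)
    fix t :: "real ^ 'n::_"
    show "indicator cube t *\<^sub>R (\<bar>vdm t\<bar> * (\<psi> (viete t) * nu (viete t))) =
        (1 / (2 * pi) ^ CARD('n)) * (weyl_w t * \<psi> (viete t))"
    proof (cases "t \<in> cube")
      case True
      then have "(\<Prod>j\<in>UNIV. sqrt (4 - (t $ j)\<^sup>2)) = (\<Prod>j\<in>UNIV. arc (t $ j))"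
        by (intro prod.cong refl) (simp add: cube_def arc_eq)
      moreover have "(vdm t)\<^sup>2 = \<bar>vdm t\<bar> * \<bar>vdm t\<bar>" by (simp add: power2_eq_square)
      ultimately show ?thesis using True by (simp add: nu_viete weyl_w_def mult_ac)
    qed (simp add: weyl_w_eq_0)
  qed
  also have "\<dots> = (1 / (2 * pi) ^ CARD('n)) * weyl_int (\<lambda>t. \<psi> (viete t))"
    by (simp add: weyl_int_def)
  finally show ?thesis by (simp add: weyl_int_1 divide_simps mult_ac)
qed

text \<open>Uniform approximation of \<open>\<psi>\<close> by polynomials in the coordinates \<open>s\<^sub>1, \<dots>, s\<^sub>g\<close>.\<close>

lemma haar_integral_real:
  fixes M :: "(complex ^ ('n + 'n) ^ ('n + 'n::{finite,linorder})) measure"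
    and T :: "complex ^ ('n + 'n) ^ ('n + 'n) \<Rightarrow> real ^ 'n::_"
  assumes haar: "normalized_haar_measure USp M"
    and T: "\<And>m k. m \<in> USp \<Longrightarrow> trp k m = complex_of_real (psum k (T m))" "\<And>m. m \<in> USp \<Longrightarrow> T m \<in> cube"
    and cont: "continuous_on sym_alcove \<psi>" and int: "integrable M (\<lambda>m. \<psi> (viete (T m)))"
  shows "(\<integral>m. \<psi> (viete (T m)) \<partial>M) = (LINT s:sym_alcove|lborel. \<psi> s * nu s)"
proof -
  interpret prob_space M using haar by (simp add: normalized_haar_measure_def)
  let ?w = "weyl_int (\<lambda>_ :: real ^ 'n::_. 1)"
  have w: "?w > 0" by (simp add: weyl_int_1)
  have si: "set_integrable lborel sym_alcove (\<lambda>s. \<phi> s * nu s)" if "continuous_on sym_alcove \<phi>"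
    for \<phi> :: "real ^ 'n::_ \<Rightarrow> real"
    unfolding set_integrable_def
    by (intro borel_integrable_compact compact_sym_alcove continuous_intros that continuous_nu)
  \<comment> \<open>Like \<open>M\<close>, the density \<open>nu\<close> has total mass one, so a
    uniform error \<open>e\<close> contributes at most \<open>e\<close> on each side.\<close>
  have one: "(LINT s:(sym_alcove :: (real ^ 'n::_) set)|lborel. 1 * nu s) = 1"
    using integral_nu[of "\<lambda>_ :: real ^ 'n::_. 1"] w by simp
  have bound: "\<bar>(\<integral>m. \<psi> (viete (T m)) \<partial>M) - (LINT s:sym_alcove|lborel. \<psi> s * nu s)\<bar> \<le> 2 * e" if e: "e > 0" for e
  proof -
    obtain R where R: "real_polynomial_function R" "\<And>s. s \<in> sym_alcove \<Longrightarrow> \<bar>\<psi> s - R s\<bar> < e"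
      using Stone_Weierstrass_real_polynomial_function[OF compact_sym_alcove cont e] by blast
    obtain n where n: "mon_span n (\<lambda>t. R (viete t))"
      using poly_span_viete[OF R(1)] by (auto simp: poly_span_def)
    have cR: "continuous_on S R" for S
      using R(1) by (simp add: continuous_on_polymonial_function real_polynomial_function_eq)
    have intR: "integrable M (\<lambda>m. R (viete (T m)))"
      by (rule haar_mon_span(1)[OF haar T n])
    have "(\<integral>m. R (viete (T m)) \<partial>M) * ?w = (LINT s:sym_alcove|lborel. R s * nu s) * ?w"
      unfolding integral_nu[OF cR] by (rule haar_mon_span(2)[OF haar T n])
    then have eq: "(\<integral>m. R (viete (T m)) \<partial>M) = (LINT s:sym_alcove|lborel. R s * nu s)"
      using w by simp
    have inS: "viete (T m) \<in> sym_alcove" if "m \<in> USp" for m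
      using T(2)[OF that] by (auto simp: sym_alcove_eq)
    have "\<bar>(\<integral>m. \<psi> (viete (T m)) \<partial>M) - (\<integral>m. R (viete (T m)) \<partial>M)\<bar> \<le> (\<integral>m. e \<partial>M)"
    proof -
      have "\<bar>\<integral>m. \<psi> (viete (T m)) - R (viete (T m)) \<partial>M\<bar> \<le> (\<integral>m. \<bar>\<psi> (viete (T m)) - R (viete (T m))\<bar> \<partial>M)"
        by (rule integral_abs_bound)
      also have "\<dots> \<le> (\<integral>m. e \<partial>M)"
        using R(2)[OF inS] haar_space[OF haar]
        by (intro Bochner_Integration.integral_mono integrable_abs Bochner_Integration.integrable_diff int intR)
          (auto intro: less_imp_le)
      finally show ?thesis using int intR by simp
    qed
    then have 1: "\<bar>(\<integral>m. \<psi> (viete (T m)) \<partial>M) - (\<integral>m. R (viete (T m)) \<partial>M)\<bar> \<le> e"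
      by (simp add: prob_space)
    have 2: "\<bar>(LINT s:sym_alcove|lborel. \<psi> s * nu s) - (LINT s:sym_alcove|lborel. R s * nu s)\<bar> \<le> e"
    proof -
      have "\<bar>(LINT s:sym_alcove|lborel. \<psi> s * nu s) - (LINT s:sym_alcove|lborel. R s * nu s)\<bar> =
          \<bar>LINT s:sym_alcove|lborel. (\<psi> s - R s) * nu s\<bar>"
        using set_integral_diff(2)[OF si[OF cont] si[OF cR]] by (simp add: left_diff_distrib)
      also have "\<dots> \<le> (LINT s|lborel. \<bar>indicator sym_alcove s *\<^sub>R ((\<psi> s - R s) * nu s)\<bar>)"
        unfolding set_lebesgue_integral_def by (rule integral_abs_bound)
      also have "\<dots> \<le> (LINT s|lborel. e * (indicator (sym_alcove :: (real ^ 'n::_) set) s *\<^sub>R (1 * nu s)))"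
      proof (rule Bochner_Integration.integral_mono)
        have "set_integrable lborel sym_alcove (\<lambda>s. (\<psi> s - R s) * nu s)"
          by (intro si continuous_intros cont cR)
        then show "integrable lborel (\<lambda>s. \<bar>indicator sym_alcove s *\<^sub>R ((\<psi> s - R s) * nu s)\<bar>)"
          unfolding set_integrable_def by (rule integrable_abs)
        show "integrable lborel (\<lambda>s :: real ^ 'n::_. e * (indicator sym_alcove s *\<^sub>R (1 * nu s)))"
          using si[of "\<lambda>_. 1"] unfolding set_integrable_def by (intro integrable_mult_right) auto
        fix s :: "real ^ 'n::_"
        show "\<bar>indicator sym_alcove s *\<^sub>R ((\<psi> s - R s) * nu s)\<bar> \<le> e * (indicator sym_alcove s *\<^sub>R (1 * nu s))"
          using R(2)[of s] nu_nonneg[of s]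
          by (cases "s \<in> sym_alcove") (auto simp: abs_mult intro!: mult_right_mono)
      qed
      also have "\<dots> = e * (LINT s:(sym_alcove :: (real ^ 'n::_) set)|lborel. 1 * nu s)"
        unfolding set_lebesgue_integral_def by simp
      finally show ?thesis unfolding one by simp
    qed
    from 1 2 eq show ?thesis by linarith
  qed
  have "\<bar>(\<integral>m. \<psi> (viete (T m)) \<partial>M) - (LINT s:sym_alcove|lborel. \<psi> s * nu s)\<bar> \<le> 0"
  proof (rule field_le_epsilon)
    fix e :: real assume "0 < e"
    with bound[of "e / 2"]
    show "\<bar>(\<integral>m. \<psi> (viete (T m)) \<partial>M) - (LINT s:sym_alcove|lborel. \<psi> s * nu s)\<bar> \<le> 0 + e" by simp
  qed
  then show ?thesis by simp
qed

theorem proposition8p1: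
  fixes F :: "complex ^ ('n + 'n) ^ ('n + 'n::{finite,linorder}) \<Rightarrow> complex"
    and M :: "(complex ^ ('n + 'n) ^ ('n + 'n::{finite,linorder})) measure"
  assumes haar: "normalized_haar_measure USp M"
    and cont: "continuous_on USp F"
    and central: "central_on USp F"
  shows "(LINT m|M. F m) =
         (LINT s:sym_alcove|lborel. alcove_fun F s * complex_of_real (nu s))"
proof -
  let ?f = "alcove_fun F"
  have "\<forall>m\<in>USp. \<exists>\<theta> :: real ^ 'n::_. (\<forall>i. \<theta> $ i \<in> {0..pi}) \<and>
      (\<forall>k. trp k m = complex_of_real (psum k (\<chi> i. 2 * cos (\<theta> $ i)))) \<and> F m = F (torus_elt \<theta>)"
  proof
    fix m :: "complex ^ ('n + 'n) ^ ('n + 'n)" assume "m \<in> USp"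
    from USp_eigenangles[OF this] obtain \<theta> :: "real ^ 'n::_" where "\<And>i. \<theta> $ i \<in> {0..pi}"
      "\<And>k. trp k m = complex_of_real (psum k (\<chi> i. 2 * cos (\<theta> $ i)))"
      "\<And>F :: _ \<Rightarrow> complex. central_on USp F \<Longrightarrow> F m = F (torus_elt \<theta>)" by blast
    then show "\<exists>\<theta> :: real ^ 'n::_. (\<forall>i. \<theta> $ i \<in> {0..pi}) \<and>
      (\<forall>k. trp k m = complex_of_real (psum k (\<chi> i. 2 * cos (\<theta> $ i)))) \<and> F m = F (torus_elt \<theta>)"
      using central by blast
  qed
  \<comment> \<open>The eigenangles are chosen pointwise and carry no measurability; the composite
    \<open>?f (viete (T m))\<close> is integrable because it equals \<open>F m\<close>.\<close>
  from bchoice[OF this] obtain \<Theta> :: "_ \<Rightarrow> real ^ 'n::_" where \<Theta>: "\<forall>m\<in>USp. (\<forall>i. \<Theta> m $ i \<in> {0..pi}) \<and>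
      (\<forall>k. trp k m = complex_of_real (psum k (\<chi> i. 2 * cos (\<Theta> m $ i)))) \<and> F m = F (torus_elt (\<Theta> m))"
    by blast
  define T where "T m = (\<chi> i. 2 * cos (\<Theta> m $ i))" for m
  have T: "trp k m = complex_of_real (psum k (T m))" "T m \<in> cube" if "m \<in> USp" for m k
    using \<Theta> that by (auto simp: T_def cube_def)
  have F: "?f (viete (T m)) = F m" if "m \<in> USp" for m
    using \<Theta> that alcove_fun(2)[OF cont central, of "\<Theta> m"] by (simp add: T_def)
  have intF: "integrable M F" by (rule haar_integrable[OF haar cont])
  have "integrable M F = integrable M (\<lambda>m. ?f (viete (T m)))"
    by (intro Bochner_Integration.integrable_cong refl) (simp add: F haar_space[OF haar])
  then have "integrable M (\<lambda>m. ?f (viete (T m)))" using intF by simp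
  note int = integrable_Re[OF this] integrable_Im[OF this]
  have cf: "continuous_on sym_alcove (\<lambda>s. Re (?f s))" "continuous_on sym_alcove (\<lambda>s. Im (?f s))"
    by (intro continuous_intros alcove_fun(1)[OF cont central])+
  have "set_integrable lborel sym_alcove (\<lambda>s. ?f s * complex_of_real (nu s))"
    unfolding set_integrable_def
    by (intro borel_integrable_compact compact_sym_alcove continuous_intros continuous_nu alcove_fun(1)[OF cont central])
  then have R: "Re (LINT s:sym_alcove|lborel. ?f s * complex_of_real (nu s)) =
      (LINT s:sym_alcove|lborel. Re (?f s) * nu s)"
    and I: "Im (LINT s:sym_alcove|lborel. ?f s * complex_of_real (nu s)) =
      (LINT s:sym_alcove|lborel. Im (?f s) * nu s)"
    unfolding set_integrable_def set_lebesgue_integral_def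
    by (simp_all flip: integral_Re integral_Im)
  have "Re (LINT m|M. F m) = (\<integral>m. Re (?f (viete (T m))) \<partial>M)"
    unfolding integral_Re[OF intF, symmetric]
    by (intro Bochner_Integration.integral_cong refl) (simp add: F haar_space[OF haar])
  moreover have "Im (LINT m|M. F m) = (\<integral>m. Im (?f (viete (T m))) \<partial>M)"
    unfolding integral_Im[OF intF, symmetric]
    by (intro Bochner_Integration.integral_cong refl) (simp add: F haar_space[OF haar])
  ultimately show ?thesis
    using haar_integral_real[OF haar T cf(1) int(1)] haar_integral_real[OF haar T cf(2) int(2)]
    by (simp add: complex_eq_iff R I)
qed

end
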